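(* There exists an $O\left((k^n)^2\right)$-time algorithm which, given a function $f : [k]^n \rightarrow \overline{\mathbb{R}}$ ($k,n$ positive integers), determines whether $f$ has a $k$-submodular relaxation, and constructs a $k$-submodular relaxation $g$ of $f$ if one exists, where the constructed $g$ has the following properties: (1) If $f$ is integer valued, then $g$ is half-integer-valued. (2) If $n = 2$, then for every $k$-submodular relaxation $g'$ of $f$ it holds that $g(x) \geq g'(x)$ for all $x \in \mathrm{dom}\, g$; namely, $g$ is the unique maximal $k$-submodular relaxation of $f$.
   Context: Notation: $[k] := \{1,2,\dots,k\}$, $[0,k] := \{0,1,\dots,k\}$, $\overline{\mathbb{R}} := \mathbb{R} \cup \{+\infty\}$, with $a < +\infty$ and $a + \infty = +\infty$ for $a \in \mathbb{R}$ (and $(+\infty)+(+\infty)=+\infty$). For a function $f : D^n \to \overline{\mathbb{R}}$, $\mathrm{dom}\, f := \{x \in D^n \mid f(x) < +\infty\}$. Binary operations $\sqcap, \sqcup$ on $[0,k]^n$ are defined componentwise: $(x \sqcap y)_i := x_i$ if $x_i = y_i$, and $0$ if $x_i \neq y_i$; $(x \sqcup y)_i := x_i$ if $x_i = y_i$, $0$ if $0 \neq x_i \neq y_i \neq 0$, $y_i$ if $x_i = 0$, and $x_i$ if $y_i = 0$. A function $g : [0,k]^n \to \overline{\mathbb{R}}$ is $k$-submodular if $g(x) + g(y) \geq g(x \sqcap y) + g(x \sqcup y)$ for all $x, y \in [0,k]^n$ (the inequality holds trivially if $g(x) = +\infty$ or $g(y) = +\infty$). A $k$-submodular relaxation of $f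 : [k]^n \to \overline{\mathbb{R}}$ is a $k$-submodular function $g : [0,k]^n \to \overline{\mathbb{R}}$ whose restriction to $[k]^n$ equals $f$. A function with values in $\overline{\mathbb{R}}$ is called integer valued (resp. half-integer-valued) if all its finite values lie in $\mathbb{Z}$ (resp. in $\frac{1}{2}\mathbb{Z}$). The input $f$ is given as the table of its $k^n$ values. *)

theory Defs
  imports "HOL-Library.Extended_Real"
begin

section \<open>k-submodular relaxations\<close>

text \<open>
  Vectors are lists, so that the dimension can be quantified over: \<open>[k]\<^sup>n\<close> is \<open>cube {1..k} n\<close> and
  \<open>[0,k]\<^sup>n\<close> is \<open>cube {0..k} n\<close>.  Only the values of a function on the relevant cube matter.
\<close>

definition cube :: "nat set \<Rightarrow> nat \<Rightarrow> nat list set" where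
  "cube A n = {x. set x \<subseteq> A \<and> length x = n}"

definition kmeet :: "nat list \<Rightarrow> nat list \<Rightarrow> nat list" where
  "kmeet = map2 (\<lambda>a b. if a = b then a else 0)"

definition kjoin :: "nat list \<Rightarrow> nat list \<Rightarrow> nat list" where
  "kjoin = map2 (\<lambda>a b. if a = b then a else if a = 0 then b else if b = 0 then a else 0)"

text \<open>The value \<open>-\<infinity>\<close> of \<^typ>\<open>ereal\<close> is excluded: functions take values in \<open>\<real> \<union> {+\<infinity>}\<close>.\<close>

definition Rbar_valued :: "nat list set \<Rightarrow> (nat list \<Rightarrow> ereal) \<Rightarrow> bool" where
  "Rbar_valued D f \<longleftrightarrow> (\<forall>x\<in>D. f x \<noteq> -\<infinity>)"

definition dom_on :: "nat list set \<Rightarrow> (nat list \<Rightarrow> ereal) \<Rightarrow> nat list set" where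
  "dom_on D f = {x \<in> D. f x < \<infinity>}"

definition ksubmodular :: "nat \<Rightarrow> nat \<Rightarrow> (nat list \<Rightarrow> ereal) \<Rightarrow> bool" where
  "ksubmodular k n g \<longleftrightarrow>
     Rbar_valued (cube {0..k} n) g \<and>
     (\<forall>x \<in> cube {0..k} n. \<forall>y \<in> cube {0..k} n. g x + g y \<ge> g (kmeet x y) + g (kjoin x y))"

definition relaxation :: "nat \<Rightarrow> nat \<Rightarrow> (nat list \<Rightarrow> ereal) \<Rightarrow> (nat list \<Rightarrow> ereal) \<Rightarrow> bool" where
  "relaxation k n f g \<longleftrightarrow> ksubmodular k n g \<and> (\<forall>x \<in> cube {1..k} n. g x = f x)"

text \<open>Maximality is with respect to the pointwise order on \<open>[0,k]\<^sup>n\<close>.\<close>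

definition maximal_relaxation :: "nat \<Rightarrow> nat \<Rightarrow> (nat list \<Rightarrow> ereal) \<Rightarrow> (nat list \<Rightarrow> ereal) \<Rightarrow> bool" where
  "maximal_relaxation k n f g \<longleftrightarrow>
     relaxation k n f g \<and>
     (\<forall>h. relaxation k n f h \<and> (\<forall>x \<in> cube {0..k} n. g x \<le> h x) \<longrightarrow>
          (\<forall>x \<in> cube {0..k} n. h x = g x))"

definition integer_valued :: "nat list set \<Rightarrow> (nat list \<Rightarrow> ereal) \<Rightarrow> bool" where
  "integer_valued D f \<longleftrightarrow> (\<forall>x \<in> dom_on D f. f x \<in> ereal ` \<int>)"

definition half_integer_valued :: "nat list set \<Rightarrow> (nat list \<Rightarrow> ereal) \<Rightarrow> bool" where
  "half_integer_valued D f \<longleftrightarrow> (\<forall>x \<in> dom_on D f. f x \<in> ereal ` {r. 2 * r \<in> \<int>})"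

section \<open>The machine model\<close>

text \<open>
  Algorithms are programs of a structured language for a random access machine with two sorts of
  memory: natural numbers (indices) and extended reals (function values).  Each sort is organised in
  arrays; the array names are fixed in the program text, the positions are computed.  A scalar
  variable is a cell with a constant position.  The only arithmetic is addition and truncated
  subtraction of indices, and addition, subtraction and halving of values; both sorts can be
  compared.  A value cannot be turned into an index, and there is no rounding.
\<close>

datatype iexp =
    INum nat
  | ICell nat iexp
  | IAdd iexp iexp
  | ISub iexp iexp

datatype vexp =
    VZero
  | VInf
  | VCell nat iexp
  | VAdd vexp vexp
  | VSub vexp vexp
  | VHalf vexp

datatype test =
    ILess iexp iexp
  | VLess vexp vexp
  | Not test
  | And test test

datatype com =
    Skip
  | ISet nat iexp iexp
  | VSet nat iexp vexp
  | Seq com com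
  | If test com com
  | While test com

record state =
  ints :: "nat \<Rightarrow> nat \<Rightarrow> nat"
  vals :: "nat \<Rightarrow> nat \<Rightarrow> ereal"

primrec ival :: "iexp \<Rightarrow> state \<Rightarrow> nat" where
  "ival (INum m) s = m"
| "ival (ICell a e) s = ints s a (ival e s)"
| "ival (IAdd e1 e2) s = ival e1 s + ival e2 s"
| "ival (ISub e1 e2) s = ival e1 s - ival e2 s"

primrec vval :: "vexp \<Rightarrow> state \<Rightarrow> ereal" where
  "vval VZero s = 0"
| "vval VInf s = \<infinity>"
| "vval (VCell a e) s = vals s a (ival e s)"
| "vval (VAdd v1 v2) s = vval v1 s + vval v2 s"
| "vval (VSub v1 v2) s = vval v1 s - vval v2 s"
| "vval (VHalf v) s = vval v s / 2"

primrec holds :: "test \<Rightarrow> state \<Rightarrow> bool" where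
  "holds (ILess e1 e2) s \<longleftrightarrow> ival e1 s < ival e2 s"
| "holds (VLess v1 v2) s \<longleftrightarrow> vval v1 s < vval v2 s"
| "holds (Not b) s \<longleftrightarrow> \<not> holds b s"
| "holds (And b1 b2) s \<longleftrightarrow> holds b1 s \<and> holds b2 s"

definition upd :: "(nat \<Rightarrow> nat \<Rightarrow> 'v) \<Rightarrow> nat \<Rightarrow> nat \<Rightarrow> 'v \<Rightarrow> nat \<Rightarrow> nat \<Rightarrow> 'v" where
  "upd m a i v = m(a := (m a)(i := v))"

text \<open>
  \<open>exec c s t s'\<close>: started in \<open>s\<close>, the program \<open>c\<close> terminates in \<open>s'\<close> after \<open>t\<close> steps.  Every
  assignment and every evaluation of a test counts as one step.  The number of elementary operations
  in an expression is bounded by a constant that depends only on the program text, so up to such a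
  constant factor this is the number of elementary operations.
\<close>

inductive exec :: "com \<Rightarrow> state \<Rightarrow> nat \<Rightarrow> state \<Rightarrow> bool" where
  Skip: "exec Skip s 1 s"
| ISet: "exec (ISet a i e) s 1 (s\<lparr>ints := upd (ints s) a (ival i s) (ival e s)\<rparr>)"
| VSet: "exec (VSet a i v) s 1 (s\<lparr>vals := upd (vals s) a (ival i s) (vval v s)\<rparr>)"
| Seq: "exec c1 s1 t1 s2 \<Longrightarrow> exec c2 s2 t2 s3 \<Longrightarrow> exec (Seq c1 c2) s1 (t1 + t2) s3"
| IfTrue: "holds b s \<Longrightarrow> exec c1 s t s' \<Longrightarrow> exec (If b c1 c2) s (Suc t) s'"
| IfFalse: "\<not> holds b s \<Longrightarrow> exec c2 s t s' \<Longrightarrow> exec (If b c1 c2) s (Suc t) s'"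
| WhileFalse: "\<not> holds b s \<Longrightarrow> exec (While b c) s 1 s"
| WhileTrue: "holds b s1 \<Longrightarrow> exec c s1 t1 s2 \<Longrightarrow> exec (While b c) s2 t2 s3 \<Longrightarrow>
    exec (While b c) s1 (Suc (t1 + t2)) s3"

lemma exec_deterministic:
  "exec c s t s' \<Longrightarrow> exec c s u s'' \<Longrightarrow> u = t \<and> s'' = s'"
proof (induction arbitrary: u s'' rule: exec.induct)
  case (Seq c1 s1 t1 s2 c2 t2 s3)
  from Seq.prems show ?case by (cases rule: exec.cases) (use Seq.IH in blast)+
next
  case (WhileTrue b s1 c t1 s2 t2 s3)
  from WhileTrue.prems show ?case
    by (cases rule: exec.cases) (use WhileTrue.IH WhileTrue.hyps in blast)+
qed (erule exec.cases; simp)+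

section \<open>Input and output conventions\<close>

text \<open>
  A function on \<open>[0,k]\<^sup>n\<close> is tabulated at the positions \<open>pos k x\<close>, the numbers with base \<open>k + 1\<close>
  digits \<open>x\<close> (least significant digit first).  The table of \<open>f\<close> occupies the positions of
  the \<open>k\<^sup>n\<close> points of \<open>[k]\<^sup>n\<close>; the other value cells initially contain \<open>+\<infinity>\<close>,
  the value of a function outside its domain.  For \<open>k \<ge> 2\<close> writing all \<open>(k + 1)\<^sup>n\<close> cells would take
  \<open>O((k\<^sup>n)\<^sup>2)\<close> steps anyway; for \<open>k = 1\<close> a table of \<open>2\<^sup>n\<close> entries cannot be written in constant time.
\<close>

definition pos :: "nat \<Rightarrow> nat list \<Rightarrow> nat" where
  "pos k x = horner_sum id (k + 1) x"

definition table :: "nat \<Rightarrow> nat \<Rightarrow> (nat list \<Rightarrow> ereal) \<Rightarrow> nat \<Rightarrow> ereal" where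
  "table k n f i =
     (if i \<in> pos k ` cube {1..k} n then f (inv_into (cube {1..k} n) (pos k) i) else \<infinity>)"

text \<open>
  Index array 0 holds \<open>k\<close>, index array 1 holds \<open>n\<close>, index array 2 receives the answer, and value
  array 0 holds the table of \<open>f\<close>, to be completed to the table of a relaxation.
\<close>

definition input :: "nat \<Rightarrow> nat \<Rightarrow> (nat list \<Rightarrow> ereal) \<Rightarrow> state" where
  "input k n f =
     \<lparr>ints = upd (upd (\<lambda>a i. 0) 0 0 k) 1 0 n, vals = (\<lambda>a i. \<infinity>)(0 := table k n f)\<rparr>"

definition accepts :: "state \<Rightarrow> bool" where
  "accepts s \<longleftrightarrow> ints s 2 0 = 1"

definition result :: "nat \<Rightarrow> state \<Rightarrow> nat list \<Rightarrow> ereal" where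
  "result k s x = vals s 0 (pos k x)"

lemma pos_inj: "inj_on (pos k) (cube {0..k} n)"
proof (induction n)
  case 0
  show ?case by (auto simp: cube_def inj_on_def)
next
  case (Suc n)
  show ?case
  proof (rule inj_onI)
    fix x y assume x: "x \<in> cube {0..k} (Suc n)" and y: "y \<in> cube {0..k} (Suc n)"
      and eq: "pos k x = pos k y"
    from x obtain a xs where xs: "x = a # xs" "a < Suc k" "xs \<in> cube {0..k} n"
      by (cases x) (auto simp: cube_def)
    from y obtain b ys where ys: "y = b # ys" "b < Suc k" "ys \<in> cube {0..k} n"
      by (cases y) (auto simp: cube_def)
    have e: "a + Suc k * pos k xs = b + Suc k * pos k ys"
      using eq xs ys by (simp add: pos_def)
    have "a = b" using arg_cong[OF e, of "\<lambda>m. m mod Suc k"] xs(2) ys(2) by (metis mod_less mod_mult_self2)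
    with e have "pos k xs = pos k ys" by (metis add_left_cancel nat_mult_eq_cancel1 zero_less_Suc)
    with Suc.IH xs(3) ys(3) have "xs = ys" by (simp add: inj_on_def)
    with \<open>a = b\<close> xs(1) ys(1) show "x = y" by simp
  qed
qed

lemma result_input:
  assumes "x \<in> cube {0..k} n"
  shows "result k (input k n f) x = (if x \<in> cube {1..k} n then f x else \<infinity>)"
proof -
  have sub: "cube {1..k} n \<subseteq> cube {0..k} n" by (auto simp: cube_def)
  note inj = inj_on_subset[OF pos_inj sub]
  have "pos k x \<in> pos k ` cube {1..k} n \<longleftrightarrow> x \<in> cube {1..k} n"
    using inj_on_image_mem_iff[OF pos_inj assms sub] .
  then show ?thesis
    using inv_into_f_f[OF inj] by (simp add: result_def input_def table_def)
qed

end

(*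
  Filling the zeros of w from z is the term kjoin w (kjoin w z), so the effective domain of a
  relaxation of f forces F = dom f to be closed under the dual discriminator
  fill (kmeet x y) z.  Conversely, if F is closed under it, the meets of points of F form a set that
  is closed under both operations and adds no point of [k]^n.  On this set any values that decrease
  fast enough with the number of zeros work, because the meet of two incomparable points has more
  zeros than either of them.  This construction needs no division, so it even preserves integrality.
  For n = 2, taking the least of the upper bounds 2 g(kmeet x y) <= f(x) + f(y) and
  g(0,0) + f(a,b) <= g(a,0) + g(0,b) already yields a relaxation, which is then the maximal one.

  The dual discriminator is a majority operation, so closure can be tested locally (consistent): it
  suffices to know which of the (k + 1)^n partial points extend to a point of F.  All tables have
  (k + 1)^n entries with O(n k) work per entry, and (k + 1)^(n + 1) (n + 1) <= 6 (k^n)^2 for k >= 2.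
*)
theory Submission
  imports Defs
begin

text \<open>Testing closure under a ternary operation directly would run over k^(3n) triples, beyond
  the budget of (k^n)^2 steps. The way out is the Baker-Pixley property: a set preserved by a
  majority operation is determined by its projections to pairs of coordinates. Hence a partial point
  has to be compared only with the points that differ from it in one digit and with points that
  prescribe a single digit. A best possible relaxation is demanded for n = 2 only; in other
  dimensions just the set of finite points and a bound on |f| matter. The obstacle for n = 2 are
  infinite values: the bound at (0,0) coming from (a,0) and (0,b) involves f(a,b) and says nothing
  if f(a,b) is infinite. Closure excludes this case, because f(a,b) is finite whenever the values at
  (a,0) and (0,b) are. For k = 1 the budget is a constant, so no table can be processed at all;
  there the input table, infinite off the single point of [1]^n, is already a relaxation.\<close>

lemma cube_iff: "x \<in> cube A n \<longleftrightarrow> length x = n \<and> (\<forall>i<n. x ! i \<in> A)"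
  by (auto simp: cube_def in_set_conv_nth subset_iff)

lemma cube_mono: "A \<subseteq> B \<Longrightarrow> cube A n \<subseteq> cube B n"
  by (auto simp: cube_def)

lemma finite_cube: "finite A \<Longrightarrow> finite (cube A n)"
  unfolding cube_def by (rule finite_lists_length_eq)

lemma cube_update: "x \<in> cube A n \<Longrightarrow> b \<in> A \<Longrightarrow> x[j := b] \<in> cube A n"
  using set_update_subset_insert[of x j b] by (auto simp: cube_def)

lemma kmeet_simps [simp]:
  "length (kmeet x y) = min (length x) (length y)"
  "i < length x \<Longrightarrow> i < length y \<Longrightarrow> kmeet x y ! i = (if x ! i = y ! i then x ! i else 0)"
  by (simp_all add: kmeet_def)

lemma kjoin_simps [simp]:
  "length (kjoin x y) = min (length x) (length y)"
  "i < length x \<Longrightarrow> i < length y \<Longrightarrow> kjoin x y ! i =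
     (if x ! i = y ! i then x ! i else if x ! i = 0 then y ! i else if y ! i = 0 then x ! i else 0)"
  by (simp_all add: kjoin_def)

section \<open>Effective domains of relaxations and the dual discriminator\<close>

definition fill :: "nat list \<Rightarrow> nat list \<Rightarrow> nat list" where
  "fill = map2 (\<lambda>a b. if a = 0 then b else a)"

lemma fill_simps [simp]:
  "length (fill x y) = min (length x) (length y)"
  "i < length x \<Longrightarrow> i < length y \<Longrightarrow> fill x y ! i = (if x ! i = 0 then y ! i else x ! i)"
  by (simp_all add: fill_def)

lemma kmeet_cube: "x \<in> cube {0..k} n \<Longrightarrow> y \<in> cube {0..k} n \<Longrightarrow> kmeet x y \<in> cube {0..k} n"
  and kjoin_cube: "x \<in> cube {0..k} n \<Longrightarrow> y \<in> cube {0..k} n \<Longrightarrow> kjoin x y \<in> cube {0..k} n"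
  and fill_cube: "x \<in> cube {0..k} n \<Longrightarrow> z \<in> cube {1..k} n \<Longrightarrow> fill x z \<in> cube {1..k} n"
  by (auto simp: cube_iff Suc_le_eq)

text \<open>The operation \<open>x y z \<mapsto> fill (kmeet x y) z\<close> is the dual discriminator, which is a majority
  operation.\<close>

definition dd_closed :: "nat list set \<Rightarrow> bool" where
  "dd_closed F \<longleftrightarrow> (\<forall>x\<in>F. \<forall>y\<in>F. \<forall>z\<in>F. fill (kmeet x y) z \<in> F)"

text \<open>As -infinity is excluded, a finite upper bound on the sum of the values at meet and join
  makes each of the two finite.\<close>

lemma relaxation_dom_closed:
  assumes h: "ksubmodular k n h" and x: "x \<in> dom_on (cube {0..k} n) h"
    and y: "y \<in> dom_on (cube {0..k} n) h"
  shows "kmeet x y \<in> dom_on (cube {0..k} n) h" "kjoin x y \<in> dom_on (cube {0..k} n) h"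
proof -
  have mem: "x \<in> cube {0..k} n" "y \<in> cube {0..k} n" using x y by (auto simp: dom_on_def)
  note c = kmeet_cube[OF mem] kjoin_cube[OF mem]
  have le: "h (kmeet x y) + h (kjoin x y) \<le> h x + h y"
    using h mem by (auto simp: ksubmodular_def)
  have "h (kmeet x y) \<noteq> -\<infinity>" "h (kjoin x y) \<noteq> -\<infinity>"
    using h c by (auto simp: ksubmodular_def Rbar_valued_def)
  moreover have "h x + h y < \<infinity>" using x y by (auto simp: dom_on_def)
  ultimately have "h (kmeet x y) < \<infinity>" "h (kjoin x y) < \<infinity>" using le
    by (cases "h (kmeet x y)"; cases "h (kjoin x y)"; auto)+
  then show "kmeet x y \<in> dom_on (cube {0..k} n) h" "kjoin x y \<in> dom_on (cube {0..k} n) h"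
    using c by (auto simp: dom_on_def)
qed

lemma relaxation_imp_dd_closed:
  assumes "relaxation k n f h"
  shows "dd_closed (dom_on (cube {1..k} n) f)"
  unfolding dd_closed_def
proof (intro ballI)
  fix x y z
  let ?F = "dom_on (cube {1..k} n) f" and ?H = "dom_on (cube {0..k} n) h"
  assume x: "x \<in> ?F" and y: "y \<in> ?F" and z: "z \<in> ?F"
  have ks: "ksubmodular k n h" and hf: "\<And>u. u \<in> cube {1..k} n \<Longrightarrow> h u = f u"
    using assms by (auto simp: relaxation_def)
  have sub: "cube {1..k} n \<subseteq> cube {0..k} n" by (rule cube_mono) auto
  have FH: "u \<in> ?H" if "u \<in> ?F" for u
    using that hf sub by (auto simp: dom_on_def)
  note cl = relaxation_dom_closed[OF ks]
  let ?w = "kmeet x y"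
  have w: "?w \<in> ?H" using cl(1)[OF FH[OF x] FH[OF y]] .
  \<comment> \<open>The inner join puts 0 where \<open>?w\<close> and \<open>z\<close> conflict; the
    outer join writes the entry of \<open>?w\<close> back there.\<close>
  have "kjoin ?w (kjoin ?w z) \<in> ?H" using cl(2)[OF w cl(2)[OF w FH[OF z]]] .
  moreover have "kjoin ?w (kjoin ?w z) = fill ?w z"
    using x y z by (auto simp: dom_on_def cube_iff intro!: nth_equalityI)
  moreover have "fill ?w z \<in> cube {1..k} n"
    using fill_cube w z by (auto simp: dom_on_def)
  ultimately show "fill ?w z \<in> ?F"
    using hf by (auto simp: dom_on_def)
qed

text \<open>The three witnesses may miss \<open>u\<close> only at \<open>i\<close>, \<open>j\<close>
  and \<open>l\<close> respectively. So at every coordinate of \<open>T\<close> at least two of them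
  are right, and the majority operation returns their value.\<close>

lemma majority_agree:
  assumes dd: "dd_closed F" and F: "F \<subseteq> cube {1..k} n" and T: "T \<subseteq> {..<n}"
    and ij: "i \<in> T" "j \<in> T" "l \<in> T" "i \<noteq> j" "i \<noteq> l" "j \<noteq> l"
    and ex: "\<And>m. m \<in> {i, j, l} \<Longrightarrow> \<exists>x\<in>F. \<forall>t\<in>T - {m}. x ! t = u ! t"
  shows "\<exists>x\<in>F. \<forall>t\<in>T. x ! t = u ! t"
proof -
  obtain x y z where xyz: "x \<in> F" "y \<in> F" "z \<in> F"
    and a: "\<forall>t\<in>T - {i}. x ! t = u ! t" "\<forall>t\<in>T - {j}. y ! t = u ! t" "\<forall>t\<in>T - {l}. z ! t = u ! t"
    using ex[of i] ex[of j] ex[of l] by auto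
  have len: "length x = n" "length y = n" "length z = n"
    using xyz F by (auto simp: cube_iff)
  have "fill (kmeet x y) z \<in> F" using dd xyz by (auto simp: dd_closed_def)
  moreover have "fill (kmeet x y) z ! t = u ! t" if t: "t \<in> T" for t
  proof -
    have "t < n" using t T by auto
    then have e: "fill (kmeet x y) z ! t = (if x ! t = y ! t \<and> x ! t \<noteq> 0 then x ! t else z ! t)"
      using len by auto
    consider "t \<noteq> i" "t \<noteq> j" "t \<noteq> l" | "t = i" | "t = j" | "t = l" by auto
    then show ?thesis
    proof cases
      case 1 then show ?thesis using a t e by auto
    next
      case 2
      then have "y ! t = u ! t" "z ! t = u ! t" using a t ij by auto
      then show ?thesis using e by auto
    next
      case 3
      then have "x ! t = u ! t" "z ! t = u ! t" using a t ij by auto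
      then show ?thesis using e by auto
    next
      case 4
      then have "x ! t = u ! t" "y ! t = u ! t" using a t ij by auto
      \<comment> \<open>Here \<open>z\<close> may be wrong, so the common value of \<open>x\<close>
        and \<open>y\<close> must survive \<open>fill\<close>, which overwrites zeros.\<close>
      moreover have "x ! t \<noteq> 0" using xyz F \<open>t < n\<close> by (force simp: cube_iff)
      ultimately show ?thesis using e by auto
    qed
  qed
  ultimately show ?thesis by auto
qed


section \<open>A local test for closure under the dual discriminator\<close>

definition up :: "nat list set \<Rightarrow> nat list \<Rightarrow> bool" where
  "up F w \<longleftrightarrow> (\<exists>x\<in>F. \<forall>i<length w. w ! i \<noteq> 0 \<longrightarrow> x ! i = w ! i)"

text \<open>\<open>up F w\<close>: some point of \<open>F\<close> arises from \<open>w\<close> by replacing zeros.  The first clause below is the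
  gluing property of a majority operation, the second one is the instance of the dual discriminator
  with two points that differ at \<open>j\<close> and a third one that prescribes the value at \<open>j\<close>.\<close>

definition consistent :: "nat \<Rightarrow> nat \<Rightarrow> nat list set \<Rightarrow> bool" where
  "consistent k n F \<longleftrightarrow> (\<forall>w\<in>cube {0..k} n. up F w \<or>
     card {j. j < n \<and> up F (w[j := 0])} \<le> 2 \<and>
     (\<forall>j<n. 2 \<le> card {b \<in> {1..k}. up F (w[j := b])} \<longrightarrow> \<not> up F ((replicate n 0)[j := w ! j])))"

lemma two_le_cardD: "2 \<le> card S \<Longrightarrow> \<exists>a b. a \<in> S \<and> b \<in> S \<and> a \<noteq> b"
  by (metis card.infinite card_le_Suc0_iff_eq not_less_eq_eq numeral_2_eq_2 zero_le)

lemma two_le_cardI: "finite S \<Longrightarrow> a \<in> S \<Longrightarrow> b \<in> S \<Longrightarrow> a \<noteq> b \<Longrightarrow> 2 \<le> card S"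
  by (metis card_le_Suc0_iff_eq not_less_eq_eq numeral_2_eq_2)

lemma dd_closed_imp_consistent:
  assumes dd: "dd_closed F" and F: "F \<subseteq> cube {1..k} n"
  shows "consistent k n F"
  unfolding consistent_def
proof (intro ballI)
  fix w assume w: "w \<in> cube {0..k} n"
  have len: "length w = n" using w by (simp add: cube_iff)
  have lenF: "length x = n" if "x \<in> F" for x using that F by (auto simp: cube_iff)
  show "up F w \<or> card {j. j < n \<and> up F (w[j := 0])} \<le> 2 \<and>
    (\<forall>j<n. 2 \<le> card {b \<in> {1..k}. up F (w[j := b])} \<longrightarrow> \<not> up F ((replicate n 0)[j := w ! j]))"
  proof (cases "up F w")
    case False
    have "card {j. j < n \<and> up F (w[j := 0])} \<le> 2"
    proof (rule ccontr)
      assume "\<not> ?thesis"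
      then have "3 \<le> card {j. j < n \<and> up F (w[j := 0])}" by simp
      then obtain S where S: "S \<subseteq> {j. j < n \<and> up F (w[j := 0])}" "card S = 3"
        by (meson obtain_subset_with_card_n)
      then obtain i j l where ijl: "S = {i, j, l}" "i \<noteq> j" "i \<noteq> l" "j \<noteq> l"
        by (auto simp: card_3_iff)
      have nz: "m < n" "w ! m \<noteq> 0" "up F (w[m := 0])" if "m \<in> {i, j, l}" for m
      proof -
        show m: "m < n" "up F (w[m := 0])" using that S ijl by auto
        \<comment> \<open>Clearing a zero digit would leave \<open>w\<close> unchanged, and
          \<open>w\<close> does not extend into \<open>F\<close>.\<close>
        show "w ! m \<noteq> 0" using m False by (metis list_update_id)
      qed
      let ?T = "{t. t < n \<and> w ! t \<noteq> 0}"
      have "\<exists>x\<in>F. \<forall>t\<in>?T. x ! t = w ! t"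
      proof (rule majority_agree[OF dd F, of ?T i j l])
        fix m assume "m \<in> {i, j, l}"
        then have "up F (w[m := 0])" by (rule nz)
        then show "\<exists>x\<in>F. \<forall>t\<in>?T - {m}. x ! t = w ! t"
          unfolding up_def using len by (elim bexE) (intro bexI, auto simp: nth_list_update)
      qed (use nz ijl in auto)
      then show False using False len by (auto simp: up_def)
    qed
    moreover have "\<not> up F ((replicate n 0)[j := w ! j])"
      if j: "j < n" and c: "2 \<le> card {b \<in> {1..k}. up F (w[j := b])}" for j
    proof
      assume "up F ((replicate n 0)[j := w ! j])"
      then obtain z where z: "z \<in> F" "w ! j \<noteq> 0 \<longrightarrow> z ! j = w ! j"
        using j by (auto simp: up_def)
      obtain b d where bd: "b \<in> {1..k}" "d \<in> {1..k}" "up F (w[j := b])" "up F (w[j := d])" "b \<noteq> d"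
        using two_le_cardD[OF c] by blast
      obtain x where x: "x \<in> F" "\<forall>i<n. w[j := b] ! i \<noteq> 0 \<longrightarrow> x ! i = w[j := b] ! i"
        using bd(3) len by (auto simp: up_def)
      obtain y where y: "y \<in> F" "\<forall>i<n. w[j := d] ! i \<noteq> 0 \<longrightarrow> y ! i = w[j := d] ! i"
        using bd(4) len by (auto simp: up_def)
      have xj: "x ! j = b" "y ! j = d"
        using x y bd len j by auto
      have xi: "x ! i = w ! i" "y ! i = w ! i" if "i < n" "i \<noteq> j" "w ! i \<noteq> 0" for i
        using x y that len by auto
      \<comment> \<open>On the support of \<open>w\<close>, the points \<open>x\<close> and
        \<open>y\<close> agree with \<open>w\<close> off \<open>j\<close>; at \<open>j\<close> they
        conflict, so the meet is zero there and \<open>z\<close> supplies the digit.\<close>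
      have "fill (kmeet x y) z \<in> F" using dd x y z by (auto simp: dd_closed_def)
      moreover have "fill (kmeet x y) z ! i = w ! i" if "i < n" "w ! i \<noteq> 0" for i
        using that xj xi z(2) bd(5) lenF x(1) y(1) z(1) by (cases "i = j") auto
      ultimately show False using False len by (auto simp: up_def)
    qed
    ultimately show ?thesis by blast
  qed simp
qed

lemma up_full:
  assumes "F \<subseteq> cube {1..k} n" "u \<in> cube {1..k} n"
  shows "up F u \<longleftrightarrow> u \<in> F"
proof
  assume "up F u"
  then obtain x where x: "x \<in> F" "\<forall>i<n. u ! i \<noteq> 0 \<longrightarrow> x ! i = u ! i"
    using assms by (auto simp: up_def cube_iff)
  moreover have "x = u"
    using x assms by (intro nth_equalityI) (force simp: cube_iff)+
  ultimately show "u \<in> F" by simp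
qed (auto simp: up_def)

text \<open>This is the Baker-Pixley property, obtained from the first clause of
  \<open>consistent\<close>. By induction on the number of prescribed coordinates: a partial point
  with at least three of them extends after any single one is cleared, so if it did not extend
  itself, it would have more than two clearable digits.\<close>

lemma consistent_pairwise:
  assumes con: "consistent k n F" and F: "F \<subseteq> cube {1..k} n" and u: "u \<in> cube {1..k} n" and "F \<noteq> {}"
    and pair: "\<And>i j. i < n \<Longrightarrow> j < n \<Longrightarrow> \<exists>x\<in>F. x ! i = u ! i \<and> x ! j = u ! j"
  shows "u \<in> F"
proof -
  define v where "v T = map (\<lambda>i. if i \<in> T then u ! i else 0) [0..<n]" for T
  have v: "v T \<in> cube {0..k} n" for T using u by (auto simp: v_def cube_iff)
  have vn: "length (v T) = n" "i < n \<Longrightarrow> v T ! i = (if i \<in> T then u ! i else 0)" for T i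
    by (auto simp: v_def)
  have "up F (v T)" if "T \<subseteq> {..<n}" for T
    using that
  proof (induction "card T" arbitrary: T rule: less_induct)
    case less
    have fin: "finite T" using less.prems finite_subset by blast
    consider "T = {}" | i j where "i < n" "j < n" "T = {i, j}" | "3 \<le> card T"
    proof (cases "3 \<le> card T")
      case False
      then consider "card T = 0" | "card T = 1" | "card T = 2" by linarith
      then show thesis using that less.prems fin
        by cases (auto simp: card_1_singleton_iff card_2_iff)
    qed
    then show ?case
    proof cases
      case 1
      then show ?thesis using \<open>F \<noteq> {}\<close> by (auto simp: up_def vn)
    next
      case 2
      obtain x where "x \<in> F" "x ! i = u ! i" "x ! j = u ! j" using pair 2 by blast
      then show ?thesis using 2 by (auto simp: up_def vn split: if_splits intro!: bexI[of _ x])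
    next
      case 3
      have "up F ((v T)[j := 0])" if "j \<in> T" for j
      proof -
        have "(v T)[j := 0] = v (T - {j})"
          using that less.prems by (intro nth_equalityI) (auto simp: vn nth_list_update)
        then show ?thesis using less.hyps[of "T - {j}"] less.prems that fin
          by (simp add: card_Diff1_less subset_insertI2 Diff_subset order_trans[OF Diff_subset]
              del: card_Diff_insert)
      qed
      then have "T \<subseteq> {j. j < n \<and> up F ((v T)[j := 0])}" using less.prems by auto
      then have "card T \<le> card {j. j < n \<and> up F ((v T)[j := 0])}"
        by (intro card_mono) auto
      then show ?thesis using con v[of T] 3 by (fastforce simp: consistent_def)
    qed
  qed
  from this[of "{..<n}"] have "up F (v {..<n})" by simp
  moreover have "v {..<n} = u" using u by (intro nth_equalityI) (auto simp: vn cube_iff)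
  ultimately show ?thesis using up_full[OF F u] by simp
qed

text \<open>By \<open>consistent_pairwise\<close> it suffices to match
  \<open>fill (kmeet x y) z\<close> on two coordinates at a time. Two coordinates where
  \<open>x\<close> and \<open>y\<close> agree are matched by \<open>x\<close>, two where they differ
  by \<open>z\<close>; the mixed pair is what the second clause of \<open>consistent\<close> is
  for.\<close>

lemma consistent_imp_dd_closed:
  assumes con: "consistent k n F" and F: "F \<subseteq> cube {1..k} n"
  shows "dd_closed F"
  unfolding dd_closed_def
proof (intro ballI)
  fix x y z assume xyz: "x \<in> F" "y \<in> F" "z \<in> F"
  let ?u = "fill (kmeet x y) z"
  have c: "x \<in> cube {1..k} n" "y \<in> cube {1..k} n" "z \<in> cube {1..k} n" using xyz F by auto
  have len: "length x = n" "length y = n" "length z = n" using c by (auto simp: cube_iff)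
  have rng: "x ! i \<in> {1..k}" "y ! i \<in> {1..k}" "z ! i \<in> {1..k}" if "i < n" for i
    using c that by (auto simp: cube_iff)
  have ui: "?u ! i = (if x ! i = y ! i then x ! i else z ! i)" if "i < n" for i
    using len rng[OF that] that by auto
  have u: "?u \<in> cube {1..k} n"
    using len ui rng by (auto simp: cube_iff)
  have mixed: "\<exists>p\<in>F. p ! i = ?u ! i \<and> p ! j = ?u ! j"
    if ij: "i < n" "j < n" "x ! i = y ! i" "x ! j \<noteq> y ! j" for i j
  proof -
    \<comment> \<open>\<open>?w\<close> prescribes the two wanted digits. For digit
      \<open>j\<close>, the points \<open>x\<close> and \<open>y\<close> show two admissible values,
      and \<open>z\<close> extends the prescription at \<open>j\<close> alone, so \<open>?w\<close>
      has to extend into \<open>F\<close>.\<close>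
    let ?w = "((replicate n 0)[i := x ! i])[j := z ! j]"
    have ne: "i \<noteq> j" using ij by auto
    have w: "?w \<in> cube {0..k} n"
      using rng[OF ij(1)] rng[OF ij(2)] ij by (intro cube_update) (auto simp: cube_def)
    have "x ! j \<in> {b \<in> {1..k}. up F (?w[j := b])}" "y ! j \<in> {b \<in> {1..k}. up F (?w[j := b])}"
      using ij rng[OF ij(2)] xyz by (auto simp: up_def nth_list_update intro: bexI[of _ x] bexI[of _ y])
    then have "2 \<le> card {b \<in> {1..k}. up F (?w[j := b])}"
      using ij(4) by (intro two_le_cardI) auto
    moreover have "up F ((replicate n 0)[j := ?w ! j])"
      using ij xyz by (auto simp: up_def nth_list_update intro: bexI[of _ z])
    ultimately have "up F ?w" using con w ij(2) by (fastforce simp: consistent_def)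
    then obtain p where p: "p \<in> F" "\<forall>t<n. ?w ! t \<noteq> 0 \<longrightarrow> p ! t = ?w ! t"
      by (auto simp: up_def)
    have "p ! i = ?u ! i" "p ! j = ?u ! j"
      using p(2) ij ne ui[OF ij(1)] ui[OF ij(2)] rng[OF ij(1)] rng[OF ij(2)]
      by (auto simp: nth_list_update dest: spec[of _ i] spec[of _ j])
    then show ?thesis using p(1) by auto
  qed
  show "?u \<in> F"
  proof (rule consistent_pairwise[OF con F u])
    fix i j assume ij: "i < n" "j < n"
    show "\<exists>p\<in>F. p ! i = ?u ! i \<and> p ! j = ?u ! j"
    proof (cases "x ! i = y ! i"; cases "x ! j = y ! j")
      assume "x ! i = y ! i" "x ! j = y ! j"
      then show ?thesis using ui ij xyz by (intro bexI[of _ x]) auto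
    next
      assume "x ! i \<noteq> y ! i" "x ! j \<noteq> y ! j"
      then show ?thesis using ui ij xyz by (intro bexI[of _ z]) auto
    next
      assume "x ! i = y ! i" "x ! j \<noteq> y ! j"
      then show ?thesis using mixed ij by blast
    next
      assume "x ! i \<noteq> y ! i" "x ! j = y ! j"
      then show ?thesis using mixed[of j i] ij by blast
    qed
  qed (use xyz in auto)
qed

section \<open>The points on which the relaxation for general dimension is finite\<close>

text \<open>For closed \<open>F\<close> these are the meets of nonempty families of points of
  \<open>F\<close>: such a \<open>w\<close> is the meet of all \<open>fill w z\<close> with
  \<open>z \<in> F\<close>, because the last clause makes two of them differ wherever
  \<open>w\<close> is zero. This form avoids a quantification over families.\<close>

definition closure :: "nat \<Rightarrow> nat \<Rightarrow> nat list set \<Rightarrow> nat list set" where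
  "closure k n F = {w \<in> cube {0..k} n. F \<noteq> {} \<and> (\<forall>z\<in>F. fill w z \<in> F) \<and>
     (\<forall>j<n. w ! j = 0 \<longrightarrow> (\<exists>x\<in>F. \<exists>y\<in>F. x ! j \<noteq> y ! j))}"

lemma closure_full:
  assumes F: "F \<subseteq> cube {1..k} n" and w: "w \<in> cube {1..k} n"
  shows "w \<in> closure k n F \<longleftrightarrow> w \<in> F"
proof -
  have e: "fill w z = w" if "z \<in> F" for z
    using that F w by (intro nth_equalityI) (force simp: cube_iff)+
  have "w \<in> cube {0..k} n" "\<forall>j<n. w ! j \<noteq> 0" using w by (fastforce simp: cube_iff)+
  then show ?thesis using e by (auto simp: closure_def)
qed

lemma closure_closed:
  assumes dd: "dd_closed F" and F: "F \<subseteq> cube {1..k} n"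
    and w: "w \<in> closure k n F" and v: "v \<in> closure k n F"
  shows "kmeet w v \<in> closure k n F" "kjoin w v \<in> closure k n F"
proof -
  have c: "w \<in> cube {0..k} n" "v \<in> cube {0..k} n" using w v by (auto simp: closure_def)
  have len: "length w = n" "length v = n" using c by (auto simp: cube_iff)
  have lenF: "length z = n" if "z \<in> F" for z using that F by (auto simp: cube_iff)
  have fl: "fill w z \<in> F" "fill v z \<in> F" if "z \<in> F" for z using w v that by (auto simp: closure_def)
  obtain z0 where z0: "z0 \<in> F" using w by (auto simp: closure_def)
  \<comment> \<open>A zero of the meet or the join stems from a zero of \<open>w\<close> or
    \<open>v\<close> or from a conflict. A conflict at \<open>j\<close> makes the points
    \<open>fill w z0\<close> and \<open>fill v z0\<close> of \<open>F\<close> differ at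
    \<open>j\<close>.\<close>
  have differ: "\<exists>x\<in>F. \<exists>y\<in>F. x ! j \<noteq> y ! j"
    if "j < n" "w ! j = 0 \<or> v ! j = 0 \<or> w ! j \<noteq> v ! j" for j
  proof (cases "w ! j = 0 \<or> v ! j = 0")
    case True then show ?thesis using that w v by (auto simp: closure_def)
  next
    case False
    then have "fill w z0 ! j \<noteq> fill v z0 ! j" using that len lenF[OF z0] by auto
    then show ?thesis using fl[OF z0] by blast
  qed
  have "fill (kmeet w v) z \<in> F" if z: "z \<in> F" for z
  proof -
    have "fill (kmeet (fill w z) (fill v z)) z \<in> F" using dd fl z by (auto simp: dd_closed_def)
    moreover have "fill (kmeet (fill w z) (fill v z)) z = fill (kmeet w v) z"
      using len lenF[OF z] by (intro nth_equalityI) auto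
    ultimately show ?thesis by simp
  qed
  moreover have "w ! j = 0 \<or> v ! j = 0 \<or> w ! j \<noteq> v ! j" if "j < n" "kmeet w v ! j = 0" for j
    using that len by auto
  ultimately show "kmeet w v \<in> closure k n F"
    using kmeet_cube[OF c] differ z0 by (auto simp: closure_def)
  have "fill (kjoin w v) z \<in> F" if z: "z \<in> F" for z
  proof -
    \<comment> \<open>The two inner fillings agree except where \<open>w\<close> and
      \<open>v\<close> are nonzero and distinct. There the meet is zero and \<open>z\<close> takes
      over, just as \<open>kjoin w v\<close> is zero there.\<close>
    have "fill (kmeet (fill w (fill v z)) (fill v (fill w z))) z \<in> F"
      using dd fl z by (auto simp: dd_closed_def)
    moreover have "fill (kmeet (fill w (fill v z)) (fill v (fill w z))) z = fill (kjoin w v) z"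
      using len lenF[OF z] by (intro nth_equalityI) auto
    ultimately show ?thesis by simp
  qed
  moreover have "w ! j = 0 \<or> v ! j = 0 \<or> w ! j \<noteq> v ! j" if "j < n" "kjoin w v ! j = 0" for j
    using that len by auto
  ultimately show "kjoin w v \<in> closure k n F"
    using kjoin_cube[OF c] differ z0 by (auto simp: closure_def)
qed

text \<open>Turns membership into counts over changes of one digit, which can be read off the table
  of \<open>up F\<close>. Points without zeros satisfy the right-hand side vacuously and are
  therefore excluded.\<close>

lemma closure_iff:
  assumes dd: "dd_closed F" and F: "F \<subseteq> cube {1..k} n" and w: "w \<in> cube {0..k} n" and zero: "0 \<in> set w"
  shows "w \<in> closure k n F \<longleftrightarrow> (\<forall>j<n. w ! j = 0 \<longrightarrow> 2 \<le> card {b \<in> {1..k}. up F (w[j := b])})"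
proof
  have len: "length w = n" using w by (simp add: cube_iff)
  have lenF: "length z = n" if "z \<in> F" for z using that F by (auto simp: cube_iff)
  have rng: "x ! i \<in> {1..k}" if "x \<in> F" "i < n" for i x
    using F that by (auto simp: cube_iff)
  {
    assume L: "w \<in> closure k n F"
    show "\<forall>j<n. w ! j = 0 \<longrightarrow> 2 \<le> card {b \<in> {1..k}. up F (w[j := b])}"
    proof (intro allI impI)
      fix j assume j: "j < n" "w ! j = 0"
      obtain x y where xy: "x \<in> F" "y \<in> F" "x ! j \<noteq> y ! j" using L j unfolding closure_def by blast
      have "z ! j \<in> {b \<in> {1..k}. up F (w[j := b])}" if z: "z \<in> F" for z
      proof -
        have "fill w z \<in> F" using L z by (auto simp: closure_def)
        then have "up F (w[j := z ! j])" unfolding up_def using len lenF[OF z] j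
          by (intro bexI[of _ "fill w z"]) (auto simp: nth_list_update)
        then show ?thesis using rng z j by auto
      qed
      from this[OF xy(1)] this[OF xy(2)] show "2 \<le> card {b \<in> {1..k}. up F (w[j := b])}"
        using xy(3) by (intro two_le_cardI) auto
    qed
  next
    assume R: "\<forall>j<n. w ! j = 0 \<longrightarrow> 2 \<le> card {b \<in> {1..k}. up F (w[j := b])}"
    have two: "\<exists>x\<in>F. \<exists>y\<in>F. x ! j \<noteq> y ! j \<and> (\<forall>i<n. w ! i \<noteq> 0 \<longrightarrow> x ! i = w ! i \<and> y ! i = w ! i)"
      if j: "j < n" "w ! j = 0" for j
    proof -
      have "2 \<le> card {b \<in> {1..k}. up F (w[j := b])}" using R j by blast
      from two_le_cardD[OF this]
      obtain b d where bd: "b \<in> {1..k}" "d \<in> {1..k}" "up F (w[j := b])" "up F (w[j := d])" "b \<noteq> d"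
        by blast
      obtain x where x: "x \<in> F" "\<forall>i<n. w[j := b] ! i \<noteq> 0 \<longrightarrow> x ! i = w[j := b] ! i"
        using bd(3) len by (auto simp: up_def)
      obtain y where y: "y \<in> F" "\<forall>i<n. w[j := d] ! i \<noteq> 0 \<longrightarrow> y ! i = w[j := d] ! i"
        using bd(4) len by (auto simp: up_def)
      have "x ! j = b" "y ! j = d" using x y bd len j by auto
      moreover have "x ! i = w ! i" "y ! i = w ! i" if "i < n" "w ! i \<noteq> 0" for i
        using x y that len j by (metis nth_list_update_neq)+
      ultimately show ?thesis using x y bd(5) by blast
    qed
    obtain j0 where j0: "j0 < n" "w ! j0 = 0" using zero len by (auto simp: in_set_conv_nth)
    then have ne: "F \<noteq> {}" using two by blast
    have "fill w z \<in> F" if z: "z \<in> F" for z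
    proof (rule consistent_pairwise[OF dd_closed_imp_consistent[OF dd F] F])
      show "fill w z \<in> cube {1..k} n" using fill_cube[OF w] z F by auto
      fix i j assume ij: "i < n" "j < n"
      have mixed: "\<exists>x\<in>F. x ! i = fill w z ! i \<and> x ! j = fill w z ! j"
        if ij: "i < n" "j < n" and w0: "w ! i \<noteq> 0" "w ! j = 0" for i j
      proof -
        obtain x y where xy: "x \<in> F" "y \<in> F" "x ! j \<noteq> y ! j" "x ! i = w ! i" "y ! i = w ! i"
          using two[OF ij(2) w0(2)] ij w0 by blast
        \<comment> \<open>\<open>x\<close> and \<open>y\<close> extend \<open>w\<close> and differ
          at \<open>j\<close>, so this point keeps \<open>w ! i\<close> and takes digit
          \<open>j\<close> from \<open>z\<close>.\<close>
        have "fill (kmeet x y) z \<in> F" using dd xy z by (auto simp: dd_closed_def)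
        then show ?thesis using xy ij w0 len lenF z by (intro bexI[of _ "fill (kmeet x y) z"]) auto
      qed
      show "\<exists>x\<in>F. x ! i = fill w z ! i \<and> x ! j = fill w z ! j"
      proof (cases "w ! i = 0"; cases "w ! j = 0")
        assume "w ! i = 0" "w ! j = 0"
        then show ?thesis using z ij len lenF by auto
      next
        assume "w ! i \<noteq> 0" "w ! j \<noteq> 0"
        then show ?thesis using two[OF j0] ij len lenF z by auto
      next
        assume "w ! i \<noteq> 0" "w ! j = 0"
        then show ?thesis using mixed ij by blast
      next
        assume "w ! i = 0" "w ! j \<noteq> 0"
        then show ?thesis using mixed[of j i] ij by blast
      qed
    qed (rule ne)
    moreover have "\<exists>x\<in>F. \<exists>y\<in>F. x ! j \<noteq> y ! j" if "j < n" "w ! j = 0" for j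
      using two[OF that] by blast
    ultimately show "w \<in> closure k n F" using w ne by (auto simp: closure_def)
  }
qed

section \<open>A relaxation in arbitrary dimension\<close>

definition zeros :: "nat list \<Rightarrow> nat" where
  "zeros w = card {j. j < length w \<and> w ! j = 0}"

definition spread :: "nat \<Rightarrow> nat \<Rightarrow> (nat list \<Rightarrow> ereal) \<Rightarrow> real \<Rightarrow> nat list \<Rightarrow> ereal" where
  "spread k n f B w =
     (let F = dom_on (cube {1..k} n) f in
      if w \<in> F then f w else if w \<in> closure k n F then ereal (- (B * 3 ^ zeros w)) else \<infinity>)"

lemma zeros_full: "w \<in> cube {1..k} n \<Longrightarrow> zeros w = 0"
  by (auto simp: zeros_def cube_iff)

lemma zeros_pos: "w \<in> cube {0..k} n \<Longrightarrow> w \<notin> cube {1..k} n \<Longrightarrow> 0 < zeros w"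
  by (force simp: zeros_def cube_iff card_gt_0_iff Suc_le_eq)

lemma zeros_kmeet:
  assumes "length x = n" "length y = n" "kmeet x y \<noteq> x"
  shows "zeros x < zeros (kmeet x y)"
proof -
  have "\<exists>j<n. kmeet x y ! j \<noteq> x ! j"
  proof (rule ccontr)
    assume "\<not> ?thesis"
    then have "kmeet x y = x" using assms(1,2) by (intro nth_equalityI) auto
    then show False using assms(3) by simp
  qed
  then obtain j where j: "j < n" "x ! j \<noteq> y ! j" "x ! j \<noteq> 0"
    using assms(1,2) by (auto split: if_splits)
  have "{j. j < n \<and> x ! j = 0} \<subseteq> {j. j < n \<and> kmeet x y ! j = 0}"
    using assms(1,2) by auto
  moreover have "j \<in> {j. j < n \<and> kmeet x y ! j = 0}" "j \<notin> {j. j < n \<and> x ! j = 0}"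
    using assms(1,2) j by auto
  ultimately have "{j. j < n \<and> x ! j = 0} \<subset> {j. j < n \<and> kmeet x y ! j = 0}" by blast
  then have "card {j. j < n \<and> x ! j = 0} < card {j. j < n \<and> kmeet x y ! j = 0}"
    by (intro psubset_card_mono) auto
  then show ?thesis using assms(1,2) unfolding zeros_def by simp
qed

lemma kmeet_comm: "length x = length y \<Longrightarrow> kmeet x y = kmeet y x"
  and kjoin_comm: "length x = length y \<Longrightarrow> kjoin x y = kjoin y x"
  by (auto intro!: nth_equalityI)

text \<open>Here \<open>x\<close> arises from \<open>y\<close> by clearing digits. For such a
  comparable pair the submodular inequality is an equality, whatever the function.\<close>

lemma kmeet_eq_left: "length x = length y \<Longrightarrow> kmeet x y = x \<Longrightarrow> kjoin x y = y"
proof (rule nth_equalityI)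
  fix i assume "length x = length y" "kmeet x y = x" and i: "i < length (kjoin x y)"
  then have "kmeet x y ! i = x ! i" by simp
  then show "kjoin x y ! i = y ! i" using i \<open>length x = length y\<close> by (auto split: if_splits)
qed auto

text \<open>A value \<open>3\<^sup>s\<close> exceeds the sum of two smaller powers of 3, so that the meet of two incomparable
  points pays for everything else.\<close>

lemma spread_relaxation:
  assumes dd: "dd_closed (dom_on (cube {1..k} n) f)"
    and B: "\<And>x. x \<in> dom_on (cube {1..k} n) f \<Longrightarrow> \<bar>f x\<bar> \<le> ereal B" and "0 \<le> B"
  shows "relaxation k n f (spread k n f B)"
proof -
  define F where "F = dom_on (cube {1..k} n) f"
  define D where "D = closure k n F"
  define g where "g = spread k n f B"
  define \<phi> where "\<phi> w = real_of_ereal (g w)" for w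
  have F: "F \<subseteq> cube {1..k} n" by (auto simp: F_def dom_on_def)
  have D: "D \<subseteq> cube {0..k} n" by (auto simp: D_def closure_def)
  have dd: "dd_closed F" using dd unfolding F_def .
  have B: "\<bar>f x\<bar> \<le> ereal B" if "x \<in> F" for x using B that unfolding F_def .
  have gdef: "g w = (if w \<in> F then f w else if w \<in> D then ereal (- (B * 3 ^ zeros w)) else \<infinity>)" for w
    by (simp add: g_def spread_def F_def D_def)
  have FD: "w \<in> D" if "w \<in> F" for w
    using that closure_full[OF F] F by (auto simp: D_def)
  have g_fin: "g w = ereal (\<phi> w)" if "w \<in> D" for w
    using that B[of w] by (cases "f w") (auto simp: gdef \<phi>_def)
  have g_inf: "g w = \<infinity>" if "w \<notin> D" for w using that FD by (auto simp: gdef)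
  have fb: "\<bar>\<phi> w\<bar> \<le> B" "zeros w = 0" if "w \<in> F" for w
    using B[of w] g_fin[OF FD[OF that]] that F zeros_full by (auto simp: gdef)
  have phi_z: "\<phi> w = - (B * 3 ^ zeros w)" "0 < zeros w" if "w \<in> D" "w \<notin> F" for w
  proof -
    show "\<phi> w = - (B * 3 ^ zeros w)" using that by (simp add: \<phi>_def gdef)
    have "w \<notin> cube {1..k} n" using that closure_full[OF F] by (auto simp: D_def)
    then show "0 < zeros w" using that D zeros_pos by blast
  qed
  have lower: "- (B * 3 ^ zeros w) \<le> \<phi> w" if "w \<in> D" for w
    using that phi_z[of w] fb[of w] by (cases "w \<in> F") auto
  have upper: "\<phi> w \<le> B" if "w \<in> D" for w
  proof (cases "w \<in> F")
    case False
    have "- (B * 3 ^ zeros w) \<le> 0" using \<open>0 \<le> B\<close> by simp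
    then show ?thesis using phi_z[OF that False] \<open>0 \<le> B\<close> by linarith
  qed (use fb[of w] in auto)
  have "ksubmodular k n g"
    unfolding ksubmodular_def Rbar_valued_def
  proof (intro conjI ballI)
    fix x assume "x \<in> cube {0..k} n"
    show "g x \<noteq> -\<infinity>" using g_fin g_inf by (cases "x \<in> D") auto
    fix y assume "y \<in> cube {0..k} n"
    then have len: "length x = n" "length y = n"
      using \<open>x \<in> cube {0..k} n\<close> by (auto simp: cube_iff)
    show "g (kmeet x y) + g (kjoin x y) \<le> g x + g y"
    proof (cases "x \<in> D \<and> y \<in> D")
      case False
      then show ?thesis using g_inf by auto
    next
      case True
      then have mj: "kmeet x y \<in> D" "kjoin x y \<in> D"
        using closure_closed[OF dd F] by (auto simp: D_def)
      consider "kmeet x y = x" | "kmeet x y = y" | "kmeet x y \<noteq> x" "kmeet x y \<noteq> y" by auto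
      then show ?thesis
      proof cases
        case 1
        then show ?thesis using kmeet_eq_left[of x y] len by simp
      next
        case 2
        then have "kjoin x y = x"
          using kmeet_eq_left[of y x] len kmeet_comm[of x y] kjoin_comm[of x y] by simp
        then show ?thesis using 2 by (simp add: add.commute)
      next
        case 3
        have zx: "zeros x < zeros (kmeet x y)" using zeros_kmeet[OF len 3(1)] .
        have zy: "zeros y < zeros (kmeet x y)"
          using zeros_kmeet[of y n x] 3(2) len kmeet_comm[of x y] by simp
        obtain s where s: "zeros (kmeet x y) = Suc s" using zx by (cases "zeros (kmeet x y)") auto
        have "kmeet x y \<notin> F" using fb s by auto
        then have m: "\<phi> (kmeet x y) = - (B * 3 ^ Suc s)" using phi_z mj s by auto
        \<comment> \<open>Of the three copies of \<open>B * 3 ^ s\<close> in the value at the meet,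
          two cover the values at \<open>x\<close> and \<open>y\<close>; the third covers the value
          at the join, which is at most \<open>B\<close>.\<close>
        have "B * 3 ^ zeros x \<le> B * 3 ^ s" "B * 3 ^ zeros y \<le> B * 3 ^ s"
          using zx zy s \<open>0 \<le> B\<close> by (auto intro!: mult_left_mono power_increasing)
        moreover have "B * 1 \<le> B * 3 ^ s" using \<open>0 \<le> B\<close> by (intro mult_left_mono) auto
        ultimately have "\<phi> (kmeet x y) + \<phi> (kjoin x y) \<le> \<phi> x + \<phi> y"
          using lower[of x] lower[of y] upper[OF mj(2)] True m by simp
        then show ?thesis using g_fin True mj by simp
      qed
    qed
  qed
  moreover have "g x = f x" if x: "x \<in> cube {1..k} n" for x
  proof (cases "x \<in> F")
    case False
    then have "x \<notin> D" using closure_full[OF F x] by (simp add: D_def)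
    then show ?thesis using False x g_inf by (auto simp: F_def dom_on_def)
  qed (simp add: gdef)
  ultimately show ?thesis by (simp add: relaxation_def g_def)
qed

lemma spread_half_integer:
  assumes "integer_valued (cube {1..k} n) f" "B \<in> \<int>"
  shows "half_integer_valued (cube {0..k} n) (spread k n f B)"
proof -
  have "spread k n f B x \<in> ereal ` {r. 2 * r \<in> \<int>}" if "spread k n f B x < \<infinity>" for x
  proof (cases "x \<in> dom_on (cube {1..k} n) f")
    case True
    then obtain r where "f x = ereal r" "r \<in> \<int>" using assms(1) by (auto simp: integer_valued_def)
    then show ?thesis using True by (auto simp: spread_def)
  next
    case False
    have "2 * - (B * 3 ^ zeros x) \<in> \<int>" using assms(2) by (intro Ints_mult Ints_minus) auto
    then show ?thesis using False that by (auto simp: spread_def Let_def split: if_splits)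
  qed
  then show ?thesis by (auto simp: half_integer_valued_def dom_on_def)
qed

section \<open>The binary case\<close>

definition half :: "nat \<Rightarrow> nat \<Rightarrow> (nat list \<Rightarrow> ereal) \<Rightarrow> nat list \<Rightarrow> ereal" where
  "half k n f m = (INF (x, y) \<in> {(x, y) \<in> cube {1..k} n \<times> cube {1..k} n. kmeet x y = m}. (f x + f y) / 2)"

text \<open>\<open>f [a, b]\<close> is subtracted only where it is finite: in \<open>ereal\<close>,
  a real number minus infinity is -infinity.\<close>

definition binary :: "nat \<Rightarrow> (nat list \<Rightarrow> ereal) \<Rightarrow> nat list \<Rightarrow> ereal" where
  "binary k f m =
     (if m = [0, 0]
      then inf (half k 2 f [0, 0])
        (INF (a, b) \<in> {(a, b) \<in> {1..k} \<times> {1..k}. f [a, b] < \<infinity>}.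
           half k 2 f [a, 0] + half k 2 f [0, b] - f [a, b])
      else half k 2 f m)"

lemma finite_INF_ereal:
  fixes c :: "'a \<Rightarrow> ereal"
  assumes "finite S"
  shows "(INF s\<in>S. c s) = \<infinity> \<or> (\<exists>s\<in>S. (INF s\<in>S. c s) = c s)"
proof (cases "S = {}")
  case False
  then have "(INF s\<in>S. c s) \<in> c ` S"
    using assms by (metis Min_Inf Min_in finite_imageI image_is_empty)
  then show ?thesis by auto
qed (simp add: top_ereal_def)

lemma half_le:
  "x \<in> cube {1..k} n \<Longrightarrow> y \<in> cube {1..k} n \<Longrightarrow> half k n f (kmeet x y) \<le> (f x + f y) / 2"
  unfolding half_def by (rule INF_lower2[of "(x, y)"]) auto

lemma half_attained:
  "half k n f m = \<infinity> \<or>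
   (\<exists>x\<in>cube {1..k} n. \<exists>y\<in>cube {1..k} n. kmeet x y = m \<and> half k n f m = (f x + f y) / 2)"
proof -
  have "finite {(x, y) \<in> cube {1..k} n \<times> cube {1..k} n. kmeet x y = m}"
    by (rule finite_subset[of _ "cube {1..k} n \<times> cube {1..k} n"]) (auto intro: finite_cube)
  from finite_INF_ereal[OF this, of "\<lambda>(x, y). (f x + f y) / 2"] show ?thesis
    unfolding half_def by auto
qed

text \<open>If \<open>m\<close> has no zeros, \<open>(m, m)\<close> is the only pair with meet
  \<open>m\<close>.\<close>

lemma half_full:
  assumes "m \<in> cube {1..k} n" "f m \<noteq> -\<infinity>"
  shows "half k n f m = f m"
proof -
  have *: "(f m + f m) / 2 = f m" using assms(2) by (cases "f m") auto
  have "x = m \<and> y = m" if "x \<in> cube {1..k} n" "y \<in> cube {1..k} n" "kmeet x y = m" for x y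
  proof -
    have "x ! i = m ! i \<and> y ! i = m ! i" if i: "i < n" for i
    proof -
      have "kmeet x y ! i = m ! i" "m ! i \<noteq> 0" using \<open>kmeet x y = m\<close> assms(1) i by (force simp: cube_iff)+
      then show ?thesis using \<open>x \<in> _\<close> \<open>y \<in> _\<close> i by (auto simp: cube_iff split: if_splits)
    qed
    then show ?thesis using that(1,2) assms(1) by (auto simp: cube_iff intro!: nth_equalityI)
  qed
  moreover have "kmeet m m = m" by (auto intro!: nth_equalityI)
  ultimately have "{(x, y) \<in> cube {1..k} n \<times> cube {1..k} n. kmeet x y = m} = {(m, m)}"
    using assms(1) by auto
  then have "half k n f m = (f m + f m) / 2" by (simp add: half_def)
  then show ?thesis using * by (rule trans)
qed

text \<open>Join and meet of two points without zeros coincide, so the value at the meet occurs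
  twice in their inequality. If \<open>m\<close> is not a meet of such points, the infimum is over
  the empty set.\<close>

lemma relaxation_le_half:
  assumes "relaxation k n f h"
  shows "h m \<le> half k n f m"
  unfolding half_def
proof (rule INF_greatest, clarify)
  fix x y assume xy: "x \<in> cube {1..k} n" "y \<in> cube {1..k} n" and m: "m = kmeet x y"
  have "kjoin x y = kmeet x y"
  proof (rule nth_equalityI)
    fix i assume i: "i < length (kjoin x y)"
    have "x ! i \<noteq> 0" "y ! i \<noteq> 0" using xy i by (fastforce simp: cube_iff)+
    then show "kjoin x y ! i = kmeet x y ! i" using i by auto
  qed simp
  moreover have mem: "x \<in> cube {0..k} n" "y \<in> cube {0..k} n"
    using xy cube_mono[of "{1..k}" "{0..k}" n] by auto
  have "h (kmeet x y) + h (kjoin x y) \<le> h x + h y"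
    using assms mem unfolding relaxation_def ksubmodular_def by blast
  moreover have "h x = f x" "h y = f y" using assms xy by (auto simp: relaxation_def)
  ultimately have "h (kmeet x y) + h (kmeet x y) \<le> f x + f y" by simp
  then show "h (kmeet x y) \<le> (f x + f y) / 2"
    by (cases "h (kmeet x y)"; cases "f x"; cases "f y") auto
qed

lemma ereal_double_le: "(z :: ereal) \<le> (x + y) / 2 \<Longrightarrow> z + z \<le> x + y"
  by (cases x; cases y; cases z) auto

lemma ereal_finiteE:
  assumes "(x :: ereal) < \<infinity>" "x \<noteq> -\<infinity>"
  obtains r where "x = ereal r"
  using assms by (cases x) auto

text \<open>\<open>A a\<close>, \<open>B b\<close> and \<open>c\<close> stand for the values at
  \<open>[a, 0]\<close>, \<open>[0, b]\<close> and \<open>[0, 0]\<close>. Abstracting from the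
  coordinates allows a second interpretation with rows and columns exchanged, so that each
  inequality is proved in one orientation only. \<open>rect\<close> is the dual discriminator
  applied to \<open>(a', d)\<close>, \<open>(a', e)\<close> and \<open>(a, b)\<close>.\<close>

locale binary_table =
  fixes K :: "nat set" and f :: "nat \<Rightarrow> nat \<Rightarrow> ereal" and A B :: "nat \<Rightarrow> ereal" and c :: ereal
  assumes nm: "\<And>a b. a \<in> K \<Longrightarrow> b \<in> K \<Longrightarrow> f a b \<noteq> -\<infinity>"
    and A_le: "\<And>a b d. a \<in> K \<Longrightarrow> b \<in> K \<Longrightarrow> d \<in> K \<Longrightarrow> b \<noteq> d \<Longrightarrow> A a \<le> (f a b + f a d) / 2"
    and B_le: "\<And>a b d. a \<in> K \<Longrightarrow> b \<in> K \<Longrightarrow> d \<in> K \<Longrightarrow> b \<noteq> d \<Longrightarrow> B a \<le> (f b a + f d a) / 2"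
    and A_at: "\<And>a. a \<in> K \<Longrightarrow> A a = \<infinity> \<or> (\<exists>b\<in>K. \<exists>d\<in>K. b \<noteq> d \<and> A a = (f a b + f a d) / 2)"
    and B_at: "\<And>a. a \<in> K \<Longrightarrow> B a = \<infinity> \<or> (\<exists>b\<in>K. \<exists>d\<in>K. b \<noteq> d \<and> B a = (f b a + f d a) / 2)"
    and c_le: "\<And>a b a' b'. a \<in> K \<Longrightarrow> b \<in> K \<Longrightarrow> a' \<in> K \<Longrightarrow> b' \<in> K \<Longrightarrow> a \<noteq> a' \<Longrightarrow> b \<noteq> b' \<Longrightarrow>
      c \<le> (f a b + f a' b') / 2"
    and c_le': "\<And>a b. a \<in> K \<Longrightarrow> b \<in> K \<Longrightarrow> f a b < \<infinity> \<Longrightarrow> c \<le> A a + B b - f a b"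
    and c_nm: "c \<noteq> -\<infinity>"
    and rect: "\<And>a b a' d e. a \<in> K \<Longrightarrow> b \<in> K \<Longrightarrow> a' \<in> K \<Longrightarrow> d \<in> K \<Longrightarrow> e \<in> K \<Longrightarrow> d \<noteq> e \<Longrightarrow>
      f a b < \<infinity> \<Longrightarrow> f a' d < \<infinity> \<Longrightarrow> f a' e < \<infinity> \<Longrightarrow> f a' b < \<infinity>"
begin

lemma A_fin:
  assumes "a \<in> K" "A a < \<infinity>"
  obtains b d where "b \<in> K" "d \<in> K" "b \<noteq> d" "f a b < \<infinity>" "f a d < \<infinity>" "A a = (f a b + f a d) / 2"
proof -
  obtain b d where *: "b \<in> K" "d \<in> K" "b \<noteq> d" "A a = (f a b + f a d) / 2"
    using A_at assms by fastforce
  moreover have "f a b < \<infinity>" "f a d < \<infinity>"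
    using * assms nm[of a b] nm[of a d] by (cases "f a b"; cases "f a d"; auto)+
  ultimately show ?thesis using that by blast
qed

lemma B_fin:
  assumes "b \<in> K" "B b < \<infinity>"
  obtains a where "a \<in> K" "f a b < \<infinity>"
proof -
  obtain a d where *: "a \<in> K" "d \<in> K" "B b = (f a b + f d b) / 2"
    using B_at assms by fastforce
  moreover have "f a b < \<infinity>"
    using * assms nm[of a b] nm[of d b] by (cases "f a b"; cases "f d b"; auto)
  ultimately show ?thesis using that by blast
qed

lemma nm': "a \<in> K \<Longrightarrow> A a \<noteq> -\<infinity>" "a \<in> K \<Longrightarrow> B a \<noteq> -\<infinity>"
proof -
  have *: "(x + y) / 2 \<noteq> -\<infinity>" if "x \<noteq> -\<infinity>" "y \<noteq> -\<infinity>" for x y :: ereal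
    using that by (cases x; cases y) auto
  show "a \<in> K \<Longrightarrow> A a \<noteq> -\<infinity>" using A_at[of a] nm * by fastforce
  show "a \<in> K \<Longrightarrow> B a \<noteq> -\<infinity>" using B_at[of a] nm * by fastforce
qed

text \<open>\<open>c_le'\<close> speaks only of finite \<open>f a b\<close>. If \<open>A a\<close>
  and \<open>B b\<close> are finite, row \<open>a\<close> has two finite entries and column
  \<open>b\<close> has one, so \<open>rect\<close> makes their crossing finite; otherwise the
  right-hand side is infinite.\<close>

lemma corner:
  assumes "a \<in> K" "b \<in> K"
  shows "c + f a b \<le> A a + B b"
proof (cases "A a < \<infinity> \<and> B b < \<infinity>")
  case True
  obtain d e where "d \<in> K" "e \<in> K" "d \<noteq> e" "f a d < \<infinity>" "f a e < \<infinity>"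
    using A_fin assms True by metis
  moreover obtain a' where "a' \<in> K" "f a' b < \<infinity>" using B_fin assms True by metis
  ultimately have "f a b < \<infinity>" using rect[of a' b a d e] assms by blast
  then have "c \<le> A a + B b - f a b" using c_le' assms by blast
  moreover obtain p where "f a b = ereal p" using \<open>f a b < \<infinity>\<close> nm assms by (blast elim: ereal_finiteE)
  moreover obtain q where "A a = ereal q" using True nm' assms by (blast elim: ereal_finiteE)
  moreover obtain r where "B b = ereal r" using True nm' assms by (blast elim: ereal_finiteE)
  ultimately show ?thesis using c_nm by (cases c) auto
qed (use nm' assms in auto)

lemma two_lines:
  assumes "a \<in> K" "a' \<in> K" "a \<noteq> a'"
  shows "c + c \<le> A a + A a'"
proof (cases "A a < \<infinity> \<and> A a' < \<infinity>")
  case True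
  obtain b d where bd: "b \<in> K" "d \<in> K" "b \<noteq> d" "f a b < \<infinity>" "f a d < \<infinity>" "A a = (f a b + f a d) / 2"
    using A_fin assms True by metis
  obtain b' d' where bd': "b' \<in> K" "d' \<in> K" "b' \<noteq> d'" "f a' b' < \<infinity>" "f a' d' < \<infinity>" "A a' = (f a' b' + f a' d') / 2"
    using A_fin assms True by metis
  have "c + c + (c + c) \<le> (f a b + f a d) + (f a' b' + f a' d')"
  \<comment> \<open>\<open>c_le\<close> needs points that differ in both coordinates. The two points
    behind \<open>A a\<close> and the two behind \<open>A a'\<close> are matched straight or
    crossed, whichever makes the second coordinates differ.\<close>
  proof (cases "b = b' \<or> d = d'")
    case False
    then have "c + c \<le> f a b + f a' b'" "c + c \<le> f a d + f a' d'"
      using bd bd' assms by (auto intro!: ereal_double_le c_le)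
    from add_mono[OF this] show ?thesis by (simp add: ac_simps)
  next
    case True
    then have "c + c \<le> f a b + f a' d'" "c + c \<le> f a d + f a' b'"
      using bd bd' assms by (auto intro!: ereal_double_le c_le)
    from add_mono[OF this] show ?thesis by (simp add: ac_simps)
  qed
  moreover obtain p where "f a b = ereal p" using bd nm assms by (blast elim: ereal_finiteE)
  moreover obtain q where "f a d = ereal q" using bd nm assms by (blast elim: ereal_finiteE)
  moreover obtain p' where "f a' b' = ereal p'" using bd' nm assms by (blast elim: ereal_finiteE)
  moreover obtain q' where "f a' d' = ereal q'" using bd' nm assms by (blast elim: ereal_finiteE)
  ultimately show ?thesis using c_nm unfolding bd(6) bd'(6) by (cases c) (auto simp: field_simps)
qed (use nm' assms in auto)

text \<open>The point \<open>(a', b)\<close> cancels from the sum of \<open>corner\<close> and \<open>B_le\<close>.\<close>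

lemma point_line:
  assumes "a \<in> K" "a' \<in> K" "b \<in> K" "a \<noteq> a'"
  shows "c + B b \<le> f a b + A a'"
proof (cases "f a b < \<infinity> \<and> A a' < \<infinity>")
  case True
  obtain d e where "d \<in> K" "e \<in> K" "d \<noteq> e" "f a' d < \<infinity>" "f a' e < \<infinity>"
    using A_fin assms True by metis
  then have fin: "f a' b < \<infinity>" using rect[of a b a' d e] assms True by blast
  have "B b + B b \<le> f a b + f a' b" using assms by (auto intro!: ereal_double_le B_le)
  moreover have "c + f a' b \<le> A a' + B b" using corner assms by blast
  moreover obtain p where "f a b = ereal p" using True nm assms by (blast elim: ereal_finiteE)
  moreover obtain q where "f a' b = ereal q" using fin nm assms by (blast elim: ereal_finiteE)
  moreover obtain r where "A a' = ereal r" using True nm' assms by (blast elim: ereal_finiteE)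
  ultimately show ?thesis using nm'(2)[of b] assms c_nm by (cases "B b"; cases c) auto
next
  case False
  then have "f a b = \<infinity> \<or> A a' = \<infinity>" by auto
  then show ?thesis by auto
qed

end

lemma binary_table_half:
  assumes R: "Rbar_valued (cube {1..k} 2) f" and dd: "dd_closed (dom_on (cube {1..k} 2) f)"
  shows "binary_table {1..k} (\<lambda>a b. f [a, b]) (\<lambda>a. half k 2 f [a, 0]) (\<lambda>b. half k 2 f [0, b]) (binary k f [0, 0])"
    and "binary_table {1..k} (\<lambda>a b. f [b, a]) (\<lambda>b. half k 2 f [0, b]) (\<lambda>a. half k 2 f [a, 0]) (binary k f [0, 0])"
proof -
  let ?F = "dom_on (cube {1..k} 2) f"
  let ?H = "half k 2 f"
  have cub: "[a, b] \<in> cube {1..k} 2 \<longleftrightarrow> a \<in> {1..k} \<and> b \<in> {1..k}" for a b by (auto simp: cube_def)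
  have lst: "\<exists>a b. x = [a, b]" if "x \<in> cube A 2" for x A
    using that by (auto simp: cube_def length_Suc_conv numeral_2_eq_2)
  have nm: "f [a, b] \<noteq> -\<infinity>" if "a \<in> {1..k}" "b \<in> {1..k}" for a b
    using R that cub by (auto simp: Rbar_valued_def)
  have le: "?H [if a = a' then a else 0, if b = b' then b else 0] \<le> (f [a, b] + f [a', b']) / 2"
    if "a \<in> {1..k}" "b \<in> {1..k}" "a' \<in> {1..k}" "b' \<in> {1..k}" for a b a' b'
    using half_le[of "[a, b]" k 2 "[a', b']" f] that cub unfolding kmeet_def by simp
  have at: "?H m = \<infinity> \<or> (\<exists>a\<in>{1..k}. \<exists>b\<in>{1..k}. \<exists>a'\<in>{1..k}. \<exists>b'\<in>{1..k}.
      m = [if a = a' then a else 0, if b = b' then b else 0] \<and> ?H m = (f [a, b] + f [a', b']) / 2)" for m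
  proof (cases "?H m = \<infinity>")
    case False
    then obtain x y where xy: "x \<in> cube {1..k} 2" "y \<in> cube {1..k} 2" "kmeet x y = m" "?H m = (f x + f y) / 2"
      using half_attained[of k 2 f m] by blast
    moreover obtain a b a' b' where ab: "x = [a, b]" "y = [a', b']" using lst xy by metis
    moreover have "m = [if a = a' then a else 0, if b = b' then b else 0]"
      unfolding xy(3)[symmetric] ab kmeet_def by simp
    moreover have "a \<in> {1..k}" "b \<in> {1..k}" "a' \<in> {1..k}" "b' \<in> {1..k}"
      using xy(1,2) cub unfolding ab by blast+
    ultimately show ?thesis by blast
  qed simp
  have dd': "f [if a = a' then a else d, if b = b' then b else e] < \<infinity>"
    if "a \<in> {1..k}" "b \<in> {1..k}" "a' \<in> {1..k}" "b' \<in> {1..k}" "d \<in> {1..k}" "e \<in> {1..k}"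
      "f [a, b] < \<infinity>" "f [a', b'] < \<infinity>" "f [d, e] < \<infinity>" for a b a' b' d e
  proof -
    have "fill (kmeet [a, b] [a', b']) [d, e] \<in> ?F"
      using dd that cub unfolding dd_closed_def dom_on_def by blast
    moreover have "fill (kmeet [a, b] [a', b']) [d, e] =
        [if a = a' then a else d, if b = b' then b else e]"
      using that(1-4) by (auto simp: kmeet_def fill_def)
    ultimately show ?thesis by (simp add: dom_on_def)
  qed
  have rect: "f [a', b] < \<infinity>" if "a \<in> {1..k}" "b \<in> {1..k}" "a' \<in> {1..k}" "d \<in> {1..k}" "e \<in> {1..k}"
    "d \<noteq> e" "f [a, b] < \<infinity>" "f [a', d] < \<infinity>" "f [a', e] < \<infinity>" for a b a' d e
    using dd'[of a' d a' e a b] that by simp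
  have rect': "f [b, a'] < \<infinity>" if "a \<in> {1..k}" "b \<in> {1..k}" "a' \<in> {1..k}" "d \<in> {1..k}" "e \<in> {1..k}"
    "d \<noteq> e" "f [b, a] < \<infinity>" "f [d, a'] < \<infinity>" "f [e, a'] < \<infinity>" for a b a' d e
    using dd'[of d a' e a' b a] that by simp
  have A_le: "?H [a, 0] \<le> (f [a, b] + f [a, d]) / 2"
    if "a \<in> {1..k}" "b \<in> {1..k}" "d \<in> {1..k}" "b \<noteq> d" for a b d
    using le[of a b a d] that by simp
  have B_le: "?H [0, a] \<le> (f [b, a] + f [d, a]) / 2"
    if "a \<in> {1..k}" "b \<in> {1..k}" "d \<in> {1..k}" "b \<noteq> d" for a b d
    using le[of b a d a] that by simp
  have A_at: "?H [a, 0] = \<infinity> \<or> (\<exists>b\<in>{1..k}. \<exists>d\<in>{1..k}. b \<noteq> d \<and> ?H [a, 0] = (f [a, b] + f [a, d]) / 2)"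
    if "a \<in> {1..k}" for a
    using at[of "[a, 0]"] that by (simp only: list.inject) (smt (verit) atLeastAtMost_iff not_one_le_zero)
  have B_at: "?H [0, a] = \<infinity> \<or> (\<exists>b\<in>{1..k}. \<exists>d\<in>{1..k}. b \<noteq> d \<and> ?H [0, a] = (f [b, a] + f [d, a]) / 2)"
    if "a \<in> {1..k}" for a
    using at[of "[0, a]"] that by (simp only: list.inject) (smt (verit) atLeastAtMost_iff not_one_le_zero)
  have c_le: "binary k f [0, 0] \<le> (f [a, b] + f [a', b']) / 2"
    if "a \<in> {1..k}" "b \<in> {1..k}" "a' \<in> {1..k}" "b' \<in> {1..k}" "a \<noteq> a'" "b \<noteq> b'" for a b a' b'
    using le[of a b a' b'] that unfolding binary_def by (simp add: min.coboundedI1)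
  have c_le': "binary k f [0, 0] \<le> ?H [a, 0] + ?H [0, b] - f [a, b]"
    if "a \<in> {1..k}" "b \<in> {1..k}" "f [a, b] < \<infinity>" for a b
    unfolding binary_def using that
    by (simp only: if_True refl, intro le_infI2 INF_lower2[of "(a, b)"]) auto
  have c_le'': "binary k f [0, 0] \<le> ?H [0, b] + ?H [a, 0] - f [a, b]"
    if "b \<in> {1..k}" "a \<in> {1..k}" "f [a, b] < \<infinity>" for a b
    using c_le'[OF that(2,1,3)] by (simp only: add.commute)
  have pos: "?H m \<noteq> -\<infinity>" for m
  proof -
    have *: "(x + y) / 2 \<noteq> -\<infinity>" if "x \<noteq> -\<infinity>" "y \<noteq> -\<infinity>" for x y :: ereal
      using that by (cases x; cases y) auto
    show ?thesis using at[of m] nm * by fastforce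
  qed
  have c_nm: "binary k f [0, 0] \<noteq> -\<infinity>"
  proof -
    let ?S = "{(a, b) \<in> {1..k} \<times> {1..k}. f [a, b] < \<infinity>}"
    let ?c = "\<lambda>(a, b). ?H [a, 0] + ?H [0, b] - f [a, b]"
    have "finite ?S" by (rule finite_subset[of _ "{1..k} \<times> {1..k}"]) auto
    \<comment> \<open>An infimum over a finite set is infinite or attained, so -infinity could only
      come from a member.\<close>
    from finite_INF_ereal[OF this, of ?c]
    have "(INF s\<in>?S. ?c s) = \<infinity> \<or> (\<exists>s\<in>?S. (INF s\<in>?S. ?c s) = ?c s)" .
    moreover have "?c s \<noteq> -\<infinity>" if sS: "s \<in> ?S" for s
    proof -
      obtain a b where s: "s = (a, b)" "f [a, b] < \<infinity>" "a \<in> {1..k}" "b \<in> {1..k}" using sS by auto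
      obtain r where "f [a, b] = ereal r" using s nm by (blast elim: ereal_finiteE)
      then show ?thesis using pos[of "[a, 0]"] pos[of "[0, b]"] s(1)
        by (cases "?H [a, 0]"; cases "?H [0, b]") auto
    qed
    ultimately have "(INF s\<in>?S. ?c s) \<noteq> -\<infinity>" by auto
    then show ?thesis using pos[of "[0, 0]"] unfolding binary_def by (simp add: inf_min min_def)
  qed
  show "binary_table {1..k} (\<lambda>a b. f [a, b]) (\<lambda>a. ?H [a, 0]) (\<lambda>b. ?H [0, b]) (binary k f [0, 0])"
    by (rule binary_table.intro; (rule nm A_le B_le A_at B_at c_le c_le' c_nm rect; assumption)?)
  show "binary_table {1..k} (\<lambda>a b. f [b, a]) (\<lambda>b. ?H [0, b]) (\<lambda>a. ?H [a, 0]) (binary k f [0, 0])"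
    by (rule binary_table.intro; (rule nm A_le B_le A_at B_at c_le c_le'' c_nm rect'; assumption)?)
qed

lemma binary_relaxation:
  assumes R: "Rbar_valued (cube {1..k} 2) f" and dd: "dd_closed (dom_on (cube {1..k} 2) f)"
  shows "relaxation k 2 f (binary k f)"
proof -
  let ?A = "\<lambda>a. half k 2 f [a, 0]" and ?B = "\<lambda>b. half k 2 f [0, b]" and ?g = "binary k f"
  interpret L: binary_table "{1..k}" "\<lambda>a b. f [a, b]" ?A ?B "?g [0, 0]"
    by (rule binary_table_half[OF R dd])
  interpret R: binary_table "{1..k}" "\<lambda>a b. f [b, a]" ?B ?A "?g [0, 0]"
    by (rule binary_table_half[OF R dd])
  have lst: "\<exists>a b. x = [a, b]" if "x \<in> cube A 2" for x A
    using that by (auto simp: cube_def length_Suc_conv numeral_2_eq_2)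
  have cub: "[a, b] \<in> cube {1..k} 2 \<longleftrightarrow> a \<in> {1..k} \<and> b \<in> {1..k}" for a b by (auto simp: cube_def)
  have full: "?g [a, b] = f [a, b]" if "a \<in> {1..k}" "b \<in> {1..k}" for a b
    using that half_full[of "[a, b]" k 2 f] L.nm cub by (auto simp: binary_def)
  have gA: "?g [a, 0] = ?A a" "?g [0, a] = ?B a" if "a \<noteq> 0" for a using that by (auto simp: binary_def)
  have nm: "?g [a, b] \<noteq> -\<infinity>" if "a \<in> {0..k}" "b \<in> {0..k}" for a b
    using that L.c_nm L.nm[of a b] L.nm'[of a] L.nm'[of b] full[of a b] gA[of a] gA[of b]
    by (cases "a = 0"; cases "b = 0") auto
  have line1: "?A a + ?A a \<le> f [a, b] + f [a, d]"
    if "a \<in> {1..k}" "b \<in> {1..k}" "d \<in> {1..k}" "b \<noteq> d" for a b d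
    using L.A_le[OF that] by (rule ereal_double_le)
  have line2: "?B a + ?B a \<le> f [b, a] + f [d, a]"
    if "a \<in> {1..k}" "b \<in> {1..k}" "d \<in> {1..k}" "b \<noteq> d" for a b d
    using L.B_le[OF that] by (rule ereal_double_le)
  have diag: "?g [0, 0] + ?g [0, 0] \<le> f [a, b] + f [a', b']"
    if "a \<in> {1..k}" "b \<in> {1..k}" "a' \<in> {1..k}" "b' \<in> {1..k}" "a \<noteq> a'" "b \<noteq> b'" for a b a' b'
    using L.c_le[OF that] by (rule ereal_double_le)
  have main: "?g [if a = c then a else 0, if b = d then b else 0] +
      ?g [if a = c then a else if a = 0 then c else if c = 0 then a else 0,
          if b = d then b else if b = 0 then d else if d = 0 then b else 0] \<le> ?g [a, b] + ?g [c, d]"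
    if r: "a \<in> {0..k}" "b \<in> {0..k}" "c \<in> {0..k}" "d \<in> {0..k}" for a b c d
  proof -
    have pos: "t \<in> {1..k}" if "t \<in> {a, b, c, d}" "t \<noteq> 0" for t using r that by auto
    \<comment> \<open>In each coordinate the two entries are equal, have a zero on one side, or
      conflict. Comparable points give equality. The rest is \<open>corner\<close> for zeros on
      opposite sides, \<open>point_line\<close> for a conflict beside a one-sided zero,
      \<open>two_lines\<close> for a conflict beside two zeros, and the defining bounds
      \<open>line1\<close>, \<open>line2\<close> and \<open>diag\<close>.\<close>
    consider "a = c" | "a = 0" "c \<in> {1..k}" | "c = 0" "a \<in> {1..k}" | "a \<noteq> c" "a \<in> {1..k}" "c \<in> {1..k}"
      using pos[of a] pos[of c] by fastforce
    then show ?thesis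
    proof cases
      case 1
      consider "b = d" | "b = 0" "b \<noteq> d" | "d = 0" "b \<noteq> d" | "b \<noteq> d" "b \<in> {1..k}" "d \<in> {1..k}"
        using pos[of b] pos[of d] by fastforce
      then show ?thesis
      proof cases
        case 4
        then show ?thesis using 1 R.two_lines[of b d] line1[of a b d] pos[of a] gA full
          by (cases "a = 0") auto
      qed (use 1 in \<open>auto simp: add.commute\<close>)
    next
      case 2
      consider "b = d" | "b = 0" "b \<noteq> d" | "d = 0" "b \<in> {1..k}" | "b \<noteq> d" "b \<in> {1..k}" "d \<in> {1..k}"
        using pos[of b] pos[of d] by fastforce
      then show ?thesis
      proof cases
        case 3
        then show ?thesis using 2 L.corner[of c b] gA full by (simp add: add.commute)
      next
        case 4
        then show ?thesis using 2 R.point_line[of d b c] gA full by (simp add: add.commute)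
      qed (use 2 in \<open>auto simp: add.commute\<close>)
    next
      case 3
      consider "b = d" | "d = 0" "b \<noteq> d" | "b = 0" "d \<in> {1..k}" | "b \<noteq> d" "b \<in> {1..k}" "d \<in> {1..k}"
        using pos[of b] pos[of d] by fastforce
      then show ?thesis
      proof cases
        case 3
        then show ?thesis using \<open>c = 0\<close> \<open>a \<in> {1..k}\<close> L.corner[of a d] gA full by (simp add: add.commute)
      next
        case 4
        then show ?thesis using \<open>c = 0\<close> \<open>a \<in> {1..k}\<close> R.point_line[of b d a] gA full
          by (simp add: add.commute)
      qed (use 3 in \<open>auto simp: add.commute\<close>)
    next
      case 4
      consider "b = d" | "b = 0" "d \<in> {1..k}" | "d = 0" "b \<in> {1..k}" | "b \<noteq> d" "b \<in> {1..k}" "d \<in> {1..k}"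
        using pos[of b] pos[of d] by fastforce
      then show ?thesis
      proof cases
        case 1
        then show ?thesis using 4 L.two_lines[of a c] line2[of b a c] pos[of b] gA full
          by (cases "b = 0") auto
      next
        case 2
        then show ?thesis using 4 L.point_line[of c a d] gA full by (simp add: add.commute)
      next
        case 3
        then show ?thesis using 4 L.point_line[of a c b] gA full by (simp add: add.commute)
      next
        case 4
        then show ?thesis using \<open>a \<noteq> c\<close> \<open>a \<in> {1..k}\<close> \<open>c \<in> {1..k}\<close> diag[of a b c d] full by simp
      qed
    qed
  qed
  have "ksubmodular k 2 ?g"
    unfolding ksubmodular_def Rbar_valued_def
  proof (intro conjI ballI)
    fix x assume x: "x \<in> cube {0..k} 2"
    obtain a b where ab: "x = [a, b]" using lst[OF x] by blast
    then have r: "a \<in> {0..k}" "b \<in> {0..k}" using x by (auto simp: cube_def)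
    show "?g x \<noteq> -\<infinity>" using nm[OF r] ab by simp
    fix y assume y: "y \<in> cube {0..k} 2"
    obtain c d where cd: "y = [c, d]" using lst[OF y] by blast
    then have r': "c \<in> {0..k}" "d \<in> {0..k}" using y by (auto simp: cube_def)
    show "?g (kmeet x y) + ?g (kjoin x y) \<le> ?g x + ?g y"
      using main[OF r r'] unfolding ab cd kmeet_def kjoin_def by simp
  qed
  moreover have "?g x = f x" if x: "x \<in> cube {1..k} 2" for x
  proof -
    obtain a b where ab: "x = [a, b]" using lst[OF x] by blast
    then show ?thesis using full x cub by auto
  qed
  ultimately show ?thesis by (simp add: relaxation_def)
qed

lemma relaxation_le_binary:
  assumes h: "relaxation k 2 f h"
  shows "h m \<le> binary k f m"
proof (cases "m = [0, 0]")
  case False then show ?thesis using relaxation_le_half[OF h] by (simp add: binary_def)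
next
  case True
  have "h [0, 0] \<le> half k 2 f [a, 0] + half k 2 f [0, b] - f [a, b]"
    if ab: "a \<in> {1..k}" "b \<in> {1..k}" and fin: "f [a, b] < \<infinity>" for a b
  proof -
    have c: "[a, 0] \<in> cube {0..k} 2" "[0, b] \<in> cube {0..k} 2" "[0, 0] \<in> cube {0..k} 2"
        "[a, b] \<in> cube {0..k} 2" "[a, b] \<in> cube {1..k} 2"
      using ab by (auto simp: cube_def)
    have "kmeet [a, 0] [0, b] = [0, 0]" "kjoin [a, 0] [0, b] = [a, b]" using ab
      by (auto simp: kmeet_def kjoin_def)
    then have "h [0, 0] + h [a, b] \<le> h [a, 0] + h [0, b]"
      using h c unfolding relaxation_def ksubmodular_def by metis
    also have "\<dots> \<le> half k 2 f [a, 0] + half k 2 f [0, b]"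
      by (intro add_mono relaxation_le_half h)
    finally have *: "h [0, 0] + f [a, b] \<le> half k 2 f [a, 0] + half k 2 f [0, b]"
      using h c by (simp add: relaxation_def)
    have "f [a, b] \<noteq> -\<infinity>" "h [0, 0] \<noteq> -\<infinity>"
      using h c by (auto simp: relaxation_def ksubmodular_def Rbar_valued_def)
    then obtain r where "f [a, b] = ereal r" using fin by (blast elim: ereal_finiteE)
    then show ?thesis using *
      by (cases "h [0, 0]"; cases "half k 2 f [a, 0] + half k 2 f [0, b]") auto
  qed
  then have "h [0, 0] \<le> (INF (a, b) \<in> {(a, b) \<in> {1..k} \<times> {1..k}. f [a, b] < \<infinity>}.
           half k 2 f [a, 0] + half k 2 f [0, b] - f [a, b])"
    by (intro INF_greatest) auto
  then show ?thesis using relaxation_le_half[OF h, of "[0, 0]"] True by (simp add: binary_def)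
qed

lemma half_of_integers:
  assumes "integer_valued (cube {1..k} n) f" "Rbar_valued (cube {1..k} n) f" "half k n f m \<noteq> \<infinity>"
  obtains r where "half k n f m = ereal r" "2 * r \<in> \<int>"
proof -
  obtain x y where xy: "x \<in> cube {1..k} n" "y \<in> cube {1..k} n" "half k n f m = (f x + f y) / 2"
    using half_attained[of k n f m] assms(3) by blast
  have nm: "f x \<noteq> -\<infinity>" "f y \<noteq> -\<infinity>" using assms(2) xy by (auto simp: Rbar_valued_def)
  then have "f x < \<infinity>" "f y < \<infinity>" using assms(3) xy(3) by (cases "f x"; cases "f y"; auto)+
  then have "f x \<in> ereal ` \<int>" "f y \<in> ereal ` \<int>"
    using assms(1) xy by (auto simp: integer_valued_def dom_on_def)
  then obtain p q where "f x = ereal p" "p \<in> \<int>" "f y = ereal q" "q \<in> \<int>" by auto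
  moreover have "2 * ((p + q) / 2) = p + q" by simp
  ultimately show ?thesis using that[of "(p + q) / 2"] xy(3) by (metis Ints_add ereal_divide plus_ereal.simps(1) numeral_eq_ereal zero_neq_numeral)
qed

text \<open>The second bound at \<open>[0, 0]\<close> combines half-integers and integers without
  another halving, so no quarters arise.\<close>

lemma binary_half_integer:
  assumes int: "integer_valued (cube {1..k} 2) f" and R: "Rbar_valued (cube {1..k} 2) f"
  shows "half_integer_valued (cube {0..k} 2) (binary k f)"
proof -
  let ?H = "half k 2 f"
  let ?S = "{(a, b) \<in> {1..k} \<times> {1..k}. f [a, b] < \<infinity>}"
  let ?c = "\<lambda>(a, b). ?H [a, 0] + ?H [0, b] - f [a, b]"
  have H: "?H m \<in> ereal ` {r. 2 * r \<in> \<int>}" if "?H m < \<infinity>" for m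
    using half_of_integers[OF int R, of m] that by auto
  have "binary k f m \<in> ereal ` {r. 2 * r \<in> \<int>}" if fin: "binary k f m < \<infinity>" for m
  proof (cases "binary k f m = ?H m")
    case True then show ?thesis using H fin by simp
  next
    case False
    then have m: "binary k f m = (INF s\<in>?S. ?c s)"
      by (auto simp: binary_def min_def split: if_splits)
    have "finite ?S" by (rule finite_subset[of _ "{1..k} \<times> {1..k}"]) auto
    from finite_INF_ereal[OF this, of ?c] obtain a b where
      ab: "a \<in> {1..k}" "b \<in> {1..k}" "f [a, b] < \<infinity>" "binary k f m = ?H [a, 0] + ?H [0, b] - f [a, b]"
      using m fin by auto
    have c: "[a, b] \<in> cube {1..k} 2" using ab by (auto simp: cube_def)
    then obtain r where r: "f [a, b] = ereal r" "r \<in> \<int>"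
      using int ab by (auto simp: integer_valued_def dom_on_def)
    have "?H [a, 0] \<noteq> \<infinity>" "?H [0, b] \<noteq> \<infinity>" using ab(4) r fin by auto
    then obtain p q where pq: "?H [a, 0] = ereal p" "2 * p \<in> \<int>" "?H [0, b] = ereal q" "2 * q \<in> \<int>"
      using half_of_integers[OF int R] by metis
    have "2 * p + 2 * q - 2 * r \<in> \<int>"
      using Ints_diff[OF Ints_add[OF pq(2,4)] Ints_mult[OF _ r(2), of 2]] by simp
    then have "2 * (p + q - r) \<in> \<int>" by (simp add: algebra_simps)
    then show ?thesis using ab(4) r pq by auto
  qed
  then show ?thesis by (auto simp: half_integer_valued_def dom_on_def)
qed

section \<open>Total correctness with step counts\<close>

text \<open>Termination is part of the claim and the postcondition sees the exact number of steps.
  The equations for the loop-free constructs are simplification rules, so straight-line code is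
  executed symbolically.\<close>

definition wp :: "com \<Rightarrow> state \<Rightarrow> (nat \<Rightarrow> state \<Rightarrow> bool) \<Rightarrow> bool" where
  "wp c s P \<longleftrightarrow> (\<exists>t s'. exec c s t s' \<and> P t s')"

abbreviation run :: "com \<Rightarrow> state \<Rightarrow> nat \<Rightarrow> (state \<Rightarrow> bool) \<Rightarrow> bool" where
  "run c s T Q \<equiv> wp c s (\<lambda>t s'. t \<le> T \<and> Q s')"

lemma upd_apply [simp]: "upd m a i v b = (if b = a then (m a)(i := v) else m b)"
  by (simp add: upd_def)

lemma wp_Skip [simp]: "wp Skip s P \<longleftrightarrow> P 1 s"
  by (auto simp: wp_def elim: exec.cases intro: exec.intros[unfolded One_nat_def])

lemma wp_ISet [simp]: "wp (ISet a i e) s P \<longleftrightarrow> P 1 (s\<lparr>ints := upd (ints s) a (ival i s) (ival e s)\<rparr>)"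
  by (auto simp: wp_def elim: exec.cases intro: exec.intros[unfolded One_nat_def])

lemma wp_VSet [simp]: "wp (VSet a i e) s P \<longleftrightarrow> P 1 (s\<lparr>vals := upd (vals s) a (ival i s) (vval e s)\<rparr>)"
  by (auto simp: wp_def elim: exec.cases intro: exec.intros[unfolded One_nat_def])

lemma wp_Seq [simp]: "wp (Seq c1 c2) s P \<longleftrightarrow> wp c1 s (\<lambda>t1 s1. wp c2 s1 (\<lambda>t2. P (t1 + t2)))"
proof
  assume "wp (Seq c1 c2) s P"
  then obtain t s' where "exec (Seq c1 c2) s t s'" "P t s'" by (auto simp: wp_def)
  then show "wp c1 s (\<lambda>t1 s1. wp c2 s1 (\<lambda>t2. P (t1 + t2)))"
    by (cases rule: exec.cases) (auto simp: wp_def)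
next
  assume "wp c1 s (\<lambda>t1 s1. wp c2 s1 (\<lambda>t2. P (t1 + t2)))"
  then show "wp (Seq c1 c2) s P" by (auto simp: wp_def intro: exec.Seq)
qed

lemma wp_If [simp]:
  "wp (If b c1 c2) s P \<longleftrightarrow>
     (if holds b s then wp c1 s (\<lambda>t. P (Suc t)) else wp c2 s (\<lambda>t. P (Suc t)))"
proof
  assume "wp (If b c1 c2) s P"
  then obtain t s' where "exec (If b c1 c2) s t s'" "P t s'" by (auto simp: wp_def)
  then show "if holds b s then wp c1 s (\<lambda>t. P (Suc t)) else wp c2 s (\<lambda>t. P (Suc t))"
    by (cases rule: exec.cases) (auto simp: wp_def)
next
  assume "if holds b s then wp c1 s (\<lambda>t. P (Suc t)) else wp c2 s (\<lambda>t. P (Suc t))"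
  then show "wp (If b c1 c2) s P" by (auto simp: wp_def intro: exec.IfTrue exec.IfFalse split: if_splits)
qed

lemma wp_mono: "wp c s P \<Longrightarrow> (\<And>t s'. P t s' \<Longrightarrow> P' t s') \<Longrightarrow> wp c s P'"
  by (auto simp: wp_def)

definition sc :: "nat \<Rightarrow> iexp" where
  "sc a = ICell a (INum 0)"

lemma ival_sc [simp]: "ival (sc a) s = ints s a 0"
  by (simp add: sc_def)

definition For :: "nat \<Rightarrow> iexp \<Rightarrow> com \<Rightarrow> com" where
  "For a bnd c = Seq (ISet a (INum 0) (INum 0))
     (While (ILess (sc a) bnd) (Seq c (ISet a (INum 0) (IAdd (sc a) (INum 1)))))"

text \<open>Each round pays for its test and its increment besides the body; the initialisation and
  the failing test give the constant 2. The bound is evaluated anew in every round, so the invariant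
  has to fix its value.\<close>

lemma run_For:
  assumes init: "I 0 (s\<lparr>ints := upd (ints s) a 0 0\<rparr>)"
    and ctr: "\<And>j s. j \<le> N \<Longrightarrow> I j s \<Longrightarrow> ints s a 0 = j \<and> ival bnd s = N"
    and step: "\<And>j s. j < N \<Longrightarrow> I j s \<Longrightarrow>
      run c s T (\<lambda>s'. I (Suc j) (s'\<lparr>ints := upd (ints s') a 0 (Suc (ints s' a 0))\<rparr>))"
    and post: "\<And>s. I N s \<Longrightarrow> Q s"
  shows "run (For a bnd c) s (2 + N * (T + 2)) Q"
proof -
  let ?body = "Seq c (ISet a (INum 0) (IAdd (sc a) (INum 1)))"
  let ?loop = "While (ILess (sc a) bnd) ?body"
  have loop: "run ?loop s (1 + (N - j) * (T + 2)) Q" if "j \<le> N" "I j s" for j s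
    using that
  proof (induction "N - j" arbitrary: j s)
    case 0
    then have "j = N" by simp
    then have "\<not> holds (ILess (sc a) bnd) s" using ctr[of N s] 0 by simp
    from exec.WhileFalse[OF this] show ?case using post 0 \<open>j = N\<close> by (fastforce simp: wp_def)
  next
    case (Suc m)
    then have j: "j < N" by simp
    have b: "holds (ILess (sc a) bnd) s" using ctr[of j s] Suc.prems j by simp
    from step[OF j Suc.prems(2)] obtain t s' where c: "exec c s t s'" "t \<le> T"
      "I (Suc j) (s'\<lparr>ints := upd (ints s') a 0 (Suc (ints s' a 0))\<rparr>)" by (auto simp: wp_def)
    let ?s = "s'\<lparr>ints := upd (ints s') a 0 (Suc (ints s' a 0))\<rparr>"
    have body: "exec ?body s (t + 1) ?s"
      using exec.Seq[OF c(1) exec.ISet[of a "INum 0" "IAdd (sc a) (INum 1)" s']] by simp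
    have "run ?loop ?s (1 + (N - Suc j) * (T + 2)) Q"
      by (rule Suc.hyps) (use Suc.hyps(2) j c in auto)
    then obtain u s'' where u: "exec ?loop ?s u s''" "u \<le> 1 + (N - Suc j) * (T + 2)" "Q s''"
      by (auto simp: wp_def)
    have "exec ?loop s (Suc ((t + 1) + u)) s''"
      using exec.WhileTrue[OF b body u(1)] .
    moreover have "N - j = Suc (N - Suc j)" using j by simp
    ultimately show ?case using u c(2) unfolding wp_def by (intro exI[of _ "Suc ((t + 1) + u)"] exI[of _ s'']) auto
  qed
  have "run ?loop (s\<lparr>ints := upd (ints s) a 0 0\<rparr>) (1 + (N - 0) * (T + 2)) Q"
    by (rule loop) (use init in auto)
  then show ?thesis unfolding For_def by (auto elim!: wp_mono)
qed

lemma wp_run: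
  assumes "run c s T Q" "\<And>t s'. t \<le> T \<Longrightarrow> Q s' \<Longrightarrow> P t s'"
  shows "wp c s P"
  using assms by (auto simp: wp_def)

section \<open>Positions\<close>

lemma pos_eq_sum: "pos k x = (\<Sum>i<length x. x ! i * (k + 1) ^ i)"
  by (simp add: pos_def horner_sum_eq_sum atLeast0LessThan)

lemma pos_take_Suc: "m < length x \<Longrightarrow> pos k (take (Suc m) x) = pos k (take m x) + x ! m * (k + 1) ^ m"
  by (simp add: pos_eq_sum)

lemma pos_less: "x \<in> cube {0..k} n \<Longrightarrow> pos k x < (k + 1) ^ n"
proof (induction n arbitrary: x)
  case 0
  then show ?case by (auto simp: cube_def pos_def)
next
  case (Suc n)
  then obtain a y where y: "x = a # y" "a < k + 1" "y \<in> cube {0..k} n"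
    by (cases x) (auto simp: cube_def)
  have "a + (k + 1) * pos k y < (k + 1) * (1 + pos k y)" using y by simp
  also have "\<dots> \<le> (k + 1) * (k + 1) ^ n" using Suc.IH[OF y(3)] by (intro mult_left_mono) auto
  finally show ?case using y by (simp add: pos_def)
qed

text \<open>Together with \<open>pos_less\<close> and \<open>pos_inj\<close> this lets a counter
  below \<open>(k + 1) ^ n\<close> visit every point exactly once.\<close>

lemma pos_surj: "p < (k + 1) ^ n \<Longrightarrow> \<exists>x\<in>cube {0..k} n. pos k x = p"
proof (induction n arbitrary: p)
  case 0
  then show ?case by (auto simp: cube_def pos_def)
next
  case (Suc n)
  have "p div (k + 1) < (k + 1) ^ n" using Suc.prems by (simp add: less_mult_imp_div_less mult.commute)
  then obtain y where y: "y \<in> cube {0..k} n" "pos k y = p div (k + 1)" using Suc.IH by blast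
  have "p mod (k + 1) \<le> k" using mod_less_divisor[of "k + 1" p] by simp
  then have "p mod (k + 1) # y \<in> cube {0..k} (Suc n)" using y by (auto simp: cube_def)
  moreover have "pos k (p mod (k + 1) # y) = p"
    using y mod_mult_div_eq[of p "k + 1"] by (simp add: pos_def)
  ultimately show ?case by blast
qed

text \<open>Adding on both sides avoids truncated subtraction. The special cases below are the
  address computations of the program.\<close>

lemma pos_update: "j < length x \<Longrightarrow> pos k (x[j := b]) + x ! j * (k + 1) ^ j = pos k x + b * (k + 1) ^ j"
  by (simp add: pos_eq_sum sum.remove[of "{..<length x}" j] nth_list_update)

lemma pos_clear: "j < length x \<Longrightarrow> pos k (x[j := 0]) = pos k x - x ! j * (k + 1) ^ j"
  using pos_update[of j x k 0] by simp

lemma pos_clear_update: "j < length x \<Longrightarrow> pos k (x[j := b]) = pos k (x[j := 0]) + b * (k + 1) ^ j"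
  using pos_update[of j "x[j := 0]" k b] by simp

lemma pos_single: "j < n \<Longrightarrow> pos k ((replicate n 0)[j := b]) = b * (k + 1) ^ j"
  using pos_update[of j "replicate n 0" k b] by (simp add: pos_eq_sum)

section \<open>The program\<close>

text \<open>
  Use of the memory.  Index arrays: 3 powers of \<open>k + 1\<close>; 4 the digits of the current point, each
  multiplied by its power; 5 the table of \<open>up F\<close>; 6 the current position; 12 the number of \<open>j\<close> such
  that clearing digit \<open>j\<close> leads into \<open>up F\<close>; 13 the number of zeros; 14 whether some zero digit has
  fewer than two admissible values; 15 whether an inconsistency was found; 24 multiples of \<open>k + 1\<close>
  (there is no multiplication); the other ones are counters and temporaries.  Value arrays: 1 a bound
  on \<open>\<bar>f\<bar>\<close>; 2 the value \<open>- (B * 3 ^ zeros x)\<close> for the current point.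
\<close>

definition env :: "nat \<Rightarrow> nat \<Rightarrow> state \<Rightarrow> bool" where
  "env k n s \<longleftrightarrow> ints s 0 0 = k \<and> ints s 1 0 = n \<and> (\<forall>i\<le>n. ints s 3 i = (k + 1) ^ i)"

definition inc :: "nat \<Rightarrow> iexp \<Rightarrow> iexp \<Rightarrow> com" where
  "inc a i e = ISet a i (IAdd (ICell a i) e)"

lemma wp_inc [simp]:
  "wp (inc a i e) s P \<longleftrightarrow>
     P 1 (s\<lparr>ints := upd (ints s) a (ival i s) (ints s a (ival i s) + ival e s)\<rparr>)"
  by (simp add: inc_def)

text \<open>Each power is accumulated as a sum of \<open>k + 1\<close> copies of the previous
  one.\<close>

definition powers :: com where
  "powers = Seq (ISet 3 (INum 0) (INum 1))
     (For 7 (sc 1) (Seq (ISet 3 (IAdd (sc 7) (INum 1)) (INum 0))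
       (For 9 (IAdd (sc 0) (INum 1)) (inc 3 (IAdd (sc 7) (INum 1)) (ICell 3 (sc 7))))))"

lemma run_powers:
  assumes "ints s 0 0 = k" "ints s 1 0 = n"
  shows "run powers s (3 + n * (5 + (k + 1) * 3))
    (\<lambda>s'. env k n s' \<and> (\<forall>a. a \<notin> {3, 7, 9} \<longrightarrow> ints s' a = ints s a) \<and> vals s' = vals s)"
proof -
  let ?fr = "\<lambda>s'. (\<forall>a. a \<notin> {3, 7, 9} \<longrightarrow> ints s' a = ints s a) \<and> vals s' = vals s"
  let ?I = "\<lambda>j s'. ints s' 7 0 = j \<and> (\<forall>i\<le>j. ints s' 3 i = (k + 1) ^ i) \<and> ?fr s'"
  have inner: "run (For 9 (IAdd (sc 0) (INum 1)) (inc 3 (IAdd (sc 7) (INum 1)) (ICell 3 (sc 7)))) s1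
      (2 + (k + 1) * (1 + 2)) (\<lambda>s'. ?I (Suc j) (s'\<lparr>ints := upd (ints s') 7 0 (Suc (ints s' 7 0))\<rparr>))"
    if s1: "?I j s1" "ints s1 3 (Suc j) = 0" for j s1
    by (rule run_For[where I = "\<lambda>b s'. ?I j s' \<and> ints s' 9 0 = b \<and> ints s' 3 (Suc j) = b * (k + 1) ^ j"])
      (use s1 assms in \<open>auto simp: le_Suc_eq\<close>)
  have "run (For 7 (sc 1) (Seq (ISet 3 (IAdd (sc 7) (INum 1)) (INum 0))
       (For 9 (IAdd (sc 0) (INum 1)) (inc 3 (IAdd (sc 7) (INum 1)) (ICell 3 (sc 7))))))
     (s\<lparr>ints := upd (ints s) 3 0 1\<rparr>) (2 + n * ((1 + (2 + (k + 1) * (1 + 2))) + 2)) (\<lambda>s'. env k n s' \<and> ?fr s')"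
    apply (rule run_For[where I = ?I])
    subgoal using assms by auto
    subgoal using assms by auto
    subgoal for j s1
      apply (simp only: wp_Seq wp_ISet)
      apply (rule wp_run[OF inner])
      by auto
    subgoal using assms by (auto simp: env_def)
    done
  then show ?thesis unfolding powers_def by (auto elim!: wp_mono simp: algebra_simps)
qed

text \<open>Division is replaced by repeated subtraction, from the most significant digit down; once
  a digit is used up, the rest of its \<open>k\<close> trials are idle. Storing digit times power
  makes clearing a digit a single subtraction from the position.\<close>

definition decode :: com where
  "decode = Seq (ISet 8 (INum 0) (sc 6))
     (For 7 (sc 1) (Seq (ISet 21 (INum 0) (ISub (ISub (sc 1) (INum 1)) (sc 7)))
       (Seq (ISet 4 (sc 21) (INum 0))
       (For 9 (sc 0)
         (If (ILess (sc 8) (ICell 3 (sc 21))) Skip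
           (Seq (inc 4 (sc 21) (ICell 3 (sc 21)))
             (ISet 8 (INum 0) (ISub (sc 8) (ICell 3 (sc 21))))))))))"

lemma run_decode:
  assumes env: "env k n s" and x: "x \<in> cube {0..k} n" and p: "ints s 6 0 = pos k x"
  shows "run decode s (3 + n * (6 + k * 5))
    (\<lambda>s'. (\<forall>j<n. ints s' 4 j = x ! j * (k + 1) ^ j) \<and>
      (\<forall>a. a \<notin> {4, 7, 8, 9, 21} \<longrightarrow> ints s' a = ints s a) \<and> vals s' = vals s)"
proof -
  have len: "length x = n" using x by (simp add: cube_iff)
  let ?fr = "\<lambda>s'. (\<forall>a. a \<notin> {4, 7, 8, 9, 21} \<longrightarrow> ints s' a = ints s a) \<and> vals s' = vals s"
  let ?K = "\<lambda>j. (k + 1) ^ j"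
  let ?I = "\<lambda>i s'. ints s' 7 0 = i \<and> ints s' 8 0 = pos k (take (n - i) x) \<and>
    (\<forall>j<n. n - i \<le> j \<longrightarrow> ints s' 4 j = x ! j * ?K j) \<and> ?fr s'"
  \<comment> \<open>\<open>min b (x ! m)\<close> is the number of successful subtractions among the
    first \<open>b\<close> trials.\<close>
  let ?J = "\<lambda>i m b s'. ints s' 7 0 = i \<and> ints s' 21 0 = m \<and> ints s' 9 0 = b \<and>
    ints s' 8 0 = (x ! m - min b (x ! m)) * ?K m + pos k (take m x) \<and>
    ints s' 4 m = min b (x ! m) * ?K m \<and>
    (\<forall>j<n. n - i \<le> j \<longrightarrow> ints s' 4 j = x ! j * ?K j) \<and> ?fr s'"
  let ?body = "If (ILess (sc 8) (ICell 3 (sc 21))) Skip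
           (Seq (inc 4 (sc 21) (ICell 3 (sc 21)))
             (ISet 8 (INum 0) (ISub (sc 8) (ICell 3 (sc 21)))))"
  have inner: "run (For 9 (sc 0) ?body) s1 (2 + k * (3 + 2))
      (\<lambda>s'. ?I (Suc i) (s'\<lparr>ints := upd (ints s') 7 0 (Suc (ints s' 7 0))\<rparr>))"
    if i: "i < n" and m: "m = n - 1 - i" and s1: "?J i m 0 (s1\<lparr>ints := upd (ints s1) 9 0 0\<rparr>)" for i m s1
  proof (rule run_For[where I = "?J i m"])
    show "?J i m 0 (s1\<lparr>ints := upd (ints s1) 9 0 0\<rparr>)" by (rule s1)
    show "ints s' 9 0 = b \<and> ival (sc 0) s' = k" if "?J i m b s'" for b s'
      using that env by (auto simp: env_def)
    show "?I (Suc i) (s'\<lparr>ints := upd (ints s') 7 0 (Suc (ints s' 7 0))\<rparr>)" if J: "?J i m k s'" for s'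
    proof -
      have "x ! m \<le> k" using x i m by (auto simp: cube_iff)
      moreover have "\<forall>j<n. n - Suc i \<le> j \<longrightarrow> j = m \<or> n - i \<le> j" using m by auto
      moreover have "m = n - Suc i" using m by simp
      ultimately show ?thesis using J by (auto simp: min_absorb2)
    qed
    show "run ?body s2 3 (\<lambda>s'. ?J i m (Suc b) (s'\<lparr>ints := upd (ints s') 9 0 (Suc (ints s' 9 0))\<rparr>))"
      if b: "b < k" and J: "?J i m b s2" for b s2
    proof -
      have P: "ints s2 3 m = ?K m" using J env m by (auto simp: env_def)
      \<comment> \<open>The lower digits amount to less than \<open>(k + 1) ^ m\<close>, so the test
        stops the subtraction exactly when digit \<open>m\<close> is used up.\<close>
      have less: "pos k (take m x) < ?K m"
        using x m i by (intro pos_less) (auto simp: cube_iff)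
      have ne: "\<not> n - i \<le> m" using m i by auto
      show ?thesis
      proof (cases "b < x ! m")
        case True
        have mn: "min b (x ! m) = b" "min (Suc b) (x ! m) = Suc b" using True by auto
        obtain d where d: "x ! m = Suc b + d" using True less_iff_Suc_add by auto
        show ?thesis using J P less ne d unfolding mn by (auto simp: algebra_simps)
      next
        case False
        then have mn: "min b (x ! m) = x ! m" "min (Suc b) (x ! m) = x ! m" by auto
        show ?thesis using J P less ne unfolding mn by auto
      qed
    qed
  qed
  have "run (For 7 (sc 1) (Seq (ISet 21 (INum 0) (ISub (ISub (sc 1) (INum 1)) (sc 7)))
       (Seq (ISet 4 (sc 21) (INum 0)) (For 9 (sc 0) ?body))))
      (s\<lparr>ints := upd (ints s) 8 0 (pos k x)\<rparr>) (2 + n * ((2 + (2 + k * (3 + 2))) + 2))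
      (\<lambda>s'. (\<forall>j<n. ints s' 4 j = x ! j * ?K j) \<and> ?fr s')"
  proof (rule run_For[where I = ?I])
    show "?I 0 (s\<lparr>ints := upd (ints s) 8 0 (pos k x), ints := upd (ints (s\<lparr>ints := upd (ints s) 8 0 (pos k x)\<rparr>)) 7 0 0\<rparr>)"
      using len by simp
    show "ints s' 7 0 = j \<and> ival (sc 1) s' = n" if "?I j s'" for j s'
      using that env by (auto simp: env_def)
    show "run (Seq (ISet 21 (INum 0) (ISub (ISub (sc 1) (INum 1)) (sc 7)))
       (Seq (ISet 4 (sc 21) (INum 0)) (For 9 (sc 0) ?body))) s1 (2 + (2 + k * (3 + 2)))
       (\<lambda>s'. ?I (Suc i) (s'\<lparr>ints := upd (ints s') 7 0 (Suc (ints s' 7 0))\<rparr>))"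
      if i: "i < n" and I: "?I i s1" for i s1
    proof -
      have e: "pos k (take (n - i) x) = pos k (take (n - Suc i) x) + x ! (n - Suc i) * ?K (n - Suc i)"
        using pos_take_Suc[of "n - Suc i" x k] len i by (simp add: Suc_diff_Suc)
      have n1: "ints s 1 0 = n" using env by (auto simp: env_def)
      show ?thesis
        apply (simp only: wp_Seq wp_ISet)
        apply (rule wp_run[OF inner[OF i refl]])
        subgoal using I e i n1 by auto
        subgoal by simp
        done
    qed
  qed auto
  then show ?thesis unfolding decode_def using p by (auto elim!: wp_mono simp: algebra_simps)
qed

definition vs :: "nat \<Rightarrow> vexp" where
  "vs a = VCell a (INum 0)"

lemma vval_vs [simp]: "vval (vs a) s = vals s a 0"
  by (simp add: vs_def)

section \<open>First pass: the table of extendable points and a bound on the values\<close>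

text \<open>Points with zeros hold infinity in the input table, so exactly the points of the
  effective domain of \<open>f\<close> pass the outer test. Comparing with both signs replaces the
  absolute value; the bound ends up as 0 or as some absolute value of \<open>f\<close>, which is why
  it inherits integrality.\<close>

definition absorb :: com where
  "absorb = If (VLess (VCell 0 (sc 6)) VInf)
     (Seq (ISet 5 (sc 6) (INum 1))
       (Seq (If (VLess (vs 1) (VCell 0 (sc 6))) (VSet 1 (INum 0) (VCell 0 (sc 6))) Skip)
            (If (VLess (vs 1) (VSub VZero (VCell 0 (sc 6)))) (VSet 1 (INum 0) (VSub VZero (VCell 0 (sc 6)))) Skip)))
     Skip"

lemma run_absorb:
  assumes v: "vals s 0 (ints s 6 0) = v" "v \<noteq> -\<infinity>" and b: "vals s 1 0 = ereal b" "0 \<le> b"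
  shows "run absorb s 6 (\<lambda>s'. (\<forall>a. a \<noteq> 5 \<longrightarrow> ints s' a = ints s a) \<and>
    ints s' 5 = (if v < \<infinity> then (ints s 5)(ints s 6 0 := 1) else ints s 5) \<and> vals s' 0 = vals s 0 \<and>
    (\<exists>b'. vals s' 1 0 = ereal b' \<and> b \<le> b' \<and> (v < \<infinity> \<longrightarrow> \<bar>v\<bar> \<le> ereal b') \<and>
      (b \<in> \<int> \<longrightarrow> v \<in> insert \<infinity> (ereal ` \<int>) \<longrightarrow> b' \<in> \<int>)))"
proof (cases "v < \<infinity>")
  case False
  then show ?thesis using v b by (auto simp: absorb_def)
next
  case True
  then obtain r where r: "v = ereal r" using v(2) by (blast elim: ereal_finiteE)
  show ?thesis using v b unfolding absorb_def r by (auto simp: zero_ereal_def)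
qed

definition mark_down :: com where
  "mark_down = For 10 (sc 1) (If (ILess (INum 0) (ICell 5 (sc 6)))
     (ISet 5 (ISub (sc 6) (ICell 4 (sc 10))) (INum 1)) Skip)"

definition mark :: com where
  "mark = Seq (VSet 1 (INum 0) VZero)
     (For 11 (ICell 3 (sc 1))
       (Seq (ISet 6 (INum 0) (ISub (ISub (ICell 3 (sc 1)) (INum 1)) (sc 11)))
         (Seq absorb (Seq decode mark_down))))"

definition tabulates :: "nat \<Rightarrow> nat \<Rightarrow> (nat list \<Rightarrow> bool) \<Rightarrow> (nat \<Rightarrow> nat) \<Rightarrow> bool" where
  "tabulates k n P m \<longleftrightarrow> (\<forall>x\<in>cube {0..k} n. m (pos k x) = of_bool (P x))"

lemma tabulates_set:
  assumes "tabulates k n P m" "y \<in> cube {0..k} n"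
  shows "tabulates k n (\<lambda>x. P x \<or> x = y) (m(pos k y := 1))"
  using assms inj_onD[OF pos_inj, of k _ y n] by (auto simp: tabulates_def)

lemma tabulates_cong: "tabulates k n P m \<Longrightarrow> (\<And>x. x \<in> cube {0..k} n \<Longrightarrow> P x = P' x) \<Longrightarrow> tabulates k n P' m"
  by (auto simp: tabulates_def)

lemma run_mark_down:
  assumes env: "env k n s" and x: "x \<in> cube {0..k} n" and p: "ints s 6 0 = pos k x"
    and W: "\<forall>j<n. ints s 4 j = x ! j * (k + 1) ^ j"
    and U: "tabulates k n P (ints s 5)"
  shows "run mark_down s (2 + n * 4)
    (\<lambda>s'. tabulates k n (\<lambda>y. P y \<or> P x \<and> (\<exists>j<n. y = x[j := 0])) (ints s' 5) \<and>
      (\<forall>a. a \<notin> {5, 10} \<longrightarrow> ints s' a = ints s a) \<and> vals s' = vals s)"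
proof -
  have len: "length x = n" using x by (simp add: cube_iff)
  let ?P = "\<lambda>j y. P y \<or> P x \<and> (\<exists>i<j. y = x[i := 0])"
  let ?I = "\<lambda>j s'. ints s' 10 0 = j \<and> tabulates k n (?P j) (ints s' 5) \<and>
    (\<forall>a. a \<notin> {5, 10} \<longrightarrow> ints s' a = ints s a) \<and> vals s' = vals s"
  have "run mark_down s (2 + n * (2 + 2)) (\<lambda>s'. tabulates k n (?P n) (ints s' 5) \<and>
      (\<forall>a. a \<notin> {5, 10} \<longrightarrow> ints s' a = ints s a) \<and> vals s' = vals s)"
    unfolding mark_down_def
  proof (rule run_For[where I = ?I])
    fix j and s1 :: state assume j: "j < n" and I: "?I j s1"
    have c: "x[j := 0] \<in> cube {0..k} n" using x by (intro cube_update) auto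
    have e: "ints s1 6 0 - ints s1 4 j = pos k (x[j := 0])"
      using I p W j len by (simp add: pos_clear)
    have "?P j x = P x" by auto
    then have Ux: "ints s1 5 (pos k x) = of_bool (P x)" using I x by (auto simp: tabulates_def)
    have "tabulates k n (?P (Suc j)) (if P x then (ints s1 5)(pos k (x[j := 0]) := 1) else ints s1 5)"
    proof (cases "P x")
      case True
      have "tabulates k n (\<lambda>y. ?P j y \<or> y = x[j := 0]) ((ints s1 5)(pos k (x[j := 0]) := 1))"
        using I c by (intro tabulates_set) auto
      then show ?thesis using True by (auto simp: less_Suc_eq elim!: tabulates_cong)
    next
      case False then show ?thesis using I by (auto elim!: tabulates_cong)
    qed
    then show "run (If (ILess (INum 0) (ICell 5 (sc 6)))
       (ISet 5 (ISub (sc 6) (ICell 4 (sc 10))) (INum 1)) Skip) s1 2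
       (\<lambda>s'. ?I (Suc j) (s'\<lparr>ints := upd (ints s') 10 0 (Suc (ints s' 10 0))\<rparr>))"
      using I p e Ux by (cases "P x") auto
  qed (use env U in \<open>auto simp: env_def\<close>)
  then show ?thesis by (simp add: mult.commute)
qed

text \<open>The points \<open>y\<close> with \<open>m \<le> pos k y\<close> have been visited.  Replacing a zero digit increases the position,
  so in this order the entry of a point is final when the point is visited.\<close>

definition marked :: "nat \<Rightarrow> nat \<Rightarrow> nat list set \<Rightarrow> nat \<Rightarrow> nat list \<Rightarrow> bool" where
  "marked k n F m x \<longleftrightarrow> m \<le> pos k x \<and> up F x \<or>
     (\<exists>y\<in>cube {0..k} n. \<exists>j<n. m \<le> pos k y \<and> up F y \<and> x = y[j := 0])"

lemma up_clear: "up F y \<Longrightarrow> up F (y[j := 0])"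
  unfolding up_def by (metis length_list_update nth_list_update nth_list_update_neq)

lemma marked_0: "marked k n F 0 x \<longleftrightarrow> up F x"
  by (auto simp: marked_def up_clear)

lemma marked_top: "x \<in> cube {0..k} n \<Longrightarrow> \<not> marked k n F ((k + 1) ^ n) x"
  using pos_less by (fastforce simp: marked_def not_le)

text \<open>If a point with a zero extends to \<open>z \<in> F\<close>, setting that digit as in
  \<open>z\<close> gives an extendable point at a higher position, which has been visited. A point
  without zeros extends only if it lies in \<open>F\<close>, which \<open>absorb\<close>
  detects.\<close>

lemma marked_self:
  assumes F: "F \<subseteq> cube {1..k} n" and x: "x \<in> cube {0..k} n"
  shows "marked k n F (Suc (pos k x)) x \<or> x \<in> F \<longleftrightarrow> up F x"
proof
  assume "up F x"
  then obtain z where z: "z \<in> F" "\<forall>i<n. x ! i \<noteq> 0 \<longrightarrow> z ! i = x ! i"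
    using x by (auto simp: up_def cube_iff)
  show "marked k n F (Suc (pos k x)) x \<or> x \<in> F"
  proof (cases "x \<in> cube {1..k} n")
    case True
    then show ?thesis using up_full[OF F True] \<open>up F x\<close> by simp
  next
    case False
    then obtain j where j: "j < n" "x ! j = 0" using x by (force simp: cube_iff Suc_le_eq)
    have zj: "z ! j \<in> {1..k}" using z F j by (auto simp: cube_iff)
    have len: "length x = n" using x by (simp add: cube_iff)
    let ?y = "x[j := z ! j]"
    have "?y \<in> cube {0..k} n" using x zj by (intro cube_update) auto
    moreover have "up F ?y" using z j len by (auto simp: up_def nth_list_update)
    moreover have "pos k ?y = pos k x + z ! j * (k + 1) ^ j"
      using pos_update[of j x k "z ! j"] j len by simp
    then have "Suc (pos k x) \<le> pos k ?y" using zj by simp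
    moreover have "x = ?y[j := 0]" using j by (metis list_update_id list_update_overwrite)
    ultimately show ?thesis using j unfolding marked_def by blast
  qed
next
  assume "marked k n F (Suc (pos k x)) x \<or> x \<in> F"
  then show "up F x" by (auto simp: marked_def up_clear) (auto simp: up_def)
qed

lemma marked_step:
  assumes x: "x \<in> cube {0..k} n" and y: "y \<in> cube {0..k} n"
  shows "marked k n F (pos k x) y \<longleftrightarrow> marked k n F (Suc (pos k x)) y \<or>
    up F x \<and> (y = x \<or> (\<exists>j<n. y = x[j := 0]))"
proof -
  have le: "pos k x \<le> pos k z \<longleftrightarrow> Suc (pos k x) \<le> pos k z \<or> z = x" if "z \<in> cube {0..k} n" for z
    using inj_onD[OF pos_inj _ that x] by (auto simp: Suc_le_eq le_less)
  show ?thesis unfolding marked_def using le x y by blast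
qed

lemma run_mark:
  assumes env: "env k n s"
    and tab: "\<And>x. x \<in> cube {0..k} n \<Longrightarrow> vals s 0 (pos k x) = (if x \<in> cube {1..k} n then f x else \<infinity>)"
    and R: "Rbar_valued (cube {1..k} n) f" and U0: "\<And>i. ints s 5 i = 0"
  shows "run mark s (3 + (k + 1) ^ n * (14 + n * (10 + k * 5)))
    (\<lambda>s'. tabulates k n (up (dom_on (cube {1..k} n) f)) (ints s' 5) \<and>
      (\<exists>b. vals s' 1 0 = ereal b \<and> 0 \<le> b \<and> (\<forall>x\<in>dom_on (cube {1..k} n) f. \<bar>f x\<bar> \<le> ereal b) \<and>
        (integer_valued (cube {1..k} n) f \<longrightarrow> b \<in> \<int>)) \<and>
      (\<forall>a. a \<notin> {4, 5, 6, 7, 8, 9, 10, 11, 21} \<longrightarrow> ints s' a = ints s a) \<and> vals s' 0 = vals s 0)"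
proof -
  define F where "F = dom_on (cube {1..k} n) f"
  let ?N = "(k + 1) ^ n"
  have F: "F \<subseteq> cube {1..k} n" by (auto simp: F_def dom_on_def)
  let ?fr = "\<lambda>s'. (\<forall>a. a \<notin> {4, 5, 6, 7, 8, 9, 10, 11, 21} \<longrightarrow> ints s' a = ints s a) \<and> vals s' 0 = vals s 0"
  let ?B = "\<lambda>m s'. \<exists>b. vals s' 1 0 = ereal b \<and> 0 \<le> b \<and> (\<forall>x\<in>F. m \<le> pos k x \<longrightarrow> \<bar>f x\<bar> \<le> ereal b) \<and>
        (integer_valued (cube {1..k} n) f \<longrightarrow> b \<in> \<int>)"
  let ?I = "\<lambda>t s'. ints s' 11 0 = t \<and> tabulates k n (marked k n F (?N - t)) (ints s' 5) \<and> ?B (?N - t) s' \<and> ?fr s'"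
  let ?T = "1 + (6 + ((3 + n * (6 + k * 5)) + (2 + n * 4)))"
  have "run (For 11 (ICell 3 (sc 1)) (Seq (ISet 6 (INum 0) (ISub (ISub (ICell 3 (sc 1)) (INum 1)) (sc 11)))
         (Seq absorb (Seq decode mark_down)))) (s\<lparr>vals := upd (vals s) 1 0 0\<rparr>) (2 + ?N * (?T + 2))
     (\<lambda>s'. tabulates k n (up F) (ints s' 5) \<and> ?B 0 s' \<and> ?fr s')"
  proof (rule run_For[where I = ?I])
    have "\<not> ?N \<le> pos k x" if "x \<in> F" for x
      using that F pos_less[of x k n] cube_mono[of "{1..k}" "{0..k}" n] by fastforce
    then have "?B ?N (s\<lparr>vals := upd (vals s) 1 0 0\<rparr>)" by (intro exI[of _ 0]) (auto simp: zero_ereal_def)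
    then show "?I 0 (s\<lparr>vals := upd (vals s) 1 0 0, ints := upd (ints (s\<lparr>vals := upd (vals s) 1 0 0\<rparr>)) 11 0 0\<rparr>)"
      using U0 marked_top[of _ k n F] by (auto simp: tabulates_def)
    show "ints s' 11 0 = t \<and> ival (ICell 3 (sc 1)) s' = ?N" if "?I t s'" for t s'
      using that env by (auto simp: env_def)
    show "tabulates k n (up F) (ints s' 5) \<and> ?B 0 s' \<and> ?fr s'" if "?I ?N s'" for s'
      using that by (simp add: marked_0[abs_def])
    fix t and s1 :: state assume t: "t < ?N" and I: "?I t s1"
    \<comment> \<open>The counter \<open>t\<close> runs upward and the position downward: after
      \<open>t\<close> rounds the positions from \<open>?N - t\<close> on are done, and
      \<open>p\<close> is the current one.\<close>
    define p where "p = ?N - Suc t"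
    have Np: "?N - t = Suc p" using t by (simp add: p_def)
    obtain x where x: "x \<in> cube {0..k} n" "pos k x = p"
      using pos_surj[of p k n] t by (auto simp: p_def)
    obtain b where b: "vals s1 1 0 = ereal b" "0 \<le> b" "\<forall>x\<in>F. Suc p \<le> pos k x \<longrightarrow> \<bar>f x\<bar> \<le> ereal b"
        "integer_valued (cube {1..k} n) f \<longrightarrow> b \<in> \<int>"
      using I unfolding Np by blast
    let ?s = "s1\<lparr>ints := upd (ints s1) 6 0 p\<rparr>"
    let ?v = "if x \<in> cube {1..k} n then f x else \<infinity>"
    have vF: "?v < \<infinity> \<longleftrightarrow> x \<in> F" by (auto simp: F_def dom_on_def)
    have vZ: "?v \<in> insert \<infinity> (ereal ` \<int>)" if "integer_valued (cube {1..k} n) f"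
      using that by (auto simp: integer_valued_def dom_on_def)
    have absorb: "run absorb ?s 6 (\<lambda>s'. (\<forall>a. a \<noteq> 5 \<longrightarrow> ints s' a = ints ?s a) \<and>
      ints s' 5 = (if ?v < \<infinity> then (ints ?s 5)(ints ?s 6 0 := 1) else ints ?s 5) \<and> vals s' 0 = vals ?s 0 \<and>
      (\<exists>b'. vals s' 1 0 = ereal b' \<and> b \<le> b' \<and> (?v < \<infinity> \<longrightarrow> \<bar>?v\<bar> \<le> ereal b') \<and>
      (b \<in> \<int> \<longrightarrow> ?v \<in> insert \<infinity> (ereal ` \<int>) \<longrightarrow> b' \<in> \<int>)))"
      by (rule run_absorb) (use I x tab[OF x(1)] b R in \<open>auto simp: Rbar_valued_def\<close>)
    \<comment> \<open>The content of the table after \<open>absorb\<close>, before the entry of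
      \<open>x\<close> is passed on to the points with one digit cleared.\<close>
    let ?Q = "\<lambda>y. marked k n F (Suc p) y \<or> x \<in> F \<and> y = x"
    have Qx: "?Q x \<longleftrightarrow> up F x" using marked_self[OF F x(1)] x(2) by auto
    have fin: "marked k n F p y \<longleftrightarrow> ?Q y \<or> ?Q x \<and> (\<exists>j<n. y = x[j := 0])" if "y \<in> cube {0..k} n" for y
      using marked_step[OF x(1) that, of F] Qx x(2) by auto
    show "run (Seq (ISet 6 (INum 0) (ISub (ISub (ICell 3 (sc 1)) (INum 1)) (sc 11)))
         (Seq absorb (Seq decode mark_down))) s1 ?T
       (\<lambda>s'. ?I (Suc t) (s'\<lparr>ints := upd (ints s') 11 0 (Suc (ints s' 11 0))\<rparr>))"
    proof -
      have "ints s1 3 (ints s1 1 0) - 1 - ints s1 11 0 = p"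
        using I env by (auto simp: env_def p_def)
      then have st: "s1\<lparr>ints := upd (ints s1) 6 (ival (INum 0) s1)
          (ival (ISub (ISub (ICell 3 (sc 1)) (INum 1)) (sc 11)) s1)\<rparr> = ?s" by simp
      show ?thesis
        unfolding wp_Seq wp_ISet st
      proof (rule wp_run[OF absorb], elim conjE exE)
        fix ta :: nat and b' :: real and sa :: state
        assume ta: "ta \<le> 6" and fa: "\<forall>a. a \<noteq> 5 \<longrightarrow> ints sa a = ints ?s a"
          and Ua: "ints sa 5 = (if ?v < \<infinity> then (ints ?s 5)(ints ?s 6 0 := 1) else ints ?s 5)"
          and va: "vals sa 0 = vals ?s 0" and ba: "vals sa 1 0 = ereal b'" "b \<le> b'"
            "?v < \<infinity> \<longrightarrow> \<bar>?v\<bar> \<le> ereal b'" "b \<in> \<int> \<longrightarrow> ?v \<in> insert \<infinity> (ereal ` \<int>) \<longrightarrow> b' \<in> \<int>"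
        have enva: "env k n sa" and pa: "ints sa 6 0 = pos k x"
          using env fa I x(2) by (auto simp: env_def)
        have UU: "tabulates k n ?Q (ints sa 5)"
        proof (cases "x \<in> F")
          case True
          then show ?thesis using tabulates_set[of k n "marked k n F (Suc p)" "ints s1 5" x] I x Ua vF Np by auto
        next
          case False
          then show ?thesis using I Ua vF Np by auto
        qed
        have bF: "\<bar>f y\<bar> \<le> ereal b'" if y: "y \<in> F" "p \<le> pos k y" for y
        proof (cases "y = x")
          case True
          then show ?thesis using ba(3) vF y F by auto
        next
          case False
          have "y \<in> cube {0..k} n" using y F cube_mono[of "{1..k}" "{0..k}" n] by auto
          then have "pos k y \<noteq> p" using False inj_onD[OF pos_inj _ _ x(1)] x(2) by metis
          then have "\<bar>f y\<bar> \<le> ereal b" using y b(3) by auto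
          also have "\<dots> \<le> ereal b'" using ba by simp
          finally show ?thesis .
        qed
        have B: "?B p sa" using ba b vZ bF by (intro exI[of _ b']) auto
        show "wp decode sa (\<lambda>t1 s1. wp mark_down s1 (\<lambda>t2 s'. 1 + (ta + (t1 + t2)) \<le> ?T \<and>
            ?I (Suc t) (s'\<lparr>ints := upd (ints s') 11 0 (Suc (ints s' 11 0))\<rparr>)))"
        proof (rule wp_run[OF run_decode[OF enva x(1) pa]], elim conjE)
          fix td :: nat and sd :: state
          assume td: "td \<le> 3 + n * (6 + k * 5)" and Wd: "\<forall>j<n. ints sd 4 j = x ! j * (k + 1) ^ j"
            and fd: "\<forall>a. a \<notin> {4, 7, 8, 9, 21} \<longrightarrow> ints sd a = ints sa a" and vd: "vals sd = vals sa"
          have envd: "env k n sd" and pd: "ints sd 6 0 = pos k x"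
            using enva fd pa by (auto simp: env_def)
          have Ud: "tabulates k n ?Q (ints sd 5)" using UU fd by auto
          show "wp mark_down sd (\<lambda>t2 s'. 1 + (ta + (td + t2)) \<le> ?T \<and>
              ?I (Suc t) (s'\<lparr>ints := upd (ints s') 11 0 (Suc (ints s' 11 0))\<rparr>))"
          proof (rule wp_run[OF run_mark_down[OF envd x(1) pd Wd Ud]], elim conjE)
            fix tm :: nat and s' :: state
            assume tm: "tm \<le> 2 + n * 4"
              and Um: "tabulates k n (\<lambda>y. ?Q y \<or> ?Q x \<and> (\<exists>j<n. y = x[j := 0])) (ints s' 5)"
              and fm: "\<forall>a. a \<notin> {5, 10} \<longrightarrow> ints s' a = ints sd a" and vm: "vals s' = vals sd"
            have "tabulates k n (marked k n F p) (ints s' 5)"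
              using Um by (rule tabulates_cong) (use fin in blast)
            moreover have "?N - Suc t = p" by (simp add: p_def)
            moreover have "?B p s'" using B vm vd by simp
            moreover have "ints s' 11 0 = t" "?fr s'" using fm fd fa vm vd va I by auto
            ultimately show "1 + (ta + (td + tm)) \<le> ?T \<and>
                ?I (Suc t) (s'\<lparr>ints := upd (ints s') 11 0 (Suc (ints s' 11 0))\<rparr>)"
              using ta td tm by simp
          qed
        qed
      qed
    qed
  qed
  then show ?thesis unfolding mark_def F_def by (auto elim!: wp_mono simp: algebra_simps)
qed

section \<open>Second pass: consistency check and new values\<close>

text \<open>Starting at the position with digit \<open>j\<close> cleared, repeated addition of
  \<open>(k + 1) ^ j\<close> steps through the \<open>k\<close> nonzero values of that
  digit.\<close>

definition count :: com where
  "count = Seq (ISet 16 (INum 0) (ISub (sc 6) (ICell 4 (sc 10))))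
     (Seq (inc 12 (INum 0) (ICell 5 (sc 16)))
     (Seq (ISet 17 (INum 0) (INum 0))
     (For 9 (sc 0) (Seq (inc 16 (INum 0) (ICell 3 (sc 10))) (inc 17 (INum 0) (ICell 5 (sc 16)))))))"

text \<open>Two additions triple the value for each zero digit, which builds
  \<open>- (B * 3 ^ zeros x)\<close> along with the count. Digit times power is itself the position
  of the point that keeps only this digit, so the entry of array 4 serves directly as an address in
  the table of \<open>up F\<close>.\<close>

definition digit :: com where
  "digit = Seq count (Seq
     (If (ILess (INum 0) (ICell 4 (sc 10))) Skip
       (Seq (VSet 2 (INum 0) (VAdd (vs 2) (VAdd (vs 2) (vs 2))))
       (Seq (inc 13 (INum 0) (INum 1))
         (If (ILess (sc 17) (INum 2)) (ISet 14 (INum 0) (INum 1)) Skip))))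
     (If (And (ILess (INum 1) (sc 17))
            (And (ILess (INum 0) (ICell 5 (ICell 4 (sc 10)))) (ILess (ICell 5 (sc 6)) (INum 1))))
        (ISet 15 (INum 0) (INum 1)) Skip))"

text \<open>The two comparisons with cell 1 of the last test express \<open>n = 2\<close>; in that
  case nothing is written, because \<open>solve_binary\<close> starts from the table of
  \<open>f\<close>. Otherwise writing in place is harmless, since the scan never reads value array
  0. Values written for an inconsistent input do not matter, as the answer is then negative.\<close>

definition scan_point :: com where
  "scan_point = Seq decode (Seq (ISet 12 (INum 0) (INum 0)) (Seq (ISet 13 (INum 0) (INum 0))
     (Seq (ISet 14 (INum 0) (INum 0)) (Seq (VSet 2 (INum 0) (VSub VZero (vs 1)))
     (Seq (For 10 (sc 1) digit)
     (Seq (If (And (ILess (INum 2) (sc 12)) (ILess (ICell 5 (sc 6)) (INum 1)))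
            (ISet 15 (INum 0) (INum 1)) Skip)
       (If (And (ILess (INum 0) (sc 13)) (And (ILess (sc 14) (INum 1))
              (Not (And (ILess (sc 1) (INum 3)) (ILess (INum 1) (sc 1))))))
          (VSet 0 (sc 6) (vs 2)) Skip)))))))"

definition scan :: com where
  "scan = For 6 (ICell 3 (sc 1)) scan_point"

abbreviation degree :: "nat \<Rightarrow> (nat list \<Rightarrow> bool) \<Rightarrow> nat list \<Rightarrow> nat \<Rightarrow> nat" where
  "degree k P x j \<equiv> card {b \<in> {1..k}. P (x[j := b])}"

definition violates :: "nat \<Rightarrow> nat \<Rightarrow> (nat list \<Rightarrow> bool) \<Rightarrow> nat list \<Rightarrow> bool" where
  "violates k n P x \<longleftrightarrow> \<not> P x \<and> (3 \<le> card {j. j < n \<and> P (x[j := 0])} \<or>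
     (\<exists>j<n. 2 \<le> degree k P x j \<and> P ((replicate n 0)[j := x ! j])))"

text \<open>For closed \<open>F\<close> and \<open>P = up F\<close> this is membership of a point
  with zeros in \<open>closure\<close>, by \<open>closure_iff\<close>.\<close>

definition inner_point :: "nat \<Rightarrow> nat \<Rightarrow> (nat list \<Rightarrow> bool) \<Rightarrow> nat list \<Rightarrow> bool" where
  "inner_point k n P x \<longleftrightarrow> 0 \<in> set x \<and> (\<forall>j<n. x ! j = 0 \<longrightarrow> 2 \<le> degree k P x j)"

lemma card_less_Suc: "card {i. i < Suc j \<and> Q i} = card {i. i < j \<and> Q i} + of_bool (Q j)"
proof -
  have "{i. i < Suc j \<and> Q i} = {i. i < j \<and> Q i} \<union> (if Q j then {j} else {})"
    by (auto simp: less_Suc_eq)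
  then show ?thesis by simp
qed

lemma card_upto_Suc: "card {i \<in> {1..Suc j}. Q i} = card {i \<in> {1..j}. Q i} + of_bool (Q (Suc j))"
proof -
  have "{i \<in> {1..Suc j}. Q i} = {i \<in> {1..j}. Q i} \<union> (if Q (Suc j) then {Suc j} else {})"
    by (auto simp: le_Suc_eq)
  then show ?thesis by simp
qed

lemma run_count:
  assumes env: "env k n s" and x: "x \<in> cube {0..k} n" and p: "ints s 6 0 = pos k x"
    and W: "\<forall>j<n. ints s 4 j = x ! j * (k + 1) ^ j"
    and U: "tabulates k n P (ints s 5)" and j: "j < n" "ints s 10 0 = j"
  shows "run count s (5 + k * 4)
    (\<lambda>s'. ints s' 17 0 = degree k P x j \<and> ints s' 12 0 = ints s 12 0 + of_bool (P (x[j := 0])) \<and>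
      (\<forall>a. a \<notin> {9, 12, 16, 17} \<longrightarrow> ints s' a = ints s a) \<and> vals s' = vals s)"
proof -
  have len: "length x = n" using x by (simp add: cube_iff)
  have cub: "x[j := b] \<in> cube {0..k} n" if "b \<le> k" for b
    using x that by (intro cube_update) auto
  have tab: "ints s 5 (pos k (x[j := b])) = of_bool (P (x[j := b]))" if "b \<le> k" for b
    using U cub[OF that] by (simp add: tabulates_def)
  have q0: "ints s 6 0 - ints s 4 j = pos k (x[j := 0])"
    using p W j len by (simp add: pos_clear)
  let ?h = "ints s 12 0 + of_bool (P (x[j := 0]))"
  let ?I = "\<lambda>b s'. ints s' 9 0 = b \<and> ints s' 16 0 = pos k (x[j := b]) \<and>
     ints s' 17 0 = card {b' \<in> {1..b}. P (x[j := b'])} \<and> ints s' 12 0 = ?h \<and>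
     (\<forall>a. a \<notin> {9, 12, 16, 17} \<longrightarrow> ints s' a = ints s a) \<and> vals s' = vals s"
  let ?Q = "\<lambda>s'. ints s' 17 0 = degree k P x j \<and> ints s' 12 0 = ?h \<and>
      (\<forall>a. a \<notin> {9, 12, 16, 17} \<longrightarrow> ints s' a = ints s a) \<and> vals s' = vals s"
  have loop: "run (For 9 (sc 0) (Seq (inc 16 (INum 0) (ICell 3 (sc 10))) (inc 17 (INum 0) (ICell 5 (sc 16)))))
     s1 (2 + k * (2 + 2)) ?Q" if s1: "?I 0 (s1\<lparr>ints := upd (ints s1) 9 0 0\<rparr>)" for s1
  proof (rule run_For[where I = ?I])
    show "ints s' 9 0 = b \<and> ival (sc 0) s' = k" if "?I b s'" for b s'
      using that env by (auto simp: env_def)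
    fix b and s2 :: state assume b: "b < k" and I: "?I b s2"
    have K: "ints s2 3 (ints s2 10 0) = (k + 1) ^ j" using I env j by (auto simp: env_def)
    have st: "pos k (x[j := b]) + (k + 1) ^ j = pos k (x[j := Suc b])"
      using pos_clear_update[of j x k b] pos_clear_update[of j x k "Suc b"] j len by simp
    show "run (Seq (inc 16 (INum 0) (ICell 3 (sc 10))) (inc 17 (INum 0) (ICell 5 (sc 16)))) s2 2
        (\<lambda>s'. ?I (Suc b) (s'\<lparr>ints := upd (ints s') 9 0 (Suc (ints s' 9 0))\<rparr>))"
      using I K st tab[of "Suc b"] b card_upto_Suc[of b "\<lambda>b'. P (x[j := b'])"] by auto
  qed (use s1 in auto)
  show ?thesis unfolding count_def wp_Seq wp_ISet wp_inc
    by (rule wp_run[OF loop]) (use j q0 tab[of 0] in auto)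
qed

lemma run_digits:
  assumes env: "env k n s" and x: "x \<in> cube {0..k} n" and p: "ints s 6 0 = pos k x"
    and W: "\<forall>j<n. ints s 4 j = x ! j * (k + 1) ^ j"
    and U: "tabulates k n P (ints s 5)"
    and init: "ints s 12 0 = 0" "ints s 13 0 = 0" "ints s 14 0 = 0" "ints s 15 0 = of_bool fl"
      "vals s 2 0 = ereal (- b)"
  shows "run (For 10 (sc 1) digit) s (2 + n * (14 + k * 4))
    (\<lambda>s'. ints s' 12 0 = card {j. j < n \<and> P (x[j := 0])} \<and> ints s' 13 0 = zeros x \<and>
      ints s' 14 0 = of_bool (\<exists>j<n. x ! j = 0 \<and> degree k P x j < 2) \<and>
      ints s' 15 0 = of_bool (fl \<or> \<not> P x \<and> (\<exists>j<n. 2 \<le> degree k P x j \<and> P ((replicate n 0)[j := x ! j]))) \<and>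
      vals s' 2 0 = ereal (- (b * 3 ^ zeros x)) \<and>
      (\<forall>a. a \<notin> {9, 10, 12, 13, 14, 15, 16, 17} \<longrightarrow> ints s' a = ints s a) \<and>
      (\<forall>a. a \<noteq> 2 \<longrightarrow> vals s' a = vals s a))"
proof -
  have len: "length x = n" using x by (simp add: cube_iff)
  let ?z = "\<lambda>j. card {i. i < j \<and> x ! i = 0}"
  let ?fl = "\<lambda>j. fl \<or> \<not> P x \<and> (\<exists>i<j. 2 \<le> degree k P x i \<and> P ((replicate n 0)[i := x ! i]))"
  let ?fr = "\<lambda>s'. (\<forall>a. a \<notin> {9, 10, 12, 13, 14, 15, 16, 17} \<longrightarrow> ints s' a = ints s a) \<and>
      (\<forall>a. a \<noteq> 2 \<longrightarrow> vals s' a = vals s a)"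
  let ?J = "\<lambda>j s'. ints s' 12 0 = card {i. i < j \<and> P (x[i := 0])} \<and> ints s' 13 0 = ?z j \<and>
      ints s' 14 0 = of_bool (\<exists>i<j. x ! i = 0 \<and> degree k P x i < 2) \<and>
      ints s' 15 0 = of_bool (?fl j) \<and>
      vals s' 2 0 = ereal (- (b * 3 ^ ?z j)) \<and> ?fr s'"
  let ?I = "\<lambda>j s'. ints s' 10 0 = j \<and> ?J j s'"
  have "run (For 10 (sc 1) digit) s (2 + n * (((5 + k * 4) + 7) + 2)) (?J n)"
  proof (rule run_For[where I = ?I])
    show "ints s' 10 0 = j \<and> ival (sc 1) s' = n" if "?I j s'" for j s'
      using that env by (auto simp: env_def)
    fix j and s1 :: state assume j: "j < n" and I: "?I j s1"
    have env1: "env k n s1" using I env by (auto simp: env_def)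
    have p1: "ints s1 6 0 = pos k x" using I p by simp
    have W1: "\<forall>j<n. ints s1 4 j = x ! j * (k + 1) ^ j" using I W by simp
    have U1: "tabulates k n P (ints s1 5)" using I U by simp
    have j1: "ints s1 10 0 = j" using I by simp
    have single: "(replicate n 0)[j := x ! j] \<in> cube {0..k} n"
      using x j by (auto simp: cube_iff nth_list_update)
    have us: "ints s1 5 (x ! j * (k + 1) ^ j) = of_bool (P ((replicate n 0)[j := x ! j]))"
      using U1 single pos_single[OF j, of k "x ! j"] by (auto simp: tabulates_def)
    have ux: "ints s1 5 (pos k x) = of_bool (P x)" using U1 x by (simp add: tabulates_def)
    have zj: "?z (Suc j) = ?z j + of_bool (x ! j = 0)" by (rule card_less_Suc)
    have hj: "card {i. i < Suc j \<and> P (x[i := 0])} = card {i. i < j \<and> P (x[i := 0])} + of_bool (P (x[j := 0]))"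
      by (rule card_less_Suc)
    have fj: "?fl (Suc j) \<longleftrightarrow> ?fl j \<or> \<not> P x \<and> 2 \<le> degree k P x j \<and> P ((replicate n 0)[j := x ! j])"
      by (auto simp: less_Suc_eq)
    have bj: "(\<exists>i<Suc j. x ! i = 0 \<and> degree k P x i < 2) \<longleftrightarrow>
       (\<exists>i<j. x ! i = 0 \<and> degree k P x i < 2) \<or> x ! j = 0 \<and> degree k P x j < 2"
      by (auto simp: less_Suc_eq)
    have tr: "ereal (- (b * 3 ^ m)) + (ereal (- (b * 3 ^ m)) + ereal (- (b * 3 ^ m))) = ereal (- (b * 3 ^ Suc m))" for m
      by simp
    show "run digit s1 ((5 + k * 4) + 7) (\<lambda>s'. ?I (Suc j) (s'\<lparr>ints := upd (ints s') 10 0 (Suc (ints s' 10 0))\<rparr>))"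
      unfolding digit_def wp_Seq
    proof (rule wp_run[OF run_count[OF env1 x p1 W1 U1 j j1]], elim conjE)
      fix t :: nat and s2 :: state
      assume t: "t \<le> 5 + k * 4" and c: "ints s2 17 0 = degree k P x j"
        and h: "ints s2 12 0 = ints s1 12 0 + of_bool (P (x[j := 0]))"
        and f: "\<forall>a. a \<notin> {9, 12, 16, 17} \<longrightarrow> ints s2 a = ints s1 a" and v: "vals s2 = vals s1"
      let ?d = "degree k P x j" and ?u = "P ((replicate n 0)[j := x ! j])"
      note S = c h f v I j1 us ux p1 W1 t
      show "wp (If (ILess (INum 0) (ICell 4 (sc 10))) Skip
           (Seq (VSet 2 (INum 0) (VAdd (vs 2) (VAdd (vs 2) (vs 2))))
             (Seq (inc 13 (INum 0) (INum 1)) (If (ILess (sc 17) (INum 2)) (ISet 14 (INum 0) (INum 1)) Skip)))) s2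
         (\<lambda>t1 s1. wp (If (And (ILess (INum 1) (sc 17))
            (And (ILess (INum 0) (ICell 5 (ICell 4 (sc 10)))) (ILess (ICell 5 (sc 6)) (INum 1))))
           (ISet 15 (INum 0) (INum 1)) Skip) s1
           (\<lambda>t2 s'. t + (t1 + t2) \<le> (5 + k * 4) + 7 \<and>
             ?I (Suc j) (s'\<lparr>ints := upd (ints s') 10 0 (Suc (ints s' 10 0))\<rparr>)))"
      proof -
        have g: "ints s2 17 0 = ?d" "ints s2 12 0 = card {i. i < j \<and> P (x[i := 0])} + of_bool (P (x[j := 0]))"
          "ints s2 13 0 = ?z j" "ints s2 14 0 = of_bool (\<exists>i<j. x ! i = 0 \<and> degree k P x i < 2)"
          "ints s2 15 0 = of_bool (?fl j)" "vals s2 2 0 = ereal (- (b * 3 ^ ?z j))"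
          "ints s2 10 0 = j" "ints s2 6 0 = pos k x" "ints s2 5 = ints s1 5"
          "ints s2 4 j = x ! j * (k + 1) ^ j"
          using S j by auto
        have fr: "ints s2 a = ints s a" if "a \<notin> {9, 10, 12, 13, 14, 15, 16, 17}" for a using that f I by simp
        have vr: "vals s2 a = vals s a" if "a \<noteq> 2" for a using that v I by simp
        \<comment> \<open>Opaque names for the compound conditions keep the case distinction
          small.\<close>
        define d e1 e2 e3 where "d = ?d" and "e1 = (\<exists>i<j. x ! i = 0 \<and> degree k P x i < 2)"
          and "e2 = ?fl j" and "e3 = ?u"
        show ?thesis
          unfolding zj hj fj bj
          using g t us ux j unfolding d_def[symmetric] e1_def[symmetric] e2_def[symmetric] e3_def[symmetric]
          by (cases "x ! j = 0"; cases "2 \<le> d"; cases e3; cases "P x") (simp_all add: tr fr vr)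
      qed
    qed
  qed (use init env in \<open>auto simp: env_def\<close>)
  then show ?thesis using len by (simp add: zeros_def add.commute)
qed

lemma run_scan_point:
  assumes env: "env k n s" and x: "x \<in> cube {0..k} n" and p: "ints s 6 0 = pos k x"
    and U: "tabulates k n P (ints s 5)"
    and init: "ints s 15 0 = of_bool fl" "vals s 1 0 = ereal b"
  shows "run scan_point s (15 + n * (20 + k * 9))
    (\<lambda>s'. ints s' 15 0 = of_bool (fl \<or> violates k n P x) \<and>
      vals s' 0 = (if n \<noteq> 2 \<and> inner_point k n P x
        then (vals s 0)(pos k x := ereal (- (b * 3 ^ zeros x))) else vals s 0) \<and>
      (\<forall>a. a \<notin> {4, 7, 8, 9, 10, 12, 13, 14, 15, 16, 17, 21} \<longrightarrow> ints s' a = ints s a) \<and>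
      vals s' 1 = vals s 1)"
  unfolding scan_point_def wp_Seq
proof (rule wp_run[OF run_decode[OF env x p]], elim conjE)
  fix t :: nat and s1 :: state
  assume t: "t \<le> 3 + n * (6 + k * 5)" and W: "\<forall>j<n. ints s1 4 j = x ! j * (k + 1) ^ j"
    and f1: "\<forall>a. a \<notin> {4, 7, 8, 9, 21} \<longrightarrow> ints s1 a = ints s a" and v1: "vals s1 = vals s"
  have len: "length x = n" using x by (simp add: cube_iff)
  have z: "0 < zeros x \<longleftrightarrow> 0 \<in> set x"
    by (auto simp: zeros_def card_gt_0_iff in_set_conv_nth)
  have inner: "inner_point k n P x \<longleftrightarrow> 0 < zeros x \<and> \<not> (\<exists>j<n. x ! j = 0 \<and> degree k P x j < 2)"
    unfolding inner_point_def z by (meson not_less)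
  let ?h = "card {j. j < n \<and> P (x[j := 0])}"
  let ?e = "\<exists>j<n. 2 \<le> degree k P x j \<and> P ((replicate n 0)[j := x ! j])"
  have viol: "violates k n P x \<longleftrightarrow> \<not> P x \<and> ?e \<or> \<not> P x \<and> 2 < ?h"
    by (auto simp: violates_def)
  have ux: "ints s 5 (pos k x) = of_bool (P x)" using U x by (simp add: tabulates_def)
  show "wp (ISet 12 (INum 0) (INum 0)) s1 (\<lambda>t1 s1. wp (ISet 13 (INum 0) (INum 0)) s1 (\<lambda>t2 s1.
    wp (ISet 14 (INum 0) (INum 0)) s1 (\<lambda>t3 s1. wp (VSet 2 (INum 0) (VSub VZero (vs 1))) s1 (\<lambda>t4 s1.
    wp (For 10 (sc 1) digit) s1 (\<lambda>t5 s1.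
    wp (If (And (ILess (INum 2) (sc 12)) (ILess (ICell 5 (sc 6)) (INum 1)))
            (ISet 15 (INum 0) (INum 1)) Skip) s1 (\<lambda>t6 s1.
    wp (If (And (ILess (INum 0) (sc 13)) (And (ILess (sc 14) (INum 1))
              (Not (And (ILess (sc 1) (INum 3)) (ILess (INum 1) (sc 1))))))
          (VSet 0 (sc 6) (vs 2)) Skip) s1 (\<lambda>t7 s'.
     t + (t1 + (t2 + (t3 + (t4 + (t5 + (t6 + t7)))))) \<le> 15 + n * (20 + k * 9) \<and>
     ints s' 15 0 = of_bool (fl \<or> violates k n P x) \<and>
      vals s' 0 = (if n \<noteq> 2 \<and> inner_point k n P x
        then (vals s 0)(pos k x := ereal (- (b * 3 ^ zeros x))) else vals s 0) \<and>
      (\<forall>a. a \<notin> {4, 7, 8, 9, 10, 12, 13, 14, 15, 16, 17, 21} \<longrightarrow> ints s' a = ints s a) \<and>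
      vals s' 1 = vals s 1)))))))"
    unfolding wp_ISet wp_VSet
  proof (rule wp_run[OF run_digits[OF _ x _ _ _, where P = P and fl = fl and b = b]], goal_cases)
    case 1 show ?case using env f1 by (auto simp: env_def)
  next
    case 2 show ?case using p f1 by simp
  next
    case 3 show ?case using W by simp
  next
    case 4 show ?case using U f1 by simp
  next
    case (10 t5 s2)
    note D = 10(2)
    have c: "ints s2 12 0 = ?h" "ints s2 13 0 = zeros x"
      "ints s2 14 0 = of_bool (\<exists>j<n. x ! j = 0 \<and> degree k P x j < 2)"
      "ints s2 15 0 = of_bool (fl \<or> \<not> P x \<and> ?e)" "vals s2 2 0 = ereal (- (b * 3 ^ zeros x))"
      using D by blast+
    have f2: "ints s2 a = ints s a" if "a \<notin> {4, 7, 8, 9, 10, 12, 13, 14, 15, 16, 17, 21}" for a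
      using D f1 that by simp
    have v2: "vals s2 a = vals s a" if "a \<noteq> 2" for a using D v1 that by simp
    have tt: "t + t5 \<le> 5 + n * (20 + k * 9)"
      using t 10(1) by (simp add: algebra_simps)
    define e d h where "e = ?e" and "d = (\<exists>j<n. x ! j = 0 \<and> degree k P x j < 2)" and "h = ?h"
    have nn: "ints s (Suc 0) 0 = n" using env by (simp add: env_def)
    show ?case unfolding viol inner
      using c tt unfolding e_def[symmetric] d_def[symmetric] h_def[symmetric]
      by (cases "P x"; cases e; cases "2 < h"; cases fl; cases d)
        (auto simp: f2 v2 ux nn p)
  qed (use f1 v1 init in \<open>auto simp: zero_ereal_def\<close>)
qed

lemma run_scan:
  assumes env: "env k n s" and U: "tabulates k n P (ints s 5)"
    and init: "ints s 15 0 = 0" "vals s 1 0 = ereal b"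
  shows "run scan s (2 + (k + 1) ^ n * (17 + n * (20 + k * 9)))
    (\<lambda>s'. ints s' 15 0 = of_bool (\<exists>x\<in>cube {0..k} n. violates k n P x) \<and>
      (\<forall>x\<in>cube {0..k} n. vals s' 0 (pos k x) = (if n \<noteq> 2 \<and> inner_point k n P x
        then ereal (- (b * 3 ^ zeros x)) else vals s 0 (pos k x))) \<and>
      (\<forall>a. a \<in> {0, 1, 2, 3} \<longrightarrow> ints s' a = ints s a))"
proof -
  let ?N = "(k + 1) ^ n"
  let ?V = "\<lambda>m s'. \<forall>x\<in>cube {0..k} n. vals s' 0 (pos k x) = (if pos k x < m \<and> n \<noteq> 2 \<and> inner_point k n P x
        then ereal (- (b * 3 ^ zeros x)) else vals s 0 (pos k x))"
  let ?fr = "\<lambda>s'. \<forall>a. a \<notin> {4, 6, 7, 8, 9, 10, 12, 13, 14, 15, 16, 17, 21} \<longrightarrow> ints s' a = ints s a"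
  let ?J = "\<lambda>m s'. ints s' 15 0 = of_bool (\<exists>x\<in>cube {0..k} n. pos k x < m \<and> violates k n P x) \<and>
     ?V m s' \<and> ?fr s' \<and> vals s' 1 0 = ereal b"
  have "run scan s (2 + ?N * ((15 + n * (20 + k * 9)) + 2))
    (\<lambda>s'. ints s' 15 0 = of_bool (\<exists>x\<in>cube {0..k} n. violates k n P x) \<and>
      (\<forall>x\<in>cube {0..k} n. vals s' 0 (pos k x) = (if n \<noteq> 2 \<and> inner_point k n P x
        then ereal (- (b * 3 ^ zeros x)) else vals s 0 (pos k x))) \<and>
      (\<forall>a. a \<in> {0, 1, 2, 3} \<longrightarrow> ints s' a = ints s a))"
    unfolding scan_def
  proof (rule run_For[where I = "\<lambda>m s'. ints s' 6 0 = m \<and> ?J m s'"])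
    show "ints s' 6 0 = m \<and> ival (ICell 3 (sc 1)) s' = ?N" if "ints s' 6 0 = m \<and> ?J m s'" for m s'
      using that env by (auto simp: env_def)
    have all: "(\<exists>x\<in>cube {0..k} n. pos k x < ?N \<and> violates k n P x) \<longleftrightarrow> (\<exists>x\<in>cube {0..k} n. violates k n P x)"
      using pos_less by blast
    show "ints s' 15 0 = of_bool (\<exists>x\<in>cube {0..k} n. violates k n P x) \<and>
      (\<forall>x\<in>cube {0..k} n. vals s' 0 (pos k x) = (if n \<noteq> 2 \<and> inner_point k n P x
        then ereal (- (b * 3 ^ zeros x)) else vals s 0 (pos k x))) \<and>
      (\<forall>a. a \<in> {0, 1, 2, 3} \<longrightarrow> ints s' a = ints s a)" if "ints s' 6 0 = ?N \<and> ?J ?N s'" for s'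
    proof (intro conjI ballI)
      show "ints s' 15 0 = of_bool (\<exists>x\<in>cube {0..k} n. violates k n P x)" using that all by simp
      show "\<forall>a. a \<in> {0, 1, 2, 3} \<longrightarrow> ints s' a = ints s a" using that by auto
      fix x assume x: "x \<in> cube {0..k} n"
      then have "vals s' 0 (pos k x) = (if pos k x < ?N \<and> n \<noteq> 2 \<and> inner_point k n P x
        then ereal (- (b * 3 ^ zeros x)) else vals s 0 (pos k x))" using that by blast
      then show "vals s' 0 (pos k x) = (if n \<noteq> 2 \<and> inner_point k n P x
        then ereal (- (b * 3 ^ zeros x)) else vals s 0 (pos k x))" using pos_less[OF x] by simp
    qed
    fix m and s1 :: state assume m: "m < ?N" and I: "ints s1 6 0 = m \<and> ?J m s1"
    obtain x where x: "x \<in> cube {0..k} n" "pos k x = m" using pos_surj[OF m] by blast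
    have env1: "env k n s1" using I env by (auto simp: env_def)
    have p1: "ints s1 6 0 = pos k x" using I x by simp
    have U1: "tabulates k n P (ints s1 5)" using I U by simp
    have less: "pos k y < Suc m \<longleftrightarrow> pos k y < m \<or> y = x" if "y \<in> cube {0..k} n" for y
      using x inj_onD[OF pos_inj _ that x(1)] by (auto simp: less_Suc_eq)
    have viol: "(\<exists>y\<in>cube {0..k} n. pos k y < Suc m \<and> violates k n P y) \<longleftrightarrow>
        (\<exists>y\<in>cube {0..k} n. pos k y < m \<and> violates k n P y) \<or> violates k n P x"
      using less x(1) by blast
    have f1: "ints s1 15 0 = of_bool (\<exists>x\<in>cube {0..k} n. pos k x < m \<and> violates k n P x)" "vals s1 1 0 = ereal b"
      using I by auto
    have Vm: "vals s1 0 (pos k y) = (if pos k y < m \<and> n \<noteq> 2 \<and> inner_point k n P y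
        then ereal (- (b * 3 ^ zeros y)) else vals s 0 (pos k y))" if "y \<in> cube {0..k} n" for y
      using I that by blast
    show "run scan_point s1 (15 + n * (20 + k * 9))
        (\<lambda>s'. ints (s'\<lparr>ints := upd (ints s') 6 0 (Suc (ints s' 6 0))\<rparr>) 6 0 = Suc m \<and>
          ?J (Suc m) (s'\<lparr>ints := upd (ints s') 6 0 (Suc (ints s' 6 0))\<rparr>))"
    proof (rule wp_run[OF run_scan_point[OF env1 x(1) p1 U1 f1]], elim conjE, goal_cases)
      case (1 t s')
      have V: "vals s' 0 (pos k y) = (if pos k y < Suc m \<and> n \<noteq> 2 \<and> inner_point k n P y
        then ereal (- (b * 3 ^ zeros y)) else vals s 0 (pos k y))" if y: "y \<in> cube {0..k} n" for y
      proof (cases "y = x")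
        case True
        have "vals s1 0 (pos k x) = vals s 0 (pos k x)" using Vm[OF x(1)] x(2) by simp
        then show ?thesis using 1(3) True x(2) by simp
      next
        case False
        then have "pos k y \<noteq> pos k x" using inj_onD[OF pos_inj _ y x(1)] by blast
        then have "vals s' 0 (pos k y) = vals s1 0 (pos k y)" using 1(3) by simp
        then show ?thesis using Vm[OF y] less[OF y] False by simp
      qed
      show ?case using 1(1,2,4,5) I V f1(2) unfolding viol by simp
    qed
  qed (use init in auto)
  then show ?thesis by (simp add: add.commute)
qed

section \<open>The program for dimension two\<close>

definition lower :: "iexp \<Rightarrow> vexp \<Rightarrow> com" where
  "lower i v = If (VLess v (VCell 0 i)) (VSet 0 i v) Skip"

definition same :: "nat \<Rightarrow> nat \<Rightarrow> test" where
  "same a b = And (Not (ILess (sc a) (sc b))) (Not (ILess (sc b) (sc a)))"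

lemma holds_same [simp]: "holds (same a b) s \<longleftrightarrow> ints s a 0 = ints s b 0"
  by (auto simp: same_def)

definition next_sc :: "nat \<Rightarrow> iexp" where
  "next_sc a = IAdd (sc a) (INum 1)"

text \<open>Counters start at 0 and digits at 1, hence the successors. Array 24 replaces
  multiplication by \<open>k + 1\<close>.\<close>

definition cell2 :: "nat \<Rightarrow> nat \<Rightarrow> iexp" where
  "cell2 a b = IAdd (next_sc a) (ICell 24 (next_sc b))"

definition multiples :: com where
  "multiples = Seq (ISet 24 (INum 0) (INum 0))
     (For 18 (sc 0) (ISet 24 (next_sc 18) (IAdd (ICell 24 (sc 18)) (ICell 3 (INum 1)))))"

text \<open>Cell 25 accumulates the position of the meet: only digits common to both points
  contribute.\<close>

definition meet_step :: com where
  "meet_step = Seq (ISet 25 (INum 0) (INum 0))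
     (Seq (If (same 18 20) (ISet 25 (INum 0) (next_sc 18)) Skip)
     (Seq (If (same 19 22) (ISet 25 (INum 0) (IAdd (sc 25) (ICell 24 (next_sc 19)))) Skip)
       (lower (sc 25) (VHalf (VAdd (VCell 0 (cell2 18 19)) (VCell 0 (cell2 20 22)))))))"

text \<open>\<open>INum 0\<close> is the position of \<open>[0, 0]\<close>. The entries at
  \<open>[a, 0]\<close> and \<open>[0, b]\<close> that are read here are final, because all meets
  have been treated before.\<close>

definition corner_step :: com where
  "corner_step = If (VLess (VCell 0 (cell2 18 19)) VInf)
     (lower (INum 0) (VSub (VAdd (VCell 0 (next_sc 18)) (VCell 0 (ICell 24 (next_sc 19)))) (VCell 0 (cell2 18 19))))
     Skip"

definition solve_binary :: com where
  "solve_binary = Seq multiples (Seq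
     (For 18 (sc 0) (For 19 (sc 0) (For 20 (sc 0) (For 22 (sc 0) meet_step))))
     (For 18 (sc 0) (For 19 (sc 0) corner_step)))"

text \<open>Made for nested loops whose invariant depends on the set of index tuples treated so far:
  round \<open>j\<close> contributes \<open>Z (Suc j)\<close>, and the order of the rounds is
  forgotten. \<open>frame\<close> demands that the invariant ignores the counter of this
  loop.\<close>

lemma run_For_union:
  fixes J :: "'a set \<Rightarrow> state \<Rightarrow> bool"
  assumes J: "J S s" and bnd: "\<And>S s. J S s \<Longrightarrow> ival bnd s = N"
    and frame: "\<And>S s v. J S s \<Longrightarrow> J S (s\<lparr>ints := upd (ints s) a 0 v\<rparr>)"
    and step: "\<And>j S s. j < N \<Longrightarrow> J S s \<Longrightarrow> ints s a 0 = j \<Longrightarrow>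
      run c s T (\<lambda>s'. ints s' a 0 = j \<and> J (S \<union> Z (Suc j)) s')"
  shows "run (For a bnd c) s (2 + N * (T + 2)) (\<lambda>s'. J (S \<union> (\<Union>j\<in>{1..N}. Z j)) s')"
proof (rule run_For[where I = "\<lambda>j s'. ints s' a 0 = j \<and> J (S \<union> (\<Union>i\<in>{1..j}. Z i)) s'"])
  show "run c s' T (\<lambda>s''. ints (s''\<lparr>ints := upd (ints s'') a 0 (Suc (ints s'' a 0))\<rparr>) a 0 = Suc j \<and>
      J (S \<union> (\<Union>i\<in>{1..Suc j}. Z i)) (s''\<lparr>ints := upd (ints s'') a 0 (Suc (ints s'' a 0))\<rparr>))"
    if j: "j < N" and I: "ints s' a 0 = j \<and> J (S \<union> (\<Union>i\<in>{1..j}. Z i)) s'" for j s'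
  proof -
    have e: "S \<union> (\<Union>i\<in>{1..j}. Z i) \<union> Z (Suc j) = S \<union> (\<Union>i\<in>{1..Suc j}. Z i)"
      by (simp add: atLeastAtMostSuc_conv Un_commute Un_left_commute)
    have "run c s' T (\<lambda>s''. ints s'' a 0 = j \<and> J (S \<union> (\<Union>i\<in>{1..j}. Z i) \<union> Z (Suc j)) s'')"
      by (rule step) (use I j in auto)
    then show ?thesis unfolding e by (rule wp_mono) (use frame in auto)
  qed
qed (use J frame bnd in auto)

definition binary_env :: "nat \<Rightarrow> state \<Rightarrow> bool" where
  "binary_env k s \<longleftrightarrow> ints s 0 0 = k \<and> (\<forall>b\<le>k. ints s 24 b = b * (k + 1))"

lemma run_multiples:
  assumes "env k 2 s"
  shows "run multiples s (3 + k * 3)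
    (\<lambda>s'. binary_env k s' \<and> (\<forall>a. a \<notin> {18, 24} \<longrightarrow> ints s' a = ints s a) \<and> vals s' = vals s)"
proof -
  have "run (For 18 (sc 0) (ISet 24 (next_sc 18) (IAdd (ICell 24 (sc 18)) (ICell 3 (INum 1)))))
     (s\<lparr>ints := upd (ints s) 24 0 0\<rparr>) (2 + k * (1 + 2))
     (\<lambda>s'. binary_env k s' \<and> (\<forall>a. a \<notin> {18, 24} \<longrightarrow> ints s' a = ints s a) \<and> vals s' = vals s)"
    apply (rule run_For[where I = "\<lambda>j s'. ints s' 18 0 = j \<and> (\<forall>b\<le>j. ints s' 24 b = b * (k + 1)) \<and>
      (\<forall>a. a \<notin> {18, 24} \<longrightarrow> ints s' a = ints s a) \<and> vals s' = vals s"])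
    using assms by (auto simp: env_def binary_env_def next_sc_def le_Suc_eq)
  then show ?thesis unfolding multiples_def by (auto elim!: wp_mono)
qed

lemma pos_pair: "pos k [a, b] = a + b * (k + 1)"
  by (simp add: pos_def)

lemma pair_cube: "[a, b] \<in> cube A 2 \<longleftrightarrow> a \<in> A \<and> b \<in> A"
  by (auto simp: cube_def)

lemma pair_exhaust: "x \<in> cube A 2 \<Longrightarrow> \<exists>a b. x = [a, b]"
  by (auto simp: cube_def length_Suc_conv numeral_2_eq_2)

text \<open>Describes a table entry after the pairs in \<open>S\<close> have been treated; the first
  argument of \<open>inf\<close> is its initial content.\<close>

definition partial_half :: "nat \<Rightarrow> (nat list \<Rightarrow> ereal) \<Rightarrow> (nat list \<times> nat list) set \<Rightarrow> nat list \<Rightarrow> ereal" where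
  "partial_half k f S m = inf (if m \<in> cube {1..k} 2 then f m else \<infinity>)
     (INF (x, y) \<in> {(x, y) \<in> S. kmeet x y = m}. (f x + f y) / 2)"

lemma partial_half_insert:
  "partial_half k f (insert (x, y) S) m =
     (if kmeet x y = m then inf ((f x + f y) / 2) (partial_half k f S m) else partial_half k f S m)"
proof -
  have "{(x', y') \<in> insert (x, y) S. kmeet x' y' = m} =
      (if kmeet x y = m then insert (x, y) {(x', y') \<in> S. kmeet x' y' = m} else {(x', y') \<in> S. kmeet x' y' = m})"
    by auto
  then show ?thesis by (simp add: partial_half_def min.left_commute)
qed

text \<open>The loops overwrite the table from which they read \<open>f\<close>. The reads stay
  correct because a meet \<open>m\<close> without zeros arises only from the pair
  \<open>(m, m)\<close>, whose average is \<open>f m\<close>.\<close>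

lemma partial_half_full:
  assumes "Rbar_valued (cube {1..k} 2) f" "S \<subseteq> cube {1..k} 2 \<times> cube {1..k} 2" "m \<in> cube {1..k} 2"
  shows "partial_half k f S m = f m"
proof -
  have "half k 2 f m \<le> (INF (x, y) \<in> {(x, y) \<in> S. kmeet x y = m}. (f x + f y) / 2)"
    unfolding half_def by (rule INF_superset_mono) (use assms in auto)
  moreover have "half k 2 f m = f m" using assms by (intro half_full) (auto simp: Rbar_valued_def)
  ultimately show ?thesis using assms(3) by (simp add: partial_half_def min_absorb1)
qed

lemma partial_half_empty: "partial_half k f {} m = (if m \<in> cube {1..k} 2 then f m else \<infinity>)"
  by (simp add: partial_half_def top_ereal_def)

lemma partial_half_all:
  assumes R: "Rbar_valued (cube {1..k} 2) f"
  shows "partial_half k f (cube {1..k} 2 \<times> cube {1..k} 2) m = half k 2 f m"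
proof (cases "m \<in> cube {1..k} 2")
  case True
  have "half k 2 f m = f m" using R True by (intro half_full) (auto simp: Rbar_valued_def)
  then show ?thesis using partial_half_full[OF R _ True] by simp
next
  case False
  then show ?thesis by (simp add: partial_half_def half_def min_absorb2)
qed

definition meet_inv :: "nat \<Rightarrow> (nat list \<Rightarrow> ereal) \<Rightarrow> (nat list \<times> nat list) set \<Rightarrow> state \<Rightarrow> bool" where
  "meet_inv k f S s \<longleftrightarrow> binary_env k s \<and> S \<subseteq> cube {1..k} 2 \<times> cube {1..k} 2 \<and>
     (\<forall>m\<in>cube {0..k} 2. vals s 0 (pos k m) = partial_half k f S m)"

lemma meet_inv_frame:
  "a \<notin> {0, 24} \<Longrightarrow> meet_inv k f S s \<Longrightarrow> meet_inv k f S (s\<lparr>ints := upd (ints s) a i v\<rparr>)"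
  by (auto simp: meet_inv_def binary_env_def)

lemma run_meet_step:
  assumes R: "Rbar_valued (cube {1..k} 2) f"
    and J: "meet_inv k f S s" and abcd: "a < k" "b < k" "c < k" "d < k"
    and cnt: "ints s 18 0 = a" "ints s 19 0 = b" "ints s 20 0 = c" "ints s 22 0 = d"
  shows "run meet_step s 7 (\<lambda>s'. meet_inv k f (S \<union> {([Suc a, Suc b], [Suc c, Suc d])}) s' \<and>
     (\<forall>i. i \<noteq> 25 \<longrightarrow> ints s' i = ints s i))"
proof -
  let ?x = "[Suc a, Suc b]" and ?y = "[Suc c, Suc d]"
  let ?m = "kmeet ?x ?y"
  have xy: "?x \<in> cube {1..k} 2" "?y \<in> cube {1..k} 2" using abcd by (auto simp: pair_cube)
  have xy0: "?x \<in> cube {0..k} 2" "?y \<in> cube {0..k} 2" using abcd by (auto simp: pair_cube)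
  have m: "?m \<in> cube {0..k} 2" using kmeet_cube xy0 by blast
  have m_eq: "?m = [if a = c then Suc a else 0, if b = d then Suc b else 0]" by (simp add: kmeet_def)
  have S: "S \<subseteq> cube {1..k} 2 \<times> cube {1..k} 2" using J by (simp add: meet_inv_def)
  have vx: "vals s 0 (pos k ?x) = f ?x" "vals s 0 (pos k ?y) = f ?y"
    using J xy xy0 partial_half_full[OF R S] by (auto simp: meet_inv_def)
  have px: "Suc (a + ints s 24 (Suc b)) = pos k ?x" "Suc (c + ints s 24 (Suc d)) = pos k ?y"
    using J abcd by (auto simp: meet_inv_def binary_env_def pos_pair)
  have pm: "(if a = c then Suc a else 0) + (if b = d then ints s 24 (Suc b) else 0) = pos k ?m"
    unfolding m_eq pos_pair using J abcd by (auto simp: meet_inv_def binary_env_def)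
  let ?w = "(f ?x + f ?y) / 2"
  let ?v = "if ?w < vals s 0 (pos k ?m) then (vals s 0)(pos k ?m := ?w) else vals s 0"
  have J': "\<forall>m'\<in>cube {0..k} 2. ?v (pos k m') = partial_half k f (S \<union> {(?x, ?y)}) m'"
  proof
    fix m' assume m': "m' \<in> cube {0..k} 2"
    have old: "vals s 0 (pos k m') = partial_half k f S m'" using J m' by (simp add: meet_inv_def)
    have "pos k m' = pos k ?m \<longleftrightarrow> ?m = m'" using inj_onD[OF pos_inj _ m' m] by auto
    then show "?v (pos k m') = partial_half k f (S \<union> {(?x, ?y)}) m'"
      using old by (auto simp: partial_half_insert min_def)
  qed
  have *: "S \<union> {(?x, ?y)} \<subseteq> cube {1..k} 2 \<times> cube {1..k} 2" using S xy by auto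
  have be: "binary_env k s" using J by (simp add: meet_inv_def)
  have "wp meet_step s (\<lambda>t s'. t \<le> 7 \<and> (\<forall>i. i \<noteq> 25 \<longrightarrow> ints s' i = ints s i) \<and> vals s' 0 = ?v)"
    using vx unfolding pm[symmetric] px[symmetric] meet_step_def lower_def next_sc_def cell2_def
    by (cases "a = c"; cases "b = d") (simp_all add: cnt)
  then show ?thesis
    by (rule wp_mono) (use J' * be in \<open>simp add: meet_inv_def binary_env_def\<close>)
qed

lemma run_meets:
  assumes R: "Rbar_valued (cube {1..k} 2) f" and J: "meet_inv k f {} s"
  shows "run (For 18 (sc 0) (For 19 (sc 0) (For 20 (sc 0) (For 22 (sc 0) meet_step)))) s
    (2 + k * (2 + k * (2 + k * (2 + k * (7 + 2) + 2) + 2) + 2))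
    (\<lambda>s'. meet_inv k f (cube {1..k} 2 \<times> cube {1..k} 2) s')"
proof -
  let ?J1 = "\<lambda>a S s. meet_inv k f S s \<and> ints s 18 0 = a"
  let ?J2 = "\<lambda>a b S s. meet_inv k f S s \<and> ints s 18 0 = a \<and> ints s 19 0 = b"
  let ?J3 = "\<lambda>a b c S s. meet_inv k f S s \<and> ints s 18 0 = a \<and> ints s 19 0 = b \<and> ints s 20 0 = c"
  let ?Z4 = "\<lambda>a b c d. {([a, b], [c, d])}"
  let ?Z3 = "\<lambda>a b c. \<Union>d\<in>{1..k}. ?Z4 a b c d"
  let ?Z2 = "\<lambda>a b. \<Union>c\<in>{1..k}. ?Z3 a b c"
  let ?Z1 = "\<lambda>a. \<Union>b\<in>{1..k}. ?Z2 a b"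
  have bnd: "meet_inv k f S s \<Longrightarrow> ints s 0 0 = k" for S s
    by (auto simp: meet_inv_def binary_env_def)
  have 3: "run (For 22 (sc 0) meet_step) s (2 + k * (7 + 2)) (\<lambda>s'. ?J3 a b c (S \<union> ?Z3 (Suc a) (Suc b) (Suc c)) s')"
    if "a < k" "b < k" "c < k" "?J3 a b c S s" for a b c S s
    apply (rule run_For_union[where J = "?J3 a b c"])
    subgoal using that by simp
    subgoal using bnd by auto
    subgoal by (auto intro: meet_inv_frame)
    subgoal for d S s by (rule wp_mono, rule run_meet_step[OF R, of S s a b c d]) (use that in auto)
    done
  have 2: "run (For 20 (sc 0) (For 22 (sc 0) meet_step)) s (2 + k * (2 + k * (7 + 2) + 2))
      (\<lambda>s'. ?J2 a b (S \<union> ?Z2 (Suc a) (Suc b)) s')"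
    if "a < k" "b < k" "?J2 a b S s" for a b S s
    apply (rule run_For_union[where J = "?J2 a b"])
    subgoal using that by simp
    subgoal using bnd by auto
    subgoal by (auto intro: meet_inv_frame)
    subgoal for c S s by (rule wp_mono, rule 3[of a b c S s]) (use that in auto)
    done
  have 1: "run (For 19 (sc 0) (For 20 (sc 0) (For 22 (sc 0) meet_step))) s
      (2 + k * (2 + k * (2 + k * (7 + 2) + 2) + 2)) (\<lambda>s'. ?J1 a (S \<union> ?Z1 (Suc a)) s')"
    if "a < k" "?J1 a S s" for a S s
    apply (rule run_For_union[where J = "?J1 a"])
    subgoal using that by simp
    subgoal using bnd by auto
    subgoal by (auto intro: meet_inv_frame)
    subgoal for b S s by (rule wp_mono, rule 2[of a b S s]) (use that in auto)
    done
  have 0: "run (For 18 (sc 0) (For 19 (sc 0) (For 20 (sc 0) (For 22 (sc 0) meet_step)))) s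
    (2 + k * (2 + k * (2 + k * (2 + k * (7 + 2) + 2) + 2) + 2))
    (\<lambda>s'. meet_inv k f ({} \<union> (\<Union>a\<in>{1..k}. ?Z1 a)) s')"
    apply (rule run_For_union[where J = "meet_inv k f"])
    subgoal using J .
    subgoal using bnd by auto
    subgoal by (auto intro: meet_inv_frame)
    subgoal for a S s by (rule wp_mono, rule 1[of a S s]) auto
    done
  have "{} \<union> (\<Union>a\<in>{1..k}. ?Z1 a) = cube {1..k} 2 \<times> cube {1..k} 2"
    using pair_exhaust[of _ "{1..k}"] by (fastforce simp: pair_cube)
  then show ?thesis using 0 by simp
qed

definition corner_inv :: "nat \<Rightarrow> (nat list \<Rightarrow> ereal) \<Rightarrow> (nat \<times> nat) set \<Rightarrow> state \<Rightarrow> bool" where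
  "corner_inv k f S s \<longleftrightarrow> binary_env k s \<and>
     (\<forall>m\<in>cube {0..k} 2. vals s 0 (pos k m) =
       (if m = [0, 0] then inf (half k 2 f [0, 0])
          (INF (a, b) \<in> {(a, b) \<in> S. f [a, b] < \<infinity>}. half k 2 f [a, 0] + half k 2 f [0, b] - f [a, b])
        else half k 2 f m))"

lemma corner_inv_frame:
  "a \<notin> {0, 24} \<Longrightarrow> corner_inv k f S s \<Longrightarrow> corner_inv k f S (s\<lparr>ints := upd (ints s) a i v\<rparr>)"
  by (auto simp: corner_inv_def binary_env_def)

lemma run_corner_step:
  assumes R: "Rbar_valued (cube {1..k} 2) f"
    and J: "corner_inv k f S s" and ab: "a < k" "b < k" and cnt: "ints s 18 0 = a" "ints s 19 0 = b"
  shows "run corner_step s 3 (\<lambda>s'. corner_inv k f (S \<union> {(Suc a, Suc b)}) s' \<and> ints s' = ints s)"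
proof -
  let ?H = "half k 2 f" and ?x = "[Suc a, Suc b]"
  let ?INF = "\<lambda>S. INF (a, b) \<in> {(a, b) \<in> S. f [a, b] < \<infinity>}. ?H [a, 0] + ?H [0, b] - f [a, b]"
  have be: "binary_env k s" using J by (simp add: corner_inv_def)
  have val: "vals s 0 (pos k m) = (if m = [0, 0] then inf (?H [0, 0]) (?INF S) else ?H m)"
    if "m \<in> cube {0..k} 2" for m
    using J that unfolding corner_inv_def by blast
  have x: "?x \<in> cube {1..k} 2" using ab by (simp add: pair_cube)
  have "?H ?x = f ?x" using R x by (intro half_full) (auto simp: Rbar_valued_def)
  then have vx: "vals s 0 (pos k ?x) = f ?x" using val[of ?x] ab by (simp add: pair_cube)
  have va: "vals s 0 (pos k [Suc a, 0]) = ?H [Suc a, 0]" "vals s 0 (pos k [0, Suc b]) = ?H [0, Suc b]"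
    using val[of "[Suc a, 0]"] val[of "[0, Suc b]"] ab by (auto simp: pair_cube)
  have px: "Suc (a + ints s 24 (Suc b)) = pos k ?x" "Suc a = pos k [Suc a, 0]"
    "ints s 24 (Suc b) = pos k [0, Suc b]" "0 = pos k [0, 0]"
    using be ab by (auto simp: binary_env_def pos_pair)
  let ?w = "?H [Suc a, 0] + ?H [0, Suc b] - f ?x"
  have va': "vals s 0 (Suc a) = ?H [Suc a, 0]" "vals s 0 (ints s 24 (Suc b)) = ?H [0, Suc b]"
    using va px by metis+
  have vx': "vals s 0 (Suc (a + ints s 24 (Suc b))) = f ?x" using vx px by metis
  let ?v = "if f ?x < \<infinity> \<and> ?w < vals s 0 0 then (vals s 0)(0 := ?w) else vals s 0"
  have ins: "?INF (S \<union> {(Suc a, Suc b)}) = (if f ?x < \<infinity> then inf ?w (?INF S) else ?INF S)"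
  proof -
    have "{(a', b') \<in> S \<union> {(Suc a, Suc b)}. f [a', b'] < \<infinity>} =
      (if f ?x < \<infinity> then insert (Suc a, Suc b) {(a', b') \<in> S. f [a', b'] < \<infinity>} else {(a', b') \<in> S. f [a', b'] < \<infinity>})"
      by auto
    then show ?thesis by simp
  qed
  have v0: "vals s 0 0 = inf (?H [0, 0]) (?INF S)" using val[of "[0, 0]"] px(4) by (simp add: pair_cube)
  have J': "\<forall>m\<in>cube {0..k} 2. ?v (pos k m) =
       (if m = [0, 0] then inf (?H [0, 0]) (?INF (S \<union> {(Suc a, Suc b)})) else ?H m)"
  proof
    fix m assume m: "m \<in> cube {0..k} 2"
    show "?v (pos k m) = (if m = [0, 0] then inf (?H [0, 0]) (?INF (S \<union> {(Suc a, Suc b)})) else ?H m)"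
    proof (cases "m = [0, 0]")
      case True
      then have "pos k m = 0" using px(4) by simp
      then show ?thesis unfolding ins using True v0 by (auto simp: min_def)
    next
      case False
      have "[0, 0] \<in> cube {0..k} 2" by (simp add: pair_cube)
      then have "pos k m \<noteq> 0" using False inj_onD[OF pos_inj _ m] px(4) by metis
      then show ?thesis using val[OF m] False by simp
    qed
  qed
  have "wp corner_step s (\<lambda>t s'. t \<le> 3 \<and> ints s' = ints s \<and> vals s' 0 = ?v)"
    unfolding corner_step_def lower_def next_sc_def cell2_def
    by (auto simp: cnt va' vx')
  then show ?thesis
    by (rule wp_mono) (use J' be in \<open>simp add: corner_inv_def binary_env_def\<close>)
qed

lemma run_corners:
  assumes R: "Rbar_valued (cube {1..k} 2) f" and J: "corner_inv k f {} s"
  shows "run (For 18 (sc 0) (For 19 (sc 0) corner_step)) s (2 + k * (2 + k * (3 + 2) + 2))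
    (\<lambda>s'. corner_inv k f ({1..k} \<times> {1..k}) s')"
proof -
  let ?J1 = "\<lambda>a S s. corner_inv k f S s \<and> ints s 18 0 = a"
  let ?Z1 = "\<lambda>a. \<Union>b\<in>{1..k}. {(a, b)}"
  have bnd: "corner_inv k f S s \<Longrightarrow> ints s 0 0 = k" for S s
    by (auto simp: corner_inv_def binary_env_def)
  have 1: "run (For 19 (sc 0) corner_step) s (2 + k * (3 + 2)) (\<lambda>s'. ?J1 a (S \<union> ?Z1 (Suc a)) s')"
    if "a < k" "?J1 a S s" for a S s
    apply (rule run_For_union[where J = "?J1 a"])
    subgoal using that by simp
    subgoal using bnd by auto
    subgoal by (auto intro: corner_inv_frame)
    subgoal for b S s by (rule wp_mono, rule run_corner_step[OF R, of S s a b]) (use that in auto)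
    done
  have 0: "run (For 18 (sc 0) (For 19 (sc 0) corner_step)) s (2 + k * (2 + k * (3 + 2) + 2))
    (\<lambda>s'. corner_inv k f ({} \<union> (\<Union>a\<in>{1..k}. ?Z1 a)) s')"
    apply (rule run_For_union[where J = "corner_inv k f"])
    subgoal using J .
    subgoal using bnd by auto
    subgoal by (auto intro: corner_inv_frame)
    subgoal for a S s by (rule wp_mono, rule 1[of a S s]) auto
    done
  have "{} \<union> (\<Union>a\<in>{1..k}. ?Z1 a) = {1..k} \<times> {1..k}" by auto
  then show ?thesis using 0 by simp
qed

lemma run_solve_binary:
  assumes R: "Rbar_valued (cube {1..k} 2) f" and env: "env k 2 s"
    and tab: "\<And>x. x \<in> cube {0..k} 2 \<Longrightarrow> vals s 0 (pos k x) = (if x \<in> cube {1..k} 2 then f x else \<infinity>)"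
  shows "run solve_binary s
    ((3 + k * 3) + ((2 + k * (2 + k * (2 + k * (2 + k * (7 + 2) + 2) + 2) + 2)) + (2 + k * (2 + k * (3 + 2) + 2))))
    (\<lambda>s'. \<forall>m\<in>cube {0..k} 2. vals s' 0 (pos k m) = binary k f m)"
  unfolding solve_binary_def wp_Seq
proof (rule wp_run[OF run_multiples[OF env]], elim conjE, goal_cases)
  case (1 t1 s1)
  have "meet_inv k f {} s1" using 1 tab by (auto simp: meet_inv_def partial_half_empty)
  from run_meets[OF R this] show ?case
  proof (rule wp_run, goal_cases)
    case (1 t2 s2)
    then have "corner_inv k f {} s2"
      by (auto simp: meet_inv_def corner_inv_def partial_half_all[OF R, simplified] top_ereal_def)
    from run_corners[OF R this] show ?case
    proof (rule wp_run, goal_cases)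
      case (1 t3 s3)
      then show ?case using \<open>t1 \<le> _\<close> \<open>t2 \<le> _\<close> by (simp add: corner_inv_def binary_def)
    qed
  qed
qed

section \<open>The whole program and its time bound\<close>

text \<open>For \<open>k = 1\<close> the answer is given at once, with the table left as it is.
  Index cell 2 is 0 initially, so rejection needs no assignment.\<close>

definition relax_program :: com where
  "relax_program = If (ILess (INum 1) (sc 0))
     (Seq powers (Seq mark (Seq scan
       (If (ILess (sc 15) (INum 1))
         (Seq (If (And (ILess (sc 1) (INum 3)) (ILess (INum 1) (sc 1))) solve_binary Skip)
           (ISet 2 (INum 0) (INum 1)))
         Skip))))
     (ISet 2 (INum 0) (INum 1))"

lemma consistent_iff_violates:
  "consistent k n F \<longleftrightarrow> (\<forall>x\<in>cube {0..k} n. \<not> violates k n (up F) x)"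
proof -
  have *: "c \<le> 2 \<longleftrightarrow> \<not> 3 \<le> c" for c :: nat by auto
  have "(up F w \<or> card {j. j < n \<and> up F (w[j := 0])} \<le> 2 \<and>
     (\<forall>j<n. 2 \<le> degree k (up F) w j \<longrightarrow> \<not> up F ((replicate n 0)[j := w ! j]))) \<longleftrightarrow>
     \<not> violates k n (up F) w" for w
    unfolding violates_def * by blast
  then show ?thesis unfolding consistent_def by simp
qed

text \<open>Off [k]^n the input table is infinite, so writing the inner points alone turns it into
  the table of \<open>spread\<close>.\<close>

lemma spread_eq:
  assumes dd: "dd_closed (dom_on (cube {1..k} n) f)" and x: "x \<in> cube {0..k} n"
  shows "spread k n f b x =
    (if inner_point k n (up (dom_on (cube {1..k} n) f)) x then ereal (- (b * 3 ^ zeros x))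
     else if x \<in> cube {1..k} n then f x else \<infinity>)"
proof -
  let ?F = "dom_on (cube {1..k} n) f"
  have F: "?F \<subseteq> cube {1..k} n" by (auto simp: dom_on_def)
  show ?thesis
  proof (cases "x \<in> cube {1..k} n")
    case True
    then have "0 \<notin> set x" by (auto simp: cube_def)
    then have "\<not> inner_point k n (up ?F) x" by (simp add: inner_point_def)
    moreover have "f x = \<infinity>" if "x \<notin> ?F" using that True by (auto simp: dom_on_def)
    ultimately show ?thesis using True closure_full[OF F True] by (simp add: spread_def Let_def)
  next
    case False
    then have "0 \<in> set x" using x by (auto simp: cube_def subset_iff Suc_le_eq)
    then have "x \<in> closure k n ?F \<longleftrightarrow> inner_point k n (up ?F) x"
      using closure_iff[OF dd F x] by (simp add: inner_point_def)
    moreover have "x \<notin> ?F" using False F by blast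
    ultimately show ?thesis using False by (simp add: spread_def Let_def)
  qed
qed

lemma relaxation_cong:
  assumes "\<And>x. x \<in> cube {0..k} n \<Longrightarrow> g x = g' x" "relaxation k n f g'"
  shows "relaxation k n f g"
proof -
  have "cube {1..k} n \<subseteq> cube {0..k} n" by (rule cube_mono) auto
  then show ?thesis using assms(2)
    by (auto simp: relaxation_def ksubmodular_def Rbar_valued_def assms(1) kmeet_cube kjoin_cube)
qed

lemma half_integer_cong:
  assumes "\<And>x. x \<in> cube {0..k} n \<Longrightarrow> g x = g' x" "half_integer_valued (cube {0..k} n) g'"
  shows "half_integer_valued (cube {0..k} n) g"
  using assms by (auto simp: half_integer_valued_def dom_on_def)

lemma greatest_relaxation:
  assumes g: "relaxation k n f g"
    and top: "\<And>h x. relaxation k n f h \<Longrightarrow> x \<in> cube {0..k} n \<Longrightarrow> h x \<le> g x"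
  shows "maximal_relaxation k n f g"
    and "maximal_relaxation k n f h \<Longrightarrow> x \<in> cube {0..k} n \<Longrightarrow> h x = g x"
  using assms unfolding maximal_relaxation_def by (blast intro: antisym, metis)

text \<open>[1]^n has a single point, so for two different points the larger side of the inequality
  is infinite.\<close>

lemma relaxation_unary_domain:
  assumes R: "Rbar_valued (cube {1..1} n) f"
  shows "relaxation 1 n f (\<lambda>x. if x \<in> cube {1..1} n then f x else \<infinity>)"
proof -
  let ?g = "\<lambda>x. if x \<in> cube {1..1} n then f x else \<infinity>"
  have "?g (kmeet x y) + ?g (kjoin x y) \<le> ?g x + ?g y" for x y
  proof (cases "x \<in> cube {1..1} n \<and> y \<in> cube {1..1} n")
    case True
    then have "\<forall>i<n. x ! i = 1 \<and> y ! i = 1" "length x = n" "length y = n" by (auto simp: cube_iff)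
    then have "x = y" "kmeet x y = x" "kjoin x y = x" by (auto intro!: nth_equalityI)
    then show ?thesis by simp
  qed auto
  then show ?thesis using R by (auto simp: relaxation_def ksubmodular_def Rbar_valued_def)
qed

text \<open>From \<open>n\<close> to \<open>n + 1\<close> the left side grows by the factor 3(n +
  2)/(n + 1), which is at most 4 from \<open>n = 2\<close> on; the step from 1 to 2 is computed. The
  quotient of the left side by \<open>4 ^ n\<close> peaks at 81/16, which 6 covers.\<close>

lemma power_bound:
  assumes "1 \<le> n"
  shows "3 ^ (n + 1) * (n + 1) \<le> (6 :: nat) * 4 ^ n"
  using assms
proof (induction n rule: dec_induct)
  case (step n)
  show ?case
  proof (cases "n = 1")
    case False
    have "3 ^ (Suc n + 1) * (Suc n + 1) = 3 ^ (n + 1) * (3 * n + 6 :: nat)" by (simp add: algebra_simps)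
    also have "\<dots> \<le> 3 ^ (n + 1) * (4 * (n + 1))" using step.hyps False by (intro mult_left_mono) auto
    also have "\<dots> = 4 * (3 ^ (n + 1) * (n + 1))" by (simp only: ac_simps)
    also have "\<dots> \<le> 4 * (6 * 4 ^ n)" using step.IH by (rule mult_left_mono) simp
    also have "\<dots> = 6 * 4 ^ Suc n" by simp
    finally show ?thesis .
  qed (simp add: eval_nat_numeral)
qed simp

text \<open>After multiplication by \<open>2 ^ (n + 1)\<close>, the estimate
  \<open>2 * (k + 1) \<le> 3 * k\<close> separates the powers of \<open>k\<close> from those of 3.
  The factor \<open>2 ^ (n - 1)\<close> that remains of \<open>4 ^ n\<close> is bounded by
  \<open>k ^ (n - 1)\<close>, which completes the exponent of \<open>k\<close> to
  \<open>2 * n\<close>.\<close>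

lemma size_bound:
  assumes "2 \<le> k" "1 \<le> n"
  shows "(k + 1) ^ n * (n + 1) * (k + 1) \<le> 6 * (k ^ n)\<^sup>2"
proof -
  obtain m where m: "n = Suc m" using assms(2) by (cases n) auto
  have "2 ^ (n + 1) * ((k + 1) ^ n * (n + 1) * (k + 1)) = (2 * (k + 1)) ^ (n + 1) * (n + 1)"
    by (simp only: power_mult_distrib power_add power_one_right ac_simps)
  also have "\<dots> \<le> (3 * k) ^ (n + 1) * (n + 1)"
    using assms(1) by (intro mult_right_mono power_mono) auto
  also have "\<dots> = 3 ^ (n + 1) * (n + 1) * k ^ (n + 1)"
    by (simp only: power_mult_distrib ac_simps)
  also have "\<dots> \<le> 6 * 4 ^ n * k ^ (n + 1)" by (intro mult_right_mono power_bound assms(2)) auto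
  also have "(4 :: nat) ^ n = 2 ^ (n + 1) * 2 ^ m"
  proof -
    have "(4 :: nat) ^ n = (2 ^ 2) ^ n" by simp
    also have "\<dots> = 2 ^ (n + 1) * 2 ^ m" by (simp only: power_mult[symmetric] power_add[symmetric]) (simp add: m)
    finally show ?thesis .
  qed
  also have "6 * (2 ^ (n + 1) * 2 ^ m) * k ^ (n + 1) \<le> 6 * (2 ^ (n + 1) * k ^ m) * k ^ (n + 1)"
    using assms(1) by (intro mult_right_mono mult_left_mono power_mono) auto
  also have "\<dots> = 2 ^ (n + 1) * (6 * (k ^ m * k ^ (n + 1)))" by (simp only: ac_simps)
  also have "k ^ m * k ^ (n + 1) = (k ^ n)\<^sup>2"
    by (simp only: power_mult[symmetric] power_add[symmetric]) (simp add: m mult_2_right)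
  finally show ?thesis by simp
qed

lemma run_relax_program:
  assumes k: "2 \<le> k" and n: "1 \<le> n" and R: "Rbar_valued (cube {1..k} n) f"
  shows "run relax_program (input k n f) (1000 * (k ^ n)\<^sup>2) (\<lambda>s.
    (accepts s \<longleftrightarrow> dd_closed (dom_on (cube {1..k} n) f)) \<and>
    (accepts s \<longrightarrow> (\<exists>b. 0 \<le> b \<and> (\<forall>x\<in>dom_on (cube {1..k} n) f. \<bar>f x\<bar> \<le> ereal b) \<and>
       (integer_valued (cube {1..k} n) f \<longrightarrow> b \<in> \<int>) \<and>
       (\<forall>x\<in>cube {0..k} n. result k s x = (if n = 2 then binary k f x else spread k n f b x)))))"
proof -
  let ?F = "dom_on (cube {1..k} n) f" and ?N = "(k + 1) ^ n"
  let ?X = "?N * (n + 1) * (k + 1)"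
  have F: "?F \<subseteq> cube {1..k} n" by (auto simp: dom_on_def)
  have X: "?X \<le> 6 * (k ^ n)\<^sup>2" using size_bound k n by blast
  have tab0: "vals (input k n f) 0 (pos k x) = (if x \<in> cube {1..k} n then f x else \<infinity>)"
    if "x \<in> cube {0..k} n" for x
    using result_input[OF that, of f] by (simp add: result_def)
  have i0: "ints (input k n f) 0 0 = k" "ints (input k n f) 1 0 = n" by (auto simp: input_def)
  have z0: "ints (input k n f) a i = 0" if "a \<notin> {0, 1}" for a i using that by (auto simp: input_def)
  have dd: "(\<exists>x\<in>cube {0..k} n. violates k n (up ?F) x) \<longleftrightarrow> \<not> dd_closed ?F"
    using consistent_iff_violates consistent_imp_dd_closed[OF _ F] dd_closed_imp_consistent[OF _ F] by blast
  let ?T1 = "3 + n * (5 + (k + 1) * 3)" and ?T2 = "3 + ?N * (14 + n * (10 + k * 5))"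
    and ?T3 = "2 + ?N * (17 + n * (20 + k * 9))"
  let ?T4 = "(3 + k * 3) + ((2 + k * (2 + k * (2 + k * (2 + k * (7 + 2) + 2) + 2) + 2)) + (2 + k * (2 + k * (3 + 2) + 2)))"
  let ?Q = "\<lambda>s. (accepts s \<longleftrightarrow> dd_closed ?F) \<and>
    (accepts s \<longrightarrow> (\<exists>b. 0 \<le> b \<and> (\<forall>x\<in>?F. \<bar>f x\<bar> \<le> ereal b) \<and>
       (integer_valued (cube {1..k} n) f \<longrightarrow> b \<in> \<int>) \<and>
       (\<forall>x\<in>cube {0..k} n. result k s x = (if n = 2 then binary k f x else spread k n f b x))))"
  have one: "1 \<le> (k ^ n)\<^sup>2" using k by simp
  \<comment> \<open>The three passes add up to at most \<open>42 * ?X\<close>, that is, 252 times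
    \<open>(k ^ n)\<^sup>2\<close>. With 100 for dimension two and 12 for the additive constants
    this stays well below 1000.\<close>
  have time: "?T1 + (?T2 + (?T3 + (3 + T))) + 1 \<le> 1000 * (k ^ n)\<^sup>2" if T: "T \<le> 100 * (k ^ n)\<^sup>2" for T
  proof -
    have e: "?N * (c * ((n + 1) * (k + 1))) = c * ?X" for c by (simp only: ac_simps)
    have "1 * (n * (5 + (k + 1) * 3)) \<le> ?N * (8 * ((n + 1) * (k + 1)))"
      by (rule mult_mono) (auto simp: algebra_simps)
    moreover have "?N * (14 + n * (10 + k * 5)) \<le> ?N * (14 * ((n + 1) * (k + 1)))"
      by (rule mult_left_mono) (auto simp: algebra_simps)
    moreover have "?N * (17 + n * (20 + k * 9)) \<le> ?N * (20 * ((n + 1) * (k + 1)))"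
      by (rule mult_left_mono) (auto simp: algebra_simps)
    ultimately have "n * (5 + (k + 1) * 3) \<le> 8 * ?X" "?N * (14 + n * (10 + k * 5)) \<le> 14 * ?X"
      "?N * (17 + n * (20 + k * 9)) \<le> 20 * ?X"
      unfolding e mult_1 .
    then show ?thesis using X one T by linarith
  qed
  have T4: "Suc ?T4 \<le> 100 * (k ^ n)\<^sup>2" if "n = 2"
  proof -
    \<comment> \<open>The coefficients add up to 40, and every power of \<open>k\<close> here is at
      most \<open>k ^ 4\<close>, which equals \<open>(k ^ n)\<^sup>2\<close> for
      \<open>n = 2\<close>.\<close>
    have "?T4 = 7 + 11 * k + 9 * k ^ 2 + 4 * k ^ 3 + 9 * k ^ 4"
      by (simp add: algebra_simps eval_nat_numeral)
    moreover have "k ^ 1 \<le> k ^ 4" "k ^ 2 \<le> k ^ 4" "k ^ 3 \<le> k ^ 4" "1 \<le> k ^ 4"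
      using k by (intro power_increasing one_le_power; simp)+
    moreover have "(k ^ n)\<^sup>2 = k ^ 4" using that by (simp add: power_mult[symmetric])
    ultimately show ?thesis by simp
  qed
  have "wp (Seq powers (Seq mark (Seq scan
       (If (ILess (sc 15) (INum 1))
         (Seq (If (And (ILess (sc 1) (INum 3)) (ILess (INum 1) (sc 1))) solve_binary Skip)
           (ISet 2 (INum 0) (INum 1)))
         Skip)))) (input k n f) (\<lambda>t s'. Suc t \<le> 1000 * (k ^ n)\<^sup>2 \<and> ?Q s')"
    unfolding wp_Seq
  proof (rule wp_run[OF run_powers[OF i0]], elim conjE, goal_cases)
    case (1 t1 s1)
    note s1 = this
    have tab1: "vals s1 0 (pos k x) = (if x \<in> cube {1..k} n then f x else \<infinity>)"
      if "x \<in> cube {0..k} n" for x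
      using s1(4) tab0[OF that] by simp
    show ?case
    proof (rule wp_run[OF run_mark[OF s1(2) tab1 R]], assumption, goal_cases)
      case (1 i) then show ?case using s1(3) z0 by simp
    next
      case (2 t2 s2)
      then obtain b where U: "tabulates k n (up ?F) (ints s2 5)" and b: "vals s2 1 0 = ereal b" "0 \<le> b"
          "\<forall>x\<in>?F. \<bar>f x\<bar> \<le> ereal b" "integer_valued (cube {1..k} n) f \<longrightarrow> b \<in> \<int>"
        and f2: "\<forall>a. a \<notin> {4, 5, 6, 7, 8, 9, 10, 11, 21} \<longrightarrow> ints s2 a = ints s1 a" and v2: "vals s2 0 = vals s1 0"
        by blast
      have t2: "t2 \<le> ?T2" using 2(1) .
      have env2: "env k n s2" using s1(2) f2 by (auto simp: env_def)
      have c15: "ints s2 15 0 = 0" using f2 s1(3) z0 by simp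
      show ?case
      proof (rule wp_run[OF run_scan[OF env2 U c15 b(1)]], elim conjE, goal_cases)
        case (1 t3 s3)
        note s3 = this
        have flag: "ints s3 15 0 = of_bool (\<not> dd_closed ?F)" using s3(2) dd by simp
        have env3: "env k n s3" using s3(4) env2 by (auto simp: env_def)
        have c2: "ints s3 2 0 = 0" using s3(4) f2 s1(3) z0 by simp
        have v3: "vals s3 0 (pos k x) = (if n \<noteq> 2 \<and> inner_point k n (up ?F) x then ereal (- (b * 3 ^ zeros x))
            else if x \<in> cube {1..k} n then f x else \<infinity>)" if "x \<in> cube {0..k} n" for x
          using s3(3) that v2 tab1[OF that] by simp
        have n3: "ints s3 (Suc 0) 0 = n" using env3 by (simp add: env_def)
        have tt: "t1 + (t2 + (t3 + (3 + T))) + 1 \<le> 1000 * (k ^ n)\<^sup>2" if "T \<le> 100 * (k ^ n)\<^sup>2" for T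
          using time[OF that] s1(1) t2 s3(1) by linarith
        show ?case
        proof (cases "dd_closed ?F")
          case False
          then show ?thesis using flag c2 tt[of 0] by (simp add: accepts_def)
        next
          case True
          have fill: "run (If (And (ILess (sc 1) (INum 3)) (ILess (INum 1) (sc 1))) solve_binary Skip) s3
            (100 * (k ^ n)\<^sup>2)
            (\<lambda>s'. \<forall>x\<in>cube {0..k} n. vals s' 0 (pos k x) = (if n = 2 then binary k f x else spread k n f b x))"
          proof (cases "n = 2")
            case n2: True
            have "env k 2 s3" using env3 n2 by simp
            moreover have "vals s3 0 (pos k x) = (if x \<in> cube {1..k} 2 then f x else \<infinity>)" if "x \<in> cube {0..k} 2" for x
              using v3[of x] that n2 by simp
            moreover have "Rbar_valued (cube {1..k} 2) f" using R n2 by simp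
            ultimately have "run solve_binary s3 ?T4 (\<lambda>s'. \<forall>m\<in>cube {0..k} 2. vals s' 0 (pos k m) = binary k f m)"
              using run_solve_binary by blast
            moreover have "holds (And (ILess (sc 1) (INum 3)) (ILess (INum 1) (sc 1))) s3" using n3 n2 by simp
            ultimately show ?thesis unfolding wp_If
              by (simp only: if_True) (erule wp_mono, use T4[OF n2] n2 in auto)
          next
            case False
            have "\<not> holds (And (ILess (sc 1) (INum 3)) (ILess (INum 1) (sc 1))) s3" using n3 False by auto
            moreover have "2 \<le> 100 * (k ^ n)\<^sup>2" using one by linarith
            moreover have "vals s3 0 (pos k x) = spread k n f b x" if "x \<in> cube {0..k} n" for x
              using v3[OF that] spread_eq[OF True that] False by simp
            ultimately show ?thesis unfolding wp_If using False by (simp only: if_False wp_Skip) simp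
          qed
          have ok: "holds (ILess (sc 15) (INum 1)) s3" using flag True by simp
          show ?thesis
            apply (subst wp_If)
            apply (simp only: ok if_True wp_Seq)
            apply (rule wp_run[OF fill])
            subgoal for t4 s4 using tt[of t4] True b by (auto simp: accepts_def result_def)
            done
        qed
      qed
    qed
  qed
  then show ?thesis using k unfolding relax_program_def by (simp add: i0)
qed

theorem theorem2:
  "\<exists>(p :: com) (C :: nat). \<forall>(k :: nat) (n :: nat) (f :: nat list \<Rightarrow> ereal).
     k \<ge> 1 \<longrightarrow> n \<ge> 1 \<longrightarrow> Rbar_valued (cube {1..k} n) f \<longrightarrow>
     (\<exists>t s. exec p (input k n f) t s \<and> t \<le> C * (k ^ n)\<^sup>2 \<and>
        (accepts s \<longleftrightarrow> (\<exists>g. relaxation k n f g)) \<and>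
        (accepts s \<longrightarrow>
           (let g = result k s in
              relaxation k n f g \<and>
              (integer_valued (cube {1..k} n) f \<longrightarrow> half_integer_valued (cube {0..k} n) g) \<and>
              (n = 2 \<longrightarrow>
                 (\<forall>g'. relaxation k n f g' \<longrightarrow>
                    (\<forall>x \<in> dom_on (cube {0..k} n) g. g x \<ge> g' x)) \<and>
                 maximal_relaxation k n f g \<and>
                 (\<forall>h. maximal_relaxation k n f h \<longrightarrow> (\<forall>x \<in> cube {0..k} n. h x = g x))))))"
proof (rule exI[of _ relax_program], rule exI[of _ 1000], intro allI impI)
  fix k n :: nat and f :: "nat list \<Rightarrow> ereal"
  assume k: "k \<ge> 1" and n: "n \<ge> 1" and R: "Rbar_valued (cube {1..k} n) f"
  let ?F = "dom_on (cube {1..k} n) f"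
  have "run relax_program (input k n f) (1000 * (k ^ n)\<^sup>2) (\<lambda>s.
    (accepts s \<longleftrightarrow> (\<exists>g. relaxation k n f g)) \<and>
    (accepts s \<longrightarrow> relaxation k n f (result k s) \<and>
       (integer_valued (cube {1..k} n) f \<longrightarrow> half_integer_valued (cube {0..k} n) (result k s)) \<and>
       (n = 2 \<longrightarrow> (\<forall>h x. relaxation k n f h \<longrightarrow> x \<in> cube {0..k} n \<longrightarrow> h x \<le> result k s x))))"
    (is "run _ _ _ ?Q")
  proof (cases "k = 1")
    case True
    let ?g = "\<lambda>x. if x \<in> cube {1..1} n then f x else \<infinity>"
    let ?s = "input k n f\<lparr>ints := upd (ints (input k n f)) 2 0 1\<rparr>"
    have res: "result k ?s x = ?g x" if "x \<in> cube {0..k} n" for x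
      using result_input[OF that, of f] True by (simp add: result_def)
    have rel: "relaxation k n f (result k ?s)"
      by (rule relaxation_cong[OF res]) (use relaxation_unary_domain R True in auto)
    have "half_integer_valued (cube {0..k} n) (result k ?s)" if int: "integer_valued (cube {1..k} n) f"
    proof (rule half_integer_cong[OF res])
      show "half_integer_valued (cube {0..k} n) ?g"
        using int True by (fastforce simp: half_integer_valued_def integer_valued_def dom_on_def)
    qed
    \<comment> \<open>\<open>h\<close> coincides with \<open>f\<close> on the single point of [1]^n,
      and the result is infinite elsewhere.\<close>
    moreover have "h x \<le> result k ?s x" if "relaxation k n f h" "x \<in> cube {0..k} n" for h x
      unfolding res[OF that(2)] using that True by (auto simp: relaxation_def)
    moreover have "accepts ?s" by (simp add: accepts_def)
    ultimately have Q: "?Q ?s" using rel by blast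
    have t: "Suc 1 \<le> 1000 * (k ^ n)\<^sup>2" using True by simp
    have le: "\<not> holds (ILess (INum 1) (sc 0)) (input k n f)" using True by (simp add: input_def)
    show ?thesis unfolding relax_program_def
      by (subst wp_If, simp only: le if_False wp_ISet ival.simps, rule conjI[OF t Q])
  next
    case False
    then have "2 \<le> k" using k by simp
    from run_relax_program[OF this n R] show ?thesis
    proof (rule wp_mono, elim conjE, intro conjI)
      fix t s
      assume t: "t \<le> 1000 * (k ^ n)\<^sup>2" and acc: "accepts s \<longleftrightarrow> dd_closed ?F"
        and ex: "accepts s \<longrightarrow> (\<exists>b. 0 \<le> b \<and> (\<forall>x\<in>?F. \<bar>f x\<bar> \<le> ereal b) \<and>
          (integer_valued (cube {1..k} n) f \<longrightarrow> b \<in> \<int>) \<and>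
          (\<forall>x\<in>cube {0..k} n. result k s x = (if n = 2 then binary k f x else spread k n f b x)))"
      show "t \<le> 1000 * (k ^ n)\<^sup>2" by (rule t)
      let ?g = "result k s"
      have good: "relaxation k n f ?g \<and>
       (integer_valued (cube {1..k} n) f \<longrightarrow> half_integer_valued (cube {0..k} n) ?g) \<and>
       (n = 2 \<longrightarrow> (\<forall>h x. relaxation k n f h \<longrightarrow> x \<in> cube {0..k} n \<longrightarrow> h x \<le> ?g x))" if a: "accepts s"
      proof -
        have dd: "dd_closed ?F" using acc a by simp
        obtain b where b: "0 \<le> b" "\<And>x. x \<in> ?F \<Longrightarrow> \<bar>f x\<bar> \<le> ereal b"
            "integer_valued (cube {1..k} n) f \<Longrightarrow> b \<in> \<int>"
          and g: "\<And>x. x \<in> cube {0..k} n \<Longrightarrow> ?g x = (if n = 2 then binary k f x else spread k n f b x)"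
          using ex a by blast
        show ?thesis
        proof (cases "n = 2")
          case n2: True
          have g2: "?g x = binary k f x" if "x \<in> cube {0..k} n" for x using g[OF that] n2 by simp
          have "relaxation k n f ?g"
            by (rule relaxation_cong[OF g2]) (use binary_relaxation R dd n2 in auto)
          moreover have "half_integer_valued (cube {0..k} n) ?g" if "integer_valued (cube {1..k} n) f"
            by (rule half_integer_cong[OF g2]) (use binary_half_integer that R n2 in auto)
          ultimately show ?thesis using relaxation_le_binary g2 n2 by auto
        next
          case False
          have gs: "?g x = spread k n f b x" if "x \<in> cube {0..k} n" for x using g[OF that] False by simp
          have "relaxation k n f ?g"
            by (rule relaxation_cong[OF gs]) (use spread_relaxation[OF dd b(2,1)] in auto)
          moreover have "half_integer_valued (cube {0..k} n) ?g" if "integer_valued (cube {1..k} n) f"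
            by (rule half_integer_cong[OF gs]) (use spread_half_integer[OF that b(3)[OF that]] in auto)
          ultimately show ?thesis using False by blast
        qed
      qed
      show "accepts s \<longleftrightarrow> (\<exists>g. relaxation k n f g)"
        using good acc relaxation_imp_dd_closed by blast
      show "accepts s \<longrightarrow> relaxation k n f ?g \<and>
       (integer_valued (cube {1..k} n) f \<longrightarrow> half_integer_valued (cube {0..k} n) ?g) \<and>
       (n = 2 \<longrightarrow> (\<forall>h x. relaxation k n f h \<longrightarrow> x \<in> cube {0..k} n \<longrightarrow> h x \<le> ?g x))"
        using good by blast
    qed
  qed
  then obtain t s where ex: "exec relax_program (input k n f) t s" "t \<le> 1000 * (k ^ n)\<^sup>2" and Q: "?Q s"
    unfolding wp_def by blast
  have "maximal_relaxation k n f (result k s)"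
    "maximal_relaxation k n f h \<Longrightarrow> x \<in> cube {0..k} n \<Longrightarrow> h x = result k s x"
    if "accepts s" "n = 2" for h x
    using greatest_relaxation[of k n f "result k s"] Q that by blast+
  then show "\<exists>t s. exec relax_program (input k n f) t s \<and> t \<le> 1000 * (k ^ n)\<^sup>2 \<and>
        (accepts s \<longleftrightarrow> (\<exists>g. relaxation k n f g)) \<and>
        (accepts s \<longrightarrow>
           (let g = result k s in
              relaxation k n f g \<and>
              (integer_valued (cube {1..k} n) f \<longrightarrow> half_integer_valued (cube {0..k} n) g) \<and>
              (n = 2 \<longrightarrow>
                 (\<forall>g'. relaxation k n f g' \<longrightarrow>
                    (\<forall>x \<in> dom_on (cube {0..k} n) g. g x \<ge> g' x)) \<and>
                 maximal_relaxation k n f g \<and>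
                 (\<forall>h. maximal_relaxation k n f h \<longrightarrow> (\<forall>x \<in> cube {0..k} n. h x = g x)))))"
    using ex Q unfolding Let_def dom_on_def
    by (intro exI[of _ t] exI[of _ s] conjI impI; blast)
qed

end
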